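(* Let $(R,\mathfrak m)$ be a Noetherian graded ring of dimension $d$ over a field $R_0=K$ of positive characteristic $p$. Let $J=(x_1,\dots,x_n)$ be a homogeneous ideal of $R$, let $y\in R$ be a form of degree $e$, and set $I=J+Ry$. Assume that $\operatorname{height}(J:y)\ge d-1$. Then: (1) If $J$ satisfies $(LC)$, then $I$ satisfies $(LC)$. (2) If $J$ satisfies $(LC^* )$, then $I$ satisfies $(LC^* )$.
   Context: A Noetherian graded ring over a field $R_0=K$ is a commutative Noetherian ring $R=\bigoplus_{i\ge 0}R_i$ graded by the nonnegative integers with degree-zero part the field $K$; its irrelevant ideal is $\mathfrak m=\bigoplus_{i\ge1}R_i$. A form is a homogeneous element. $J:y=\{r\in R: ry\in J\}$. The letter $q$ always denotes a varying power $q=p^e$ of the characteristic $p$ (here the exponent is unrelated to $\deg y$). For an ideal $I$, $I^{[q]}$ is the ideal generated by the $q$th powers of all elements of $I$. $R^o$ is the set of elements of $R$ not in any minimal prime of $R$. The tight closure $I^*$ of $I$ is the set of $x\in R$ for which there is $c\in R^o$ with $cx^q\in I^{[q]}$ for all large $q$. $R_{\ge N}$ denotes the ideal of $R$ generated by all forms of degree at least $N$. A homogeneous ideal $I$ satisfies condition $(LC)$ if there is a constant $N$ such that for all $q$, $R_{\ge Nq}\cdot H^0_{\mathfrak m}(R/I^{[q]})=0$. A homogeneous ideal $I$ satisfies condition $(LC^* )$ if there is a constant $N$ such that for all $q$, $R_{\ge Nq}\cdot H^0_{\mathfrak m}(R/(I^{[q]})^* )=0$. Here $H^0_{\mathfrak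 m}(M)$ is the submodule of elements of $M$ killed by some power of $\mathfrak m$. *)

theory Defs
  imports
    "HOL-Algebra.Ring_Divisibility"
    "HOL-Algebra.Ideal_Product"
    "HOL-Algebra.QuotRing"
    "HOL-Algebra.Module"
    "HOL-Algebra.Subrings"
    "HOL-Library.Extended_Nat"
begin

definition ring_char :: "('a, 'b) ring_scheme \<Rightarrow> nat" where
  "ring_char R =
    (if \<exists>n>0. add_pow R (n::nat) \<one>\<^bsub>R\<^esub> = \<zero>\<^bsub>R\<^esub>
     then LEAST n. n > 0 \<and> add_pow R (n::nat) \<one>\<^bsub>R\<^esub> = \<zero>\<^bsub>R\<^esub> else 0)"

definition prime_chain :: "('a, 'b) ring_scheme \<Rightarrow> (nat \<Rightarrow> 'a set) \<Rightarrow> nat \<Rightarrow> bool" where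
  "prime_chain R C n \<longleftrightarrow> (\<forall>i\<le>n. primeideal (C i) R) \<and> (\<forall>i<n. C i \<subset> C (Suc i))"

definition krull_dim :: "('a, 'b) ring_scheme \<Rightarrow> enat" where
  "krull_dim R = Sup {enat n | n C. prime_chain R C n}"

definition prime_height :: "('a, 'b) ring_scheme \<Rightarrow> 'a set \<Rightarrow> enat" where
  "prime_height R P = Sup {enat n | n C. prime_chain R C n \<and> C n = P}"

text \<open>The infimum over the empty set is \<open>\<infinity>\<close>, so the unit ideal has height \<open>\<infinity>\<close>.\<close>

definition ideal_height :: "('a, 'b) ring_scheme \<Rightarrow> 'a set \<Rightarrow> enat" where
  "ideal_height R I = (INF P \<in> {P. primeideal P R \<and> I \<subseteq> P}. prime_height R P)"

definition minimal_prime :: "('a, 'b) ring_scheme \<Rightarrow> 'a set \<Rightarrow> bool" where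
  "minimal_prime R P \<longleftrightarrow> primeideal P R \<and> (\<forall>Q. primeideal Q R \<and> Q \<subseteq> P \<longrightarrow> Q = P)"

definition colon_elem :: "('a, 'b) ring_scheme \<Rightarrow> 'a set \<Rightarrow> 'a \<Rightarrow> 'a set" where
  "colon_elem R J y = {r \<in> carrier R. r \<otimes>\<^bsub>R\<^esub> y \<in> J}"

definition frob_power :: "('a, 'b) ring_scheme \<Rightarrow> 'a set \<Rightarrow> nat \<Rightarrow> 'a set" where
  "frob_power R I q = Idl\<^bsub>R\<^esub> {x [^]\<^bsub>R\<^esub> q | x. x \<in> I}"

definition ring_circ :: "('a, 'b) ring_scheme \<Rightarrow> 'a set" where
  "ring_circ R = {c \<in> carrier R. \<forall>P. minimal_prime R P \<longrightarrow> c \<notin> P}"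

definition tight_closure :: "('a, 'b) ring_scheme \<Rightarrow> nat \<Rightarrow> 'a set \<Rightarrow> 'a set" where
  "tight_closure R p I =
    {x \<in> carrier R. \<exists>c \<in> ring_circ R. \<exists>e\<^sub>0. \<forall>e\<ge>e\<^sub>0.
       c \<otimes>\<^bsub>R\<^esub> (x [^]\<^bsub>R\<^esub> (p ^ e)) \<in> frob_power R I (p ^ e)}"

text \<open>In the decomposition axiom, \<open>f\<close> is the family of homogeneous components of \<open>x\<close>;
  uniqueness says that the sum of the \<open>G i\<close> is direct.\<close>

locale graded_ring = ring R for R (structure) +
  fixes G :: "nat \<Rightarrow> 'a set"
  assumes grade_subgroup: "additive_subgroup (G i) R"
    and grade_one: "\<one> \<in> G 0"
    and grade_mult: "a \<in> G i \<Longrightarrow> b \<in> G j \<Longrightarrow> a \<otimes> b \<in> G (i + j)"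
    and grade_decomp: "x \<in> carrier R \<Longrightarrow>
      \<exists>!f. (\<forall>i. f i \<in> G i) \<and> finite {i. f i \<noteq> \<zero>} \<and> x = finsum R f {i. f i \<noteq> \<zero>}"

definition forms :: "(nat \<Rightarrow> 'a set) \<Rightarrow> 'a set" where
  "forms G = (\<Union>i. G i)"

definition homogeneous_ideal :: "('a, 'b) ring_scheme \<Rightarrow> (nat \<Rightarrow> 'a set) \<Rightarrow> 'a set \<Rightarrow> bool" where
  "homogeneous_ideal R G I \<longleftrightarrow> ideal I R \<and> I = Idl\<^bsub>R\<^esub> (I \<inter> forms G)"

definition irrelevant_ideal :: "('a, 'b) ring_scheme \<Rightarrow> (nat \<Rightarrow> 'a set) \<Rightarrow> 'a set" where
  "irrelevant_ideal R G = {finsum R f A | f A. finite A \<and> (\<forall>i\<in>A. 1 \<le> i \<and> f i \<in> G i)}"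

definition ideal_ge :: "('a, 'b) ring_scheme \<Rightarrow> (nat \<Rightarrow> 'a set) \<Rightarrow> nat \<Rightarrow> 'a set" where
  "ideal_ge R G N = Idl\<^bsub>R\<^esub> (\<Union>i\<in>{N..}. G i)"

text \<open>\<open>R/I\<close> as an \<open>R\<close>-module; the fields \<^const>\<open>mult\<close> and \<^const>\<open>one\<close>, which the record
  type also requires, are those of the quotient ring.\<close>

definition quot_module :: "('a, 'b) ring_scheme \<Rightarrow> 'a set \<Rightarrow> ('a, 'a set) module" where
  "quot_module R I =
    \<lparr>carrier = carrier (R Quot I), mult = mult (R Quot I), one = one (R Quot I),
     zero = zero (R Quot I), add = add (R Quot I),
     smult = (\<lambda>r X. (I +>\<^bsub>R\<^esub> r) \<otimes>\<^bsub>R Quot I\<^esub> X)\<rparr>"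

lemma quot_module_is_module:
  assumes "cring R" and "ideal I R"
  shows "module R (quot_module R I)"
proof -
  interpret R: cring R by fact
  interpret I: ideal I R by fact
  interpret Q: ring "R Quot I" by (rule I.quotient_is_ring)
  interpret h: ring_hom_ring R "R Quot I" "(+>\<^bsub>R\<^esub>) I" by (rule I.rcos_ring_hom_ring)
  show ?thesis
  proof (rule moduleI)
    show "cring R" by fact
    show "abelian_group (quot_module R I)"
      using Q.a_assoc Q.a_comm Q.l_neg
      by (intro abelian_groupI)
         (auto simp: quot_module_def Q.a_assoc intro: Q.a_comm bexI[of _ "a_inv (R Quot I) x" for x])
    show "\<one>\<^bsub>R\<^esub> \<odot>\<^bsub>quot_module R I\<^esub> X = X" if "X \<in> carrier (quot_module R I)" for X
      using Q.l_one[of X] h.hom_one that by (simp add: quot_module_def)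
  qed (auto simp: quot_module_def Q.l_distr Q.r_distr Q.m_assoc)
qed

text \<open>\<open>H\<^sup>0\<^sub>\<mm>(M)\<close>; the power of the ideal is taken in the monoid of ideals of \<open>R\<close>.\<close>

definition H0 :: "('a, 'b) ring_scheme \<Rightarrow> 'a set \<Rightarrow> ('a, 'c, 'd) module_scheme \<Rightarrow> 'c set" where
  "H0 R \<mm> M =
    {u \<in> carrier M. \<exists>k::nat. \<forall>r \<in> \<mm> [^]\<^bsub>ideals_set R\<^esub> k. r \<odot>\<^bsub>M\<^esub> u = \<zero>\<^bsub>M\<^esub>}"

definition satisfies_LC ::
    "('a, 'b) ring_scheme \<Rightarrow> (nat \<Rightarrow> 'a set) \<Rightarrow> nat \<Rightarrow> 'a set \<Rightarrow> bool" where
  "satisfies_LC R G p I \<longleftrightarrow> homogeneous_ideal R G I \<and>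
    (\<exists>N::nat. \<forall>e::nat.
       let M = quot_module R (frob_power R I (p ^ e)) in
       \<forall>r \<in> ideal_ge R G (N * p ^ e). \<forall>u \<in> H0 R (irrelevant_ideal R G) M.
         r \<odot>\<^bsub>M\<^esub> u = \<zero>\<^bsub>M\<^esub>)"

definition satisfies_LC_star ::
    "('a, 'b) ring_scheme \<Rightarrow> (nat \<Rightarrow> 'a set) \<Rightarrow> nat \<Rightarrow> 'a set \<Rightarrow> bool" where
  "satisfies_LC_star R G p I \<longleftrightarrow> homogeneous_ideal R G I \<and>
    (\<exists>N::nat. \<forall>e::nat.
       let M = quot_module R (tight_closure R p (frob_power R I (p ^ e))) in
       \<forall>r \<in> ideal_ge R G (N * p ^ e). \<forall>u \<in> H0 R (irrelevant_ideal R G) M.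
         r \<odot>\<^bsub>M\<^esub> u = \<zero>\<^bsub>M\<^esub>)"

end

theory Submission
  imports Defs "HOL-Computational_Algebra.Primes"
begin

text \<open>Let \<open>A = J : y\<close>. The height hypothesis leaves no room for a chain of homogeneous primes
  \<open>A \<subseteq> P \<subset> Q \<subset> \<mm>\<close>, so prime avoidance gives a form \<open>z\<close> of positive degree with \<open>\<mm>\<close> in the radical
  of \<open>A + Rz\<close>; hence \<open>R\<^bsub>\<ge>cq\<^esub> \<subseteq> z\<^sup>q R + A\<^bsup>[q]\<^esup>\<close> with \<open>c\<close> independent of \<open>q\<close>. If \<open>u\<close> has degree at
  least \<open>(c + e) q\<close> and is killed by a power of \<open>\<mm>\<close> modulo \<open>I\<^bsup>[q]\<^esup> = J\<^bsup>[q]\<^esup> + R y\<^sup>q\<close>, write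
  \<open>z\<^sup>k u = j + a y\<^sup>q\<close> and \<open>a = b z\<^sup>k + v\<close> with \<open>v \<in> A\<^bsup>[q]\<^esup>\<close>. Then \<open>u - b y\<^sup>q\<close> is killed by a power of
  \<open>\<mm>\<close> modulo \<open>J\<^bsup>[q]\<^esup>\<close>, and (LC) for \<open>J\<close> applies to it.

  For (LC*) the argument is run with \<open>c u\<^bsup>q'\<^esup>\<close> in place of \<open>u\<close>, and one needs a single
  \<open>c\<^sub>1 \<in> R\<^sup>o\<close> and \<open>q\<^sub>0\<close> with \<open>c\<^sub>1 x\<^bsup>q\<^sub>0\<^esup> \<in> L\<^bsup>[q\<^sub>0]\<^esup>\<close> whenever \<open>x \<in> L\<^sup>*\<close>. Such a weak test element
  exists because each \<open>R/P\<close> is a finitely generated domain over a field: adjoining one generator at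
  a time, one constructs for every \<open>d \<noteq> 0\<close> and all large \<open>q\<close> an additive map \<open>\<Theta>\<close> with
  \<open>\<Theta>(s\<^sup>q b) = s\<^bsup>q\<^sub>0\<^esup> \<Theta>(b)\<close> whose value at \<open>d\<close> does not depend on \<open>d\<close>.\<close>

section \<open>Frobenius powers and tight closure\<close>

text \<open>Two uniformity problems shape the proof. The exponent k with which z^k moves u into
  I^[q] is unbounded, whereas only a loss of degree linear in q is allowed. So one divides by z^q
  repeatedly: each round costs exactly the degree of z^q, and the surplus c q is paid once. This
  requires cutting quotients and remainders down to high degrees, which stays inside the ideals
  because they are homogeneous. For tight closure, the multiplier must not depend on q', and R may
  have nilpotents while K may have infinite degree over K^p. Both are absorbed by the fixed power
  q_0 of the test: a generator that is inseparable becomes separable after a p-power is taken, and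
  nilpotent errors die under a further one. In the separable case a denominator
  \<open>\<beta>\<close> has to be cleared to the power q; semilinearity turns this factor into
  \<open>\<beta>\<close> to the power q_0, and this is why the value at d is independent of
  q.\<close>

lemma (in cring) ideal_if_closed:
  assumes "I \<subseteq> carrier R" "\<zero> \<in> I"
    and "\<And>a b. a \<in> I \<Longrightarrow> b \<in> I \<Longrightarrow> a \<oplus> b \<in> I"
    and "\<And>a r. a \<in> I \<Longrightarrow> r \<in> carrier R \<Longrightarrow> r \<otimes> a \<in> I"
  shows "ideal I R"
proof (rule idealI[OF ring_axioms])
  have neg: "\<ominus> a \<in> I" if "a \<in> I" for a
  proof -
    have "(\<ominus> \<one>) \<otimes> a = \<ominus> a"
      using that assms(1) by (simp add: l_minus subsetD)
    then show ?thesis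
      using assms(4)[OF that, of "\<ominus> \<one>"] by simp
  qed
  show "subgroup I (add_monoid R)"
    by (rule add.subgroupI) (use assms neg in auto)
  show "x \<otimes> a \<in> I" "a \<otimes> x \<in> I" if "a \<in> I" "x \<in> carrier R" for a x
    using assms(1,4) that m_comm by (auto simp: subset_eq)
qed

lemma (in ring) ideal_props:
  assumes "ideal I R"
  shows "I \<subseteq> carrier R" "\<And>a. a \<in> I \<Longrightarrow> a \<in> carrier R" "\<zero> \<in> I"
    "\<And>a b. a \<in> I \<Longrightarrow> b \<in> I \<Longrightarrow> a \<oplus> b \<in> I"
    "\<And>a b. a \<in> I \<Longrightarrow> b \<in> I \<Longrightarrow> a \<ominus> b \<in> I"
    "\<And>a r. a \<in> I \<Longrightarrow> r \<in> carrier R \<Longrightarrow> r \<otimes> a \<in> I"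
    "\<And>a r. a \<in> I \<Longrightarrow> r \<in> carrier R \<Longrightarrow> a \<otimes> r \<in> I"
proof -
  interpret I: ideal I R by fact
  show "I \<subseteq> carrier R" "\<And>a. a \<in> I \<Longrightarrow> a \<in> carrier R" "\<zero> \<in> I"
    "\<And>a b. a \<in> I \<Longrightarrow> b \<in> I \<Longrightarrow> a \<oplus> b \<in> I"
    "\<And>a b. a \<in> I \<Longrightarrow> b \<in> I \<Longrightarrow> a \<ominus> b \<in> I"
    "\<And>a r. a \<in> I \<Longrightarrow> r \<in> carrier R \<Longrightarrow> r \<otimes> a \<in> I"
    "\<And>a r. a \<in> I \<Longrightarrow> r \<in> carrier R \<Longrightarrow> a \<otimes> r \<in> I"
    using I.a_subset by (auto simp: a_minus_def I.I_l_closed I.I_r_closed)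
qed

lemma (in cring) ideal_pow_closed:
  assumes "ideal I R" "x \<in> I" "0 < (n::nat)"
  shows "x [^] n \<in> I"
  using assms by (cases n) (auto intro: ideal_props)

lemma (in cring) binomial:
  assumes "a \<in> carrier R" "b \<in> carrier R"
  shows "(a \<oplus> b) [^] (n::nat) = (\<Oplus>k\<in>{..n}. [(n choose k)] \<cdot> (a [^] k \<otimes> b [^] (n - k)))"
proof (induction n)
  case 0
  then show ?case using assms by simp
next
  case (Suc n)
  let ?t = "\<lambda>n k. [(n choose k)] \<cdot> (a [^] k \<otimes> b [^] (n - k))"
  have t: "?t n k \<in> carrier R" for n k using assms by simp
  let ?u = "\<lambda>k. [(n choose k)] \<cdot> (a [^] Suc k \<otimes> b [^] (n - k))"
  let ?v = "\<lambda>k. [(n choose Suc k)] \<cdot> (a [^] Suc k \<otimes> b [^] (n - k))"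
  let ?w = "\<lambda>k. [(n choose k)] \<cdot> (a [^] k \<otimes> b [^] (Suc n - k))"
  have c: "?u k \<in> carrier R" "?v k \<in> carrier R" "?w k \<in> carrier R" for k using assms by auto
  have "(\<Oplus>k\<in>{..n}. ?t n k) \<otimes> a = (\<Oplus>k\<in>{..n}. ?u k)"
    unfolding finsum_ldistr[OF finite_atMost assms(1) Pi_I[OF t]]
    using assms by (intro finsum_cong) (auto simp: add_pow_ldistr m_ac add_pow_rdistr simp_implies_def)
  moreover have "(\<Oplus>k\<in>{..n}. ?t n k) \<otimes> b = (\<Oplus>k\<in>{..n}. ?w k)"
    unfolding finsum_ldistr[OF finite_atMost assms(2) Pi_I[OF t]]
    using assms by (intro finsum_cong) (auto simp: add_pow_ldistr m_assoc Suc_diff_le simp_implies_def)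
  \<comment> \<open>The added summand has coefficient \<open>n choose Suc n\<close>, which is 0.
    With it, splitting off k = 0 leaves a sum over the same range as \<open>?u\<close>, ready for
    Pascal's rule.\<close>
  moreover have "(\<Oplus>k\<in>{..n}. ?w k) = (\<Oplus>k\<in>{..Suc n}. ?w k)"
    using assms by (simp add: finsum_Suc Pi_def binomial_eq_0)
  moreover have "\<dots> = (\<Oplus>k\<in>{..n}. ?v k) \<oplus> ?w 0"
    using finsum_Suc2[of ?w n] c by (simp add: Pi_def)
  ultimately have "(\<Oplus>k\<in>{..n}. ?t n k) \<otimes> (a \<oplus> b) = (\<Oplus>k\<in>{..n}. ?u k) \<oplus> ((\<Oplus>k\<in>{..n}. ?v k) \<oplus> ?w 0)"
    using assms t by (simp add: r_distr Pi_def)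
  also have "\<dots> = (\<Oplus>k\<in>{..n}. ?u k \<oplus> ?v k) \<oplus> ?w 0"
    using c finsum_addf[of ?u "{..n}" ?v]
      a_assoc[OF finsum_closed[of ?u] finsum_closed[of ?v] c(3)] by (simp only: Pi_I)
  also have "\<dots> = (\<Oplus>k\<in>{..n}. ?t (Suc n) (Suc k)) \<oplus> ?t (Suc n) 0"
    using assms by (simp add: add.nat_pow_mult)
  also have "\<dots> = (\<Oplus>k\<in>{..Suc n}. ?t (Suc n) k)"
    by (rule finsum_Suc2[symmetric]) (use t in auto)
  finally show ?case using Suc by simp
qed

section \<open>Additivity of the Frobenius map\<close>

locale cring_char_p = cring R for R (structure) +
  fixes p :: nat
  assumes prime_p: "prime p" and char_p: "[p] \<cdot> \<one> = \<zero>"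
begin

lemma p_gt_0 [simp]: "0 < p"
  using prime_p prime_gt_0_nat by blast

lemma add_pow_p_multiple:
  assumes "p dvd n" "x \<in> carrier R"
  shows "[n] \<cdot> x = \<zero>"
proof -
  obtain k where n: "n = k * p" using assms(1) by (metis dvd_def mult.commute)
  have "[p] \<cdot> x = ([p] \<cdot> \<one>) \<otimes> x"
    using assms(2) by (simp add: add_pow_ldistr)
  then have "[p] \<cdot> x = \<zero>" using char_p assms(2) by simp
  then show ?thesis
    using add.nat_pow_pow[of x k p] assms(2) by (simp add: n mult.commute)
qed

lemma frob_add_p:
  assumes [simp]: "a \<in> carrier R" "b \<in> carrier R"
  shows "(a \<oplus> b) [^] p = a [^] p \<oplus> b [^] p"
proof -
  let ?t = "\<lambda>k. [(p choose k)] \<cdot> (a [^] k \<otimes> b [^] (p - k))"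
  have "(a \<oplus> b) [^] p = (\<Oplus>k\<in>{..p}. ?t k)" by (simp add: binomial)
  also have "\<dots> = (\<Oplus>k\<in>{0, p}. ?t k)"
  proof (rule add.finprod_mono_neutral_cong_right)
    fix i assume "i \<in> {..p} - {0, p}"
    then have "p dvd (p choose i)" by (intro dvd_choose_prime) (use prime_p in auto)
    then show "?t i = \<zero>" by (simp add: add_pow_p_multiple)
  qed auto
  also have "\<dots> = a [^] p \<oplus> b [^] p"
    using p_gt_0 by (simp add: finsum_insert a_comm del: p_gt_0)
  finally show ?thesis .
qed

lemma frob_add:
  assumes [simp]: "a \<in> carrier R" "b \<in> carrier R"
  shows "(a \<oplus> b) [^] (p ^ f) = a [^] (p ^ f) \<oplus> b [^] (p ^ f)"
proof (induction f)
  case (Suc f)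
  have "x [^] (p ^ Suc f) = (x [^] (p ^ f)) [^] p" if "x \<in> carrier R" for x
    using nat_pow_pow[OF that, of "p ^ f" p] by (simp add: mult.commute)
  then show ?case by (simp add: Suc frob_add_p)
qed simp

lemma zero_pow_p [simp]: "\<zero> [^] (p ^ f) = \<zero>"
  by (simp add: nat_pow_zero)

lemma frob_minus:
  assumes [simp]: "a \<in> carrier R"
  shows "(\<ominus> a) [^] (p ^ f) = \<ominus> (a [^] (p ^ f))"
  using frob_add[of "\<ominus> a" a f] by (simp add: l_neg minus_equality)

lemma frob_diff:
  assumes [simp]: "a \<in> carrier R" "b \<in> carrier R"
  shows "(a \<ominus> b) [^] (p ^ f) = a [^] (p ^ f) \<ominus> b [^] (p ^ f)"
  by (simp add: a_minus_def frob_add frob_minus)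

end

section \<open>Ideals generated by q-th powers, and colon ideals\<close>

context cring
begin

lemma frob_power_ideal:
  assumes "I \<subseteq> carrier R" shows "ideal (frob_power R I q) R"
  unfolding frob_power_def by (rule genideal_ideal) (use assms in auto)

lemma frob_power_mem:
  assumes "I \<subseteq> carrier R" "x \<in> I" shows "x [^] q \<in> frob_power R I q"
  unfolding frob_power_def
  by (rule subsetD[OF genideal_self]) (use assms in auto)

lemma frob_power_minimal:
  assumes "ideal L R" "\<And>x. x \<in> I \<Longrightarrow> x [^] q \<in> L"
  shows "frob_power R I q \<subseteq> L"
  unfolding frob_power_def by (rule genideal_minimal) (use assms in auto)

lemma frob_power_mono:
  assumes "I \<subseteq> L" "L \<subseteq> carrier R" shows "frob_power R I q \<subseteq> frob_power R L q"
  using assms by (intro frob_power_minimal frob_power_ideal frob_power_mem) auto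

lemma colon_ideal:
  assumes "ideal I R" "y \<in> carrier R"
  shows "ideal (colon_elem R I y) R"
  unfolding colon_elem_def
  by (rule ideal_if_closed) (use assms in \<open>auto simp: l_distr m_assoc intro: ideal_props\<close>)

text \<open>The ideal J^[q] : y^q contains x^q for every x in J : y, hence all of (J : y)^[q]. So
  the error of a division modulo (J : y)^[q] disappears once it is multiplied by y^q.\<close>

lemma colon_frob_power:
  assumes "ideal J R" "y \<in> carrier R" "w \<in> frob_power R (colon_elem R J y) q"
  shows "w \<otimes> y [^] q \<in> frob_power R J q"
proof -
  have J: "J \<subseteq> carrier R" using assms(1) ideal_props by blast
  have "frob_power R (colon_elem R J y) q \<subseteq> colon_elem R (frob_power R J q) (y [^] q)"
  proof (rule frob_power_minimal)
    show "ideal (colon_elem R (frob_power R J q) (y [^] q)) R"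
      by (intro colon_ideal frob_power_ideal) (use J assms in auto)
    fix x assume "x \<in> colon_elem R J y"
    then have x: "x \<in> carrier R" "x \<otimes> y \<in> J" by (auto simp: colon_elem_def)
    then have "x [^] q \<otimes> y [^] q \<in> frob_power R J q"
      using frob_power_mem[OF J x(2), of q] assms(2) by (simp add: nat_pow_distrib)
    then show "x [^] q \<in> colon_elem R (frob_power R J q) (y [^] q)"
      using x by (simp add: colon_elem_def)
  qed
  then show ?thesis using assms(3) by (auto simp: colon_elem_def)
qed

end

context cring_char_p
begin

lemma pow_pow: "x \<in> carrier R \<Longrightarrow> (x [^] (p ^ a)) [^] (p ^ b) = x [^] (p ^ (a + b))"
  by (simp add: nat_pow_pow power_add)

lemma root_ideal:
  assumes "ideal L R" shows "ideal {x \<in> carrier R. x [^] (p ^ f) \<in> L} R"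
  by (rule ideal_if_closed)
     (use assms in \<open>auto simp: frob_add nat_pow_distrib intro: ideal_props\<close>)

text \<open>Since Frobenius is additive, the elements whose q-th power lies in a given ideal form an
  ideal, and it is enough to know that this ideal contains \<open>S\<close>.\<close>

lemma frob_power_Idl:
  assumes "S \<subseteq> carrier R"
  shows "frob_power R (Idl S) (p ^ f) = Idl {x [^] (p ^ f) | x. x \<in> S}"
proof
  let ?L = "Idl {x [^] (p ^ f) | x. x \<in> S}"
  have c: "{x [^] (p ^ f) | x. x \<in> S} \<subseteq> carrier R" using assms by auto
  have L: "ideal ?L R" by (rule genideal_ideal[OF c])
  have "Idl S \<subseteq> {x \<in> carrier R. x [^] (p ^ f) \<in> ?L}"
    by (rule genideal_minimal[OF root_ideal[OF L]]) (use assms genideal_self[OF c] in auto)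
  then show "frob_power R (Idl S) (p ^ f) \<subseteq> ?L"
    by (intro frob_power_minimal[OF L]) auto
  have "Idl S \<subseteq> carrier R" using genideal_ideal[OF assms] ideal_props by blast
  then show "?L \<subseteq> frob_power R (Idl S) (p ^ f)"
    by (intro genideal_minimal[OF frob_power_ideal])
       (use genideal_self[OF assms] in \<open>auto intro!: frob_power_mem\<close>)
qed

lemma frob_power_frob_power:
  assumes "I \<subseteq> carrier R"
  shows "frob_power R (frob_power R I (p ^ a)) (p ^ b) = frob_power R I (p ^ (a + b))"
proof -
  have *: "{x [^] (p ^ b) |x. \<exists>y. x = y [^] (p ^ a) \<and> y \<in> I} = {x [^] (p ^ (a + b)) |x. x \<in> I}"
    using assms by (force simp: pow_pow subset_eq)
  have "frob_power R (frob_power R I (p ^ a)) (p ^ b) =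
      Idl {x [^] (p ^ b) |x. x \<in> {y [^] (p ^ a) |y. y \<in> I}}"
    unfolding frob_power_def[of R I "p ^ a"] by (rule frob_power_Idl) (use assms in auto)
  then show ?thesis using * by (simp add: frob_power_def)
qed

lemma frob_power_sum:
  assumes J: "ideal J R" and y: "y \<in> carrier R" and I: "I = J <+>\<^bsub>R\<^esub> (PIdl y)"
    and u: "u \<in> frob_power R I (p ^ f)"
  shows "\<exists>j \<in> frob_power R J (p ^ f). \<exists>a \<in> carrier R. u = j \<oplus> a \<otimes> y [^] (p ^ f)"
proof -
  let ?L = "frob_power R J (p ^ f) <+>\<^bsub>R\<^esub> (PIdl (y [^] (p ^ f)))"
  have Jc: "J \<subseteq> carrier R" using J ideal_props by blast
  have "frob_power R I (p ^ f) \<subseteq> ?L"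
  proof (rule frob_power_minimal)
    show "ideal ?L R" by (intro add_ideals frob_power_ideal cgenideal_ideal) (use Jc y in auto)
    fix x assume "x \<in> I"
    then obtain j a where j: "j \<in> J" "a \<in> carrier R" "x = j \<oplus> a \<otimes> y"
      by (auto simp: I set_add_def' cgenideal_def)
    have "x [^] (p ^ f) = j [^] (p ^ f) \<oplus> a [^] (p ^ f) \<otimes> y [^] (p ^ f)"
      using j Jc y by (auto simp: frob_add nat_pow_distrib)
    then show "x [^] (p ^ f) \<in> ?L"
      using frob_power_mem[OF Jc j(1), of "p ^ f"] nat_pow_closed[OF j(2), of "p ^ f"]
      unfolding set_add_def' cgenideal_def by blast
  qed
  then show ?thesis using u unfolding set_add_def' cgenideal_def by blast
qed

end

section \<open>The multipliers R^o and basic properties of tight closure\<close>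

lemma (in cring) ring_circ_mult:
  assumes "a \<in> ring_circ R" "b \<in> ring_circ R" shows "a \<otimes> b \<in> ring_circ R"
  using assms primeideal.I_prime unfolding ring_circ_def minimal_prime_def by fastforce

lemma (in cring) one_ring_circ: "\<one> \<in> ring_circ R"
  unfolding ring_circ_def minimal_prime_def
  by (auto dest: primeideal.I_notcarr ideal.one_imp_carrier[OF primeideal.axioms(1)])

lemma (in cring) ring_circ_pow:
  "a \<in> ring_circ R \<Longrightarrow> a [^] (n::nat) \<in> ring_circ R"
  by (induction n) (auto simp: one_ring_circ ring_circ_mult)

lemma (in cring) ring_circ_carrier: "a \<in> ring_circ R \<Longrightarrow> a \<in> carrier R"
  by (simp add: ring_circ_def)

context cring_char_p
begin

lemma tight_closure_ideal:
  assumes "I \<subseteq> carrier R" shows "ideal (tight_closure R p I) R"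
proof (rule ideal_if_closed)
  note F = frob_power_ideal[OF assms]
  show "tight_closure R p I \<subseteq> carrier R" by (auto simp: tight_closure_def)
  show "\<zero> \<in> tight_closure R p I"
    unfolding tight_closure_def using ideal_props(3)[OF F]
    by (auto intro!: bexI[OF _ one_ring_circ] simp del: nat_pow_one)
  fix a assume "a \<in> tight_closure R p I"
  then obtain c e where c: "c \<in> ring_circ R" "\<And>f. f \<ge> e \<Longrightarrow> c \<otimes> a [^] (p ^ f) \<in> frob_power R I (p ^ f)"
    and a: "a \<in> carrier R" by (auto simp: tight_closure_def)
  note cc = ring_circ_carrier[OF c(1)]
  {
    fix r assume r: "r \<in> carrier R"
    have "c \<otimes> (r \<otimes> a) [^] (p ^ f) = r [^] (p ^ f) \<otimes> (c \<otimes> a [^] (p ^ f))" for f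
      using r a cc by (simp add: nat_pow_distrib m_lcomm)
    then have "c \<otimes> (r \<otimes> a) [^] (p ^ f) \<in> frob_power R I (p ^ f)" if "f \<ge> e" for f
      using c(2)[OF that] r F by (auto intro: ideal_props)
    then show "r \<otimes> a \<in> tight_closure R p I"
      unfolding tight_closure_def using c(1) a r by auto
  }
  fix b assume "b \<in> tight_closure R p I"
  then obtain d e' where d: "d \<in> ring_circ R" "\<And>f. f \<ge> e' \<Longrightarrow> d \<otimes> b [^] (p ^ f) \<in> frob_power R I (p ^ f)"
    and b: "b \<in> carrier R" by (auto simp: tight_closure_def)
  note dd = ring_circ_carrier[OF d(1)]
  have "(c \<otimes> d) \<otimes> (a \<oplus> b) [^] (p ^ f) \<in> frob_power R I (p ^ f)" if "f \<ge> max e e'" for f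
  proof -
    have "(c \<otimes> d) \<otimes> (a \<oplus> b) [^] (p ^ f) = d \<otimes> (c \<otimes> a [^] (p ^ f)) \<oplus> c \<otimes> (d \<otimes> b [^] (p ^ f))"
      using a b cc dd by (simp add: frob_add r_distr m_ac)
    then show ?thesis using c(2)[of f] d(2)[of f] that cc dd F by (auto intro!: ideal_props(4)[OF F] ideal_props(6)[OF F])
  qed
  then show "a \<oplus> b \<in> tight_closure R p I"
    unfolding tight_closure_def using ring_circ_mult[OF c(1) d(1)] a b by blast
qed

lemma tight_closure_superset:
  assumes "I \<subseteq> carrier R" shows "I \<subseteq> tight_closure R p I"
  unfolding tight_closure_def using assms frob_power_mem[OF assms]
  by (auto intro!: bexI[OF _ one_ring_circ])

end

section \<open>Polynomial expressions in one element over a subring\<close>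

text \<open>Coefficients run from the constant term upwards and trailing zeros are allowed, so an
  element of B[t] has many lists. Maps out of B[t] are therefore built on lists first and then shown
  to ignore the choice.\<close>

primrec horner :: "('a, 'b) ring_scheme \<Rightarrow> 'a \<Rightarrow> 'a list \<Rightarrow> 'a" where
  "horner R t [] = \<zero>\<^bsub>R\<^esub>"
| "horner R t (a # as) = a \<oplus>\<^bsub>R\<^esub> t \<otimes>\<^bsub>R\<^esub> horner R t as"

definition adjoin :: "('a, 'b) ring_scheme \<Rightarrow> 'a set \<Rightarrow> 'a \<Rightarrow> 'a set" where
  "adjoin R B t = {horner R t as | as. set as \<subseteq> B}"

fun list_add :: "('a, 'b) ring_scheme \<Rightarrow> 'a list \<Rightarrow> 'a list \<Rightarrow> 'a list" where
  "list_add R [] bs = bs"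
| "list_add R as [] = as"
| "list_add R (a # as) (b # bs) = (a \<oplus>\<^bsub>R\<^esub> b) # list_add R as bs"

fun lincomb :: "('a, 'b) ring_scheme \<Rightarrow> 'a list \<Rightarrow> 'a list \<Rightarrow> 'a" where
  "lincomb R (c # cs) (w # ws) = c \<otimes>\<^bsub>R\<^esub> w \<oplus>\<^bsub>R\<^esub> lincomb R cs ws"
| "lincomb R _ _ = \<zero>\<^bsub>R\<^esub>"

lemma list_add_Nil2 [simp]: "list_add R as [] = as"
  by (cases as) auto

lemma length_list_add [simp]: "length (list_add R as bs) = max (length as) (length bs)"
  by (induction as bs rule: list_induct2') auto

lemma set_list_add:
  assumes "\<And>a b. a \<in> B \<Longrightarrow> b \<in> B \<Longrightarrow> a \<oplus>\<^bsub>R\<^esub> b \<in> B" "set as \<subseteq> B" "set bs \<subseteq> B"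
  shows "set (list_add R as bs) \<subseteq> B"
  using assms by (induction as bs rule: list_induct2') auto

lemma list_add_snoc:
  "length as = length bs \<Longrightarrow> list_add R (as @ [a]) (bs @ [b]) = list_add R as bs @ [a \<oplus>\<^bsub>R\<^esub> b]"
  by (induction as bs rule: list_induct2) auto

lemma map_list_add:
  assumes "\<And>a b. a \<in> B \<Longrightarrow> b \<in> B \<Longrightarrow> f (a \<oplus>\<^bsub>R\<^esub> b) = f a \<oplus>\<^bsub>R\<^esub> f b" "set as \<subseteq> B" "set bs \<subseteq> B"
  shows "map f (list_add R as bs) = list_add R (map f as) (map f bs)"
  using assms by (induction as bs rule: list_induct2') auto

context cring
begin

lemma horner_closed [simp]: "t \<in> carrier R \<Longrightarrow> set as \<subseteq> carrier R \<Longrightarrow> horner R t as \<in> carrier R"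
  by (induction as) auto

lemma horner_in_subring:
  "subring C R \<Longrightarrow> t \<in> C \<Longrightarrow> set as \<subseteq> C \<Longrightarrow> horner R t as \<in> C"
  by (induction as) (auto simp: subringE)

lemma horner_list_add:
  assumes "t \<in> carrier R" "set as \<subseteq> carrier R" "set bs \<subseteq> carrier R"
  shows "horner R t (list_add R as bs) = horner R t as \<oplus> horner R t bs"
  using assms(2,3)
proof (induction as bs rule: list_induct2')
  case (4 a as b bs)
  then have "a \<in> carrier R" "b \<in> carrier R" "horner R t as \<in> carrier R" "horner R t bs \<in> carrier R"
    using assms(1) by auto
  with 4 assms(1) show ?case by (simp add: r_distr a_ac)
qed (use assms in auto)

lemma horner_map_mult:
  assumes "t \<in> carrier R" "s \<in> carrier R" "set as \<subseteq> carrier R"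
  shows "horner R t (map ((\<otimes>) s) as) = s \<otimes> horner R t as"
  using assms(3) by (induction as) (use assms in \<open>auto simp: r_distr m_lcomm\<close>)

lemma horner_append:
  assumes "t \<in> carrier R" "set as \<subseteq> carrier R" "set bs \<subseteq> carrier R"
  shows "horner R t (as @ bs) = horner R t as \<oplus> t [^] length as \<otimes> horner R t bs"
  using assms(2)
proof (induction as)
  case (Cons a as)
  have "t [^] length as \<in> carrier R" using assms(1) by simp
  with Cons show ?case using assms
    by (simp add: r_distr a_assoc m_assoc m_comm[of _ t] m_lcomm)
qed (use assms in simp)

lemma horner_zeros: "t \<in> carrier R \<Longrightarrow> set as \<subseteq> {\<zero>} \<Longrightarrow> horner R t as = \<zero>"
  by (induction as) auto

lemma horner_snoc_zero:
  assumes "t \<in> carrier R" "set as \<subseteq> carrier R"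
  shows "horner R t (as @ replicate k \<zero>) = horner R t as"
  using assms horner_append[OF assms, of "replicate k \<zero>"] by (simp add: horner_zeros set_replicate_conv_if)

lemma horner_shift:
  assumes "t \<in> carrier R" "set as \<subseteq> carrier R"
  shows "horner R t (replicate k \<zero> @ as) = t [^] k \<otimes> horner R t as"
  using assms horner_append[OF assms(1) _ assms(2), of "replicate k \<zero>"]
  by (simp add: horner_zeros set_replicate_conv_if)

lemma subring_pow: "subring B R \<Longrightarrow> x \<in> B \<Longrightarrow> x [^] (n::nat) \<in> B"
  by (induction n) (auto simp: subringE)

lemma adjoin_mem: "set as \<subseteq> B \<Longrightarrow> horner R t as \<in> adjoin R B t"
  by (auto simp: adjoin_def)

lemma adjoinE:
  assumes "u \<in> adjoin R B t" obtains as where "set as \<subseteq> B" "u = horner R t as"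
  using assms by (auto simp: adjoin_def)

lemma subset_adjoin:
  assumes "subring B R" "t \<in> carrier R" shows "B \<subseteq> adjoin R B t"
proof
  fix b assume b: "b \<in> B"
  then have "horner R t [b] \<in> adjoin R B t" by (intro adjoin_mem) auto
  then show "b \<in> adjoin R B t" using b assms subringE(1) by fastforce
qed

lemma adjoin_subring:
  assumes B: "subring B R" and t: "t \<in> carrier R"
  shows "subring (adjoin R B t) R" "t \<in> adjoin R B t"
proof -
  note Bp = subringE[OF B]
  have c: "set as \<subseteq> carrier R" if "set as \<subseteq> B" for as using that Bp(1) by auto
  have add: "u \<oplus> v \<in> adjoin R B t" if "u \<in> adjoin R B t" "v \<in> adjoin R B t" for u v
  proof -
    obtain as bs where *: "set as \<subseteq> B" "u = horner R t as" "set bs \<subseteq> B" "v = horner R t bs"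
      using \<open>u \<in> _\<close> \<open>v \<in> _\<close> by (auto simp: adjoin_def)
    have "horner R t (list_add R as bs) = u \<oplus> v"
      using horner_list_add[OF t c[OF *(1)] c[OF *(3)]] * by simp
    moreover have "set (list_add R as bs) \<subseteq> B" using * Bp by (intro set_list_add) auto
    ultimately show ?thesis by (metis adjoin_mem)
  qed
  have scale: "b \<otimes> u \<in> adjoin R B t" if "b \<in> B" "u \<in> adjoin R B t" for b u
  proof -
    obtain as where *: "set as \<subseteq> B" "u = horner R t as" using \<open>u \<in> _\<close> by (auto simp: adjoin_def)
    have "b \<otimes> u = horner R t (map ((\<otimes>) b) as)"
      using horner_map_mult[OF t _ c[OF *(1)]] * that Bp(1) by auto
    moreover have "set (map ((\<otimes>) b) as) \<subseteq> B" using * that Bp by auto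
    ultimately show ?thesis by (metis adjoin_mem)
  qed
  have shift: "t \<otimes> u \<in> adjoin R B t" if "u \<in> adjoin R B t" for u
  proof -
    obtain as where *: "set as \<subseteq> B" "u = horner R t as" using \<open>u \<in> _\<close> by (auto simp: adjoin_def)
    have "t \<otimes> u = horner R t (\<zero> # as)" using * c t by simp
    moreover have "set (\<zero> # as) \<subseteq> B" using * Bp by auto
    ultimately show ?thesis by (metis adjoin_mem)
  qed
  have Bs: "B \<subseteq> adjoin R B t" by (rule subset_adjoin[OF B t])
  have sub: "adjoin R B t \<subseteq> carrier R" using c t by (auto simp: adjoin_def)
  show "t \<in> adjoin R B t" using shift[of \<one>] Bs Bp(3) t by auto
  show "subring (adjoin R B t) R"
  proof (rule subringI[OF sub])
    show "\<one> \<in> adjoin R B t" using Bs Bp by auto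
    show "\<ominus> h \<in> adjoin R B t" if "h \<in> adjoin R B t" for h
      using scale[of "\<ominus> \<one>" h] that sub Bp(3,5) by (auto simp: l_minus subset_eq)
    show "h1 \<oplus> h2 \<in> adjoin R B t" if "h1 \<in> adjoin R B t" "h2 \<in> adjoin R B t" for h1 h2
      by (rule add[OF that])
    show "h1 \<otimes> h2 \<in> adjoin R B t" if h1: "h1 \<in> adjoin R B t" and h2: "h2 \<in> adjoin R B t" for h1 h2
    proof -
      obtain as where *: "set as \<subseteq> B" "h1 = horner R t as" using h1 by (auto simp: adjoin_def)
      have h2c: "h2 \<in> carrier R" using h2 sub by auto
      have "horner R t as \<otimes> h2 \<in> adjoin R B t" using *(1)
      proof (induction as)
        case Nil
        then show ?case using Bs Bp h2c by auto
      next
        case (Cons a as)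
        have "horner R t (a # as) \<otimes> h2 = a \<otimes> h2 \<oplus> t \<otimes> (horner R t as \<otimes> h2)"
          using Cons.prems c[of as] Bp(1) h2c t by (auto simp: l_distr m_assoc)
        then show ?case using Cons add scale shift h2 by auto
      qed
      then show ?thesis using * by simp
    qed
  qed
qed

lemma adjoin_minimal:
  assumes "subring C R" "B \<subseteq> C" "t \<in> C" shows "adjoin R B t \<subseteq> C"
  using assms horner_in_subring by (auto simp: adjoin_def)

lemma lincomb_closed [simp]:
  "set cs \<subseteq> carrier R \<Longrightarrow> set ws \<subseteq> carrier R \<Longrightarrow> lincomb R cs ws \<in> carrier R"
  by (induction cs ws rule: list_induct2') auto

lemma lincomb_in_subring:
  "subring B R \<Longrightarrow> set cs \<subseteq> B \<Longrightarrow> set ws \<subseteq> B \<Longrightarrow> lincomb R cs ws \<in> B"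
  by (induction cs ws rule: list_induct2') (auto simp: subringE)

lemma lincomb_zeros:
  "set cs \<subseteq> {\<zero>} \<Longrightarrow> set ws \<subseteq> carrier R \<Longrightarrow> lincomb R cs ws = \<zero>"
  by (induction cs ws rule: list_induct2') auto

lemma lincomb_append:
  assumes "length cs = length ws" "set cs \<subseteq> carrier R" "set ws \<subseteq> carrier R"
    "set cs' \<subseteq> carrier R" "set ws' \<subseteq> carrier R"
  shows "lincomb R (cs @ cs') (ws @ ws') = lincomb R cs ws \<oplus> lincomb R cs' ws'"
  using assms by (induction cs ws rule: list_induct2) (auto simp: a_assoc)

lemma lincomb_map_mult:
  assumes "s \<in> carrier R" "set cs \<subseteq> carrier R" "set ws \<subseteq> carrier R"
  shows "lincomb R (map ((\<otimes>) s) cs) ws = s \<otimes> lincomb R cs ws"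
  using assms by (induction cs ws rule: list_induct2') (auto simp: r_distr m_assoc)

lemma lincomb_scaled:
  assumes "length cs = length ws" "set cs \<subseteq> carrier R" "set ws \<subseteq> carrier R" "\<And>w. w \<in> set ws \<Longrightarrow> g w \<in> carrier R"
  shows "lincomb R cs (map (\<lambda>w. g w \<otimes> w) ws) = lincomb R (map2 (\<lambda>c w. c \<otimes> g w) cs ws) ws"
  using assms by (induction cs ws rule: list_induct2) (auto simp: m_assoc)

lemma lincomb_powers:
  assumes "t \<in> carrier R" "set cs \<subseteq> carrier R"
  shows "lincomb R cs (map (\<lambda>i. t [^] i) [0..<length cs]) = horner R t cs"
proof -
  \<comment> \<open>The exponents start at an arbitrary \<open>k\<close>, because removing the head
    coefficient shifts them.\<close>
  have "lincomb R cs (map (\<lambda>i. t [^] i) [k..<k + length cs]) = t [^] k \<otimes> horner R t cs" for k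
    using assms(2)
  proof (induction cs arbitrary: k)
    case (Cons c cs)
    have "[k..<k + length (c # cs)] = k # [Suc k..<Suc k + length cs]"
      using upt_conv_Cons[of k "k + length (c # cs)"] by simp
    moreover have "lincomb R cs (map (\<lambda>i. t [^] i) [Suc k..<Suc k + length cs]) =
        t [^] Suc k \<otimes> horner R t cs"
      by (rule Cons.IH) (use Cons.prems in simp)
    ultimately have "lincomb R (c # cs) (map (\<lambda>i. t [^] i) [k..<k + length (c # cs)]) =
        c \<otimes> t [^] k \<oplus> t [^] Suc k \<otimes> horner R t cs"
      by (simp only: list.map lincomb.simps)
    then show ?case using Cons.prems assms(1) by (simp add: r_distr m_ac)
  qed (use assms in simp)
  from this[of 0] show ?thesis using assms by simp
qed

end

text \<open>Gaussian elimination without division.\<close>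

lemma (in domain) lincomb_dependent:
  assumes B: "subring B R"
    and "set ws \<subseteq> carrier R" "length ws < length us"
    and "\<And>u. u \<in> set us \<Longrightarrow> \<exists>cs. set cs \<subseteq> B \<and> length cs = length ws \<and> u = lincomb R cs ws"
  shows "\<exists>cs. set cs \<subseteq> B \<and> length cs = length us \<and> \<not> set cs \<subseteq> {\<zero>} \<and> lincomb R cs us = \<zero>"
  using assms(2-)
proof (induction ws arbitrary: us)
  case Nil
  then obtain u us' where us: "us = u # us'" by (cases us) auto
  have z: "v = \<zero>" if "v \<in> set us" for v using Nil(3)[OF that] by auto
  have "set us' \<subseteq> carrier R" using z us by fastforce
  then have "lincomb R (\<one> # replicate (length us') \<zero>) us = \<zero>"
    using z[of u] lincomb_zeros[of "replicate (length us') \<zero>" us'] us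
    by (simp add: set_replicate_conv_if)
  moreover have "set (\<one> # replicate (length us') \<zero>) \<subseteq> B" "\<not> set (\<one> # replicate (length us') \<zero>) \<subseteq> {\<zero>}"
    using subringE(2,3)[OF B] by (simp_all add: set_replicate_conv_if)
  moreover have "length (\<one> # replicate (length us') \<zero>) = length us" using us by simp
  ultimately show ?case by blast
next
  case (Cons w ws)
  note Bp = subringE[OF B]
  let ?S = "\<lambda>u. \<exists>cs. set cs \<subseteq> B \<and> length cs = length ws \<and> u = lincomb R cs ws"
  have w: "w \<in> carrier R" "set ws \<subseteq> carrier R" using Cons.prems by auto
  have "\<exists>a u'. a \<in> B \<and> ?S u' \<and> u = a \<otimes> w \<oplus> u'" if u: "u \<in> set us" for u
  proof -
    obtain cs where cs: "set cs \<subseteq> B" "length cs = Suc (length ws)" "u = lincomb R cs (w # ws)"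
      using Cons.prems(3)[OF u] by auto
    then obtain c cs' where "cs = c # cs'" by (cases cs) auto
    then show ?thesis using cs by auto
  qed
  then obtain a g where ag: "\<And>u. u \<in> set us \<Longrightarrow> a u \<in> B \<and> ?S (g u) \<and> u = a u \<otimes> w \<oplus> g u"
    by metis
  have S_c: "u \<in> carrier R" if "?S u" for u using that w Bp(1) by auto
  have S_add: "?S (u \<oplus> v)" if u: "?S u" and v: "?S v" for u v
  proof -
    obtain cs ds where *: "set cs \<subseteq> B" "length cs = length ws" "u = lincomb R cs ws"
      "set ds \<subseteq> B" "length ds = length ws" "v = lincomb R ds ws" using u v by auto
    have "lincomb R (list_add R cs ds) ws = lincomb R cs ws \<oplus> lincomb R ds ws"
      if "length cs = length ws" "length ds = length ws" "set cs \<subseteq> B" "set ds \<subseteq> B" "set ws \<subseteq> carrier R"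
      for cs ds ws
      using that Bp(1)
    proof (induction cs ws arbitrary: ds rule: list_induct2)
      case (Cons c cs w ws)
      then obtain d ds' where ds: "ds = d # ds'" by (cases ds) auto
      have cc: "c \<in> carrier R" "d \<in> carrier R" "w \<in> carrier R" "lincomb R cs ws \<in> carrier R"
        "lincomb R ds' ws \<in> carrier R" using Cons.prems ds by auto
      have "lincomb R (list_add R cs ds') ws = lincomb R cs ws \<oplus> lincomb R ds' ws"
        using Cons ds by auto
      then show ?case using cc unfolding ds by (simp add: l_distr a_ac)
    qed auto
    from this[OF *(2,5,1,4) w(2)] show ?thesis using * set_list_add[OF Bp(7) *(1,4)]
      by (intro exI[of _ "list_add R cs ds"]) auto
  qed
  have S_mult: "?S (b \<otimes> u)" if b: "b \<in> B" and u: "?S u" for b u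
  proof -
    obtain cs where *: "set cs \<subseteq> B" "length cs = length ws" "u = lincomb R cs ws" using u by auto
    have "lincomb R (map ((\<otimes>) b) cs) ws = b \<otimes> u"
      using lincomb_map_mult[of b cs ws] * w Bp(1) b by auto
    then show ?thesis using * b Bp by (intro exI[of _ "map ((\<otimes>) b) cs"]) auto
  qed
  show ?case
  proof (cases "\<forall>u\<in>set us. a u = \<zero>")
    case True
    have "?S u" if "u \<in> set us" for u
      using ag[OF that] True that w S_c[of "g u"] by (metis l_null l_zero)
    then show ?thesis using Cons.IH[OF w(2), of us] Cons.prems(2) by auto
  next
    case False
    then obtain u0 where u0: "u0 \<in> set us" "a u0 \<noteq> \<zero>" by auto
    then obtain xs ys where us: "us = xs @ u0 # ys" using split_list by metis
    let ?zs = "xs @ ys"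
    \<comment> \<open>Pivot on \<open>u0\<close>: the multiples of \<open>w\<close> cancel in these
      combinations, so they lie in the span of \<open>ws\<close>, and only one vector has been
      spent.\<close>
    let ?f = "\<lambda>v. a u0 \<otimes> v \<ominus> a v \<otimes> u0"
    have a0: "a u0 \<in> carrier R" "a u0 \<in> B" using ag[OF u0(1)] Bp(1) by auto
    have u0c: "u0 \<in> carrier R" using ag[OF u0(1)] S_c[of "g u0"] w Bp(1)
      by (metis a0(1) add.m_closed m_closed)
    have S_f: "?S (?f v)" and vc: "v \<in> carrier R" and avc: "a v \<in> carrier R" "a v \<in> B"
      if "v \<in> set us" for v
    proof -
      note A = ag[OF that] and A0 = ag[OF u0(1)]
      show avc: "a v \<in> carrier R" "a v \<in> B" using A Bp(1) by auto
      have gc: "g v \<in> carrier R" "g u0 \<in> carrier R" using A A0 S_c by blast+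
      then show "v \<in> carrier R" using A avc w by (metis add.m_closed m_closed)
      have "?f v = a u0 \<otimes> (a v \<otimes> w \<oplus> g v) \<ominus> a v \<otimes> (a u0 \<otimes> w \<oplus> g u0)"
        using A A0 by simp
      also have "\<dots> = a u0 \<otimes> g v \<oplus> (\<ominus> a v) \<otimes> g u0"
        using gc avc a0 w by algebra
      finally show "?S (?f v)" using A A0 S_add S_mult Bp(5) by auto
    qed
    have zs: "set ?zs \<subseteq> set us" using us by auto
    have "\<exists>cs. set cs \<subseteq> B \<and> length cs = length (map ?f ?zs) \<and> \<not> set cs \<subseteq> {\<zero>} \<and>
        lincomb R cs (map ?f ?zs) = \<zero>"
    proof (rule Cons.IH[OF w(2)])
      show "length ws < length (map ?f ?zs)" using Cons.prems(2) us by simp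
      show "?S u" if "u \<in> set (map ?f ?zs)" for u using that S_f zs by auto
    qed
    then obtain cs where cs: "set cs \<subseteq> B" "length cs = length ?zs" "\<not> set cs \<subseteq> {\<zero>}"
      "lincomb R cs (map ?f ?zs) = \<zero>" by auto
    have expand: "lincomb R cs (map ?f zs) = a u0 \<otimes> lincomb R cs zs \<ominus> lincomb R cs (map a zs) \<otimes> u0"
      if "length cs = length zs" "set cs \<subseteq> B" "set zs \<subseteq> set us" for cs zs
      using that
    proof (induction cs zs rule: list_induct2)
      case Nil
      then show ?case using a0 u0c by (simp add: a_minus_def)
    next
      case (Cons c cs z zs)
      have cc: "c \<in> carrier R" "z \<in> carrier R" "a z \<in> carrier R" "lincomb R cs zs \<in> carrier R"
        "lincomb R cs (map a zs) \<in> carrier R"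
        using Cons.prems Bp(1) vc avc(1) by (auto simp: subset_eq)
      have "lincomb R cs (map ?f zs) = a u0 \<otimes> lincomb R cs zs \<ominus> lincomb R cs (map a zs) \<otimes> u0"
        using Cons by auto
      then show ?case using cc a0 u0c by simp algebra
    qed
    define l where "l = lincomb R cs (map a ?zs)"
    define cs1 cs2 where "cs1 = take (length xs) cs" and "cs2 = drop (length xs) cs"
    have cs12: "cs = cs1 @ cs2" "length cs1 = length xs" "length cs2 = length ys"
      using cs(2) by (auto simp: cs1_def cs2_def)
    \<comment> \<open>Substituting back, every old coefficient is multiplied by the pivot and
      \<open>u0\<close> receives minus the sum of the c_i a(z_i). In a domain a nonzero c_i stays
      nonzero.\<close>
    let ?ds = "map ((\<otimes>) (a u0)) cs1 @ (\<ominus> l) # map ((\<otimes>) (a u0)) cs2"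
    have lB: "l \<in> B" unfolding l_def using cs zs avc by (intro lincomb_in_subring[OF B]) auto
    have csc: "set cs1 \<subseteq> carrier R" "set cs2 \<subseteq> carrier R" "set cs1 \<subseteq> B" "set cs2 \<subseteq> B"
      using cs(1) cs12(1) Bp(1) by auto
    have xyc: "set xs \<subseteq> carrier R" "set ys \<subseteq> carrier R" using zs vc by auto
    have lc: "l \<in> carrier R" using lB Bp(1) by auto
    have LL: "lincomb R cs1 xs \<in> carrier R" "lincomb R cs2 ys \<in> carrier R" using csc xyc by auto
    have "lincomb R ?ds us = a u0 \<otimes> lincomb R cs1 xs \<oplus> (\<ominus> l \<otimes> u0 \<oplus> a u0 \<otimes> lincomb R cs2 ys)"
      unfolding us using csc xyc lc a0 u0c cs12 
      by (subst lincomb_append) (auto simp: lincomb_map_mult subset_eq)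
    also have "\<dots> = a u0 \<otimes> (lincomb R cs1 xs \<oplus> lincomb R cs2 ys) \<ominus> l \<otimes> u0"
      using LL a0(1) lc u0c by algebra
    also have "\<dots> = a u0 \<otimes> lincomb R cs ?zs \<ominus> l \<otimes> u0"
      unfolding cs12(1) using csc xyc cs12 by (subst lincomb_append) auto
    also have "\<dots> = \<zero>" using expand[OF cs(2,1) zs] cs(4) by (simp add: l_def)
    finally have "lincomb R ?ds us = \<zero>" .
    moreover have "set ?ds \<subseteq> B" using csc lB a0 Bp by auto
    moreover have "length ?ds = length us" using cs12 us by simp
    moreover have "\<not> set ?ds \<subseteq> {\<zero>}"
    proof -
      obtain c where c: "c \<in> set cs" "c \<noteq> \<zero>" using cs(3) by auto
      then have "a u0 \<otimes> c \<noteq> \<zero>" using u0(2) a0(1) cs(1) Bp(1) integral by blast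
      then show ?thesis using c cs12(1) by auto
    qed
    ultimately show ?thesis by blast
  qed
qed

section \<open>Frobenius-linear functionals on finitely generated domains\<close>

text \<open>For m = p^f and n = 1 this is a p^(-f)-linear map: the root of the scalar comes out.
  Allowing n = p^f0 leaves room for a preliminary Frobenius power, which inseparable generators
  require.\<close>

definition frob_linear :: "('a, 'b) ring_scheme \<Rightarrow> 'a set \<Rightarrow> nat \<Rightarrow> nat \<Rightarrow> ('a \<Rightarrow> 'a) \<Rightarrow> bool" where
  "frob_linear R B m n \<Theta> \<longleftrightarrow> (\<forall>b\<in>B. \<Theta> b \<in> B) \<and>
    (\<forall>a\<in>B. \<forall>b\<in>B. \<Theta> (a \<oplus>\<^bsub>R\<^esub> b) = \<Theta> a \<oplus>\<^bsub>R\<^esub> \<Theta> b) \<and>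
    (\<forall>s\<in>B. \<forall>b\<in>B. \<Theta> (s [^]\<^bsub>R\<^esub> m \<otimes>\<^bsub>R\<^esub> b) = s [^]\<^bsub>R\<^esub> n \<otimes>\<^bsub>R\<^esub> \<Theta> b)"

text \<open>The point is that \<open>c\<close> and \<open>f\<^sub>0\<close> do not depend on \<open>d\<close>: applying \<open>\<Theta>\<close> to an equation
  \<open>d x\<^sup>q = \<Sum> r\<^sub>i a\<^sub>i\<^sup>q\<close> shows that \<open>c\<close> is a test element up to the power \<open>p ^ f\<^sub>0\<close>.\<close>

definition uniform_splitting :: "('a, 'b) ring_scheme \<Rightarrow> nat \<Rightarrow> 'a set \<Rightarrow> bool" where
  "uniform_splitting R p B \<longleftrightarrow> (\<exists>c\<in>B. c \<noteq> \<zero>\<^bsub>R\<^esub> \<and> (\<exists>f\<^sub>0. \<forall>d\<in>B. d \<noteq> \<zero>\<^bsub>R\<^esub> \<longrightarrow>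
    (\<exists>f\<^sub>1. \<forall>f\<ge>f\<^sub>1. \<exists>\<Theta>. frob_linear R B (p ^ f) (p ^ f\<^sub>0) \<Theta> \<and> \<Theta> d = c)))"

locale domain_char_p = domain R + cring_char_p R p for R (structure) and p

lemma (in cring) additive_zero:
  assumes "\<zero> \<in> V" "\<And>v. v \<in> V \<Longrightarrow> \<Theta> v \<in> carrier R"
    "\<And>v w. v \<in> V \<Longrightarrow> w \<in> V \<Longrightarrow> \<Theta> (v \<oplus> w) = \<Theta> v \<oplus> \<Theta> w"
  shows "\<Theta> \<zero> = \<zero>"
  using assms(3)[OF assms(1,1)] assms(2)[OF assms(1)]
  by (metis a_closed add.l_cancel_one l_zero zero_closed)

section \<open>Semilinear maps and their construction from coefficient lists\<close>

context cring_char_p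
begin

lemma frob_linear_zero:
  assumes "subring B R" "frob_linear R B m n \<Theta>" shows "\<Theta> \<zero> = \<zero>"
  by (rule additive_zero[of B]) (use assms subringE[OF assms(1)] in \<open>auto simp: frob_linear_def\<close>)

lemma frob_linear_minus:
  assumes "subring B R" "frob_linear R B m n \<Theta>" "a \<in> B" shows "\<Theta> (\<ominus> a) = \<ominus> \<Theta> a"
proof -
  note Bp = subringE[OF assms(1)]
  have c: "a \<in> carrier R" "\<Theta> a \<in> carrier R" "\<Theta> (\<ominus> a) \<in> carrier R"
    using assms Bp(1,5) by (auto simp: frob_linear_def)
  have "\<Theta> (\<ominus> a) \<oplus> \<Theta> a = \<Theta> (\<ominus> a \<oplus> a)"
    using assms Bp(5) by (simp add: frob_linear_def)
  also have "\<dots> = \<zero>" using c frob_linear_zero[OF assms(1,2)] by (simp add: l_neg)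
  finally show ?thesis using c by (simp add: minus_equality)
qed

lemma frob_horner:
  assumes "t \<in> carrier R" "set as \<subseteq> carrier R"
  shows "(horner R t as) [^] (p ^ f) = horner R (t [^] (p ^ f)) (map (\<lambda>a. a [^] (p ^ f)) as)"
  using assms(2) by (induction as) (use assms(1) in \<open>auto simp: frob_add nat_pow_distrib\<close>)

lemma adjoin_frob:
  assumes "subring B R" "t \<in> carrier R" "u \<in> adjoin R B t"
  shows "u [^] (p ^ f) \<in> adjoin R B (t [^] (p ^ f))"
proof -
  obtain as where as: "set as \<subseteq> B" "u = horner R t as" using assms(3) by (rule adjoinE)
  then have "u [^] (p ^ f) = horner R (t [^] (p ^ f)) (map (\<lambda>a. a [^] (p ^ f)) as)"
    using frob_horner assms(2) subringE(1)[OF assms(1)] by auto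
  moreover have "set (map (\<lambda>a. a [^] (p ^ f)) as) \<subseteq> B"
    using as subring_pow[OF assms(1)] by auto
  ultimately show ?thesis by (metis adjoin_mem)
qed

text \<open>Additivity of Frobenius spreads semilinearity from the scalars in \<open>B\<close> and
  \<open>t\<close> to all of B[t]. The domain \<open>V\<close> is kept apart from B[t] because for
  an algebraic t the map will live on B[t^q] only, which is still stable under multiplication by
  q-th powers of elements of B[t].\<close>

lemma semilinear_adjoin:
  assumes B: "subring B R" and t: "t \<in> carrier R" and V: "V \<subseteq> carrier R" "\<zero> \<in> V"
    and add: "\<And>v w. v \<in> V \<Longrightarrow> w \<in> V \<Longrightarrow> v \<oplus> w \<in> V \<and> \<Theta> (v \<oplus> w) = \<Theta> v \<oplus> \<Theta> w"
    and cl: "\<And>v. v \<in> V \<Longrightarrow> \<Theta> v \<in> carrier R"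
    and scale: "\<And>c v. c \<in> B \<union> {t} \<Longrightarrow> v \<in> V \<Longrightarrow>
      c [^] (p ^ f) \<otimes> v \<in> V \<and> \<Theta> (c [^] (p ^ f) \<otimes> v) = c [^] (p ^ g) \<otimes> \<Theta> v"
    and s: "s \<in> adjoin R B t" and v: "v \<in> V"
  shows "s [^] (p ^ f) \<otimes> v \<in> V \<and> \<Theta> (s [^] (p ^ f) \<otimes> v) = s [^] (p ^ g) \<otimes> \<Theta> v"
proof -
  obtain as where as: "set as \<subseteq> B" "s = horner R t as" using s by (rule adjoinE)
  have z: "\<Theta> \<zero> = \<zero>" by (rule additive_zero[of V]) (use V add cl in auto)
  have "horner R t as [^] (p ^ f) \<otimes> v \<in> V \<and>
      \<Theta> (horner R t as [^] (p ^ f) \<otimes> v) = horner R t as [^] (p ^ g) \<otimes> \<Theta> v"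
    using as(1)
  proof (induction as)
    case Nil
    then show ?case using V v z cl[OF v] by auto
  next
    case (Cons a as)
    let ?h = "horner R t as"
    have c: "a \<in> carrier R" "?h \<in> carrier R" "v \<in> carrier R" "\<Theta> v \<in> carrier R"
      using Cons.prems subringE(1)[OF B] t V v cl by auto
    have IH: "?h [^] (p ^ f) \<otimes> v \<in> V" "\<Theta> (?h [^] (p ^ f) \<otimes> v) = ?h [^] (p ^ g) \<otimes> \<Theta> v"
      using Cons by auto
    have e: "horner R t (a # as) [^] (p ^ k) \<otimes> w =
        a [^] (p ^ k) \<otimes> w \<oplus> t [^] (p ^ k) \<otimes> (?h [^] (p ^ k) \<otimes> w)" if "w \<in> carrier R" for k w
      using c t that by (simp add: frob_add nat_pow_distrib l_distr m_assoc)
    show ?case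
      unfolding e[OF c(3)] e[OF c(4)]
      using scale[of a, OF _ v] scale[of t, OF _ IH(1)] IH(2) add Cons.prems by auto
  qed
  then show ?thesis using as by simp
qed

text \<open>Adding the negative of \<open>bs\<close> to two lists of equal value gives two lists of
  value zero, on which \<open>\<Psi>\<close> vanishes. The second of them is only a list of zeros in
  value, not the empty list, so both are formed and compared.\<close>

lemma lift_from_lists:
  assumes B: "subring B R" and t: "t \<in> carrier R"
    and cl: "\<And>as. set as \<subseteq> B \<Longrightarrow> \<Psi> as \<in> carrier R"
    and add: "\<And>as bs. set as \<subseteq> B \<Longrightarrow> set bs \<subseteq> B \<Longrightarrow> \<Psi> (list_add R as bs) = \<Psi> as \<oplus> \<Psi> bs"
    and ker: "\<And>as. set as \<subseteq> B \<Longrightarrow> horner R t as = \<zero> \<Longrightarrow> \<Psi> as = \<zero>"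
  shows "\<exists>\<Theta>. \<forall>as. set as \<subseteq> B \<longrightarrow> \<Theta> (horner R t as) = \<Psi> as"
proof -
  note Bp = subringE[OF B]
  have eq: "\<Psi> as = \<Psi> bs" if as: "set as \<subseteq> B" and bs: "set bs \<subseteq> B" and h: "horner R t as = horner R t bs" for as bs
  proof -
    let ?ns = "map ((\<otimes>) (\<ominus> \<one>)) bs"
    have ns: "set ?ns \<subseteq> B" using bs Bp by auto
    have c: "set as \<subseteq> carrier R" "set bs \<subseteq> carrier R" "set ?ns \<subseteq> carrier R" using as bs ns Bp(1) by auto
    have "horner R t ?ns = \<ominus> horner R t bs"
      using horner_map_mult[OF t _ c(2), of "\<ominus> \<one>"] c t by (simp add: l_minus)
    then have "horner R t (list_add R as ?ns) = \<zero>" "horner R t (list_add R bs ?ns) = \<zero>"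
      using horner_list_add[OF t c(1,3)] horner_list_add[OF t c(2,3)] h c t by (simp_all add: r_neg)
    then have "\<Psi> (list_add R as ?ns) = \<zero>" "\<Psi> (list_add R bs ?ns) = \<zero>"
      using set_list_add[OF Bp(7) as ns] set_list_add[OF Bp(7) bs ns] by (auto intro: ker)
    then have "\<Psi> as \<oplus> \<Psi> ?ns = \<Psi> bs \<oplus> \<Psi> ?ns" using add as bs ns by simp
    then show ?thesis using cl as bs ns by simp
  qed
  show ?thesis
    by (rule exI[of _ "\<lambda>u. \<Psi> (SOME as. set as \<subseteq> B \<and> u = horner R t as)"])
       (metis (mono_tags, lifting) eq someI_ex)
qed

end

text \<open>One step of pseudo-division of \<open>as\<close> by \<open>bs\<close>, as
  \<open>B\<close> is not a field. The top entry, where the two leading terms cancel, is deleted by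
  position; so the length drops by exactly one, whether or not further leading entries
  vanish.\<close>

definition head_reduce :: "('a, 'b) ring_scheme \<Rightarrow> 'a list \<Rightarrow> 'a list \<Rightarrow> 'a list" where
  "head_reduce R as bs = list_add R (map ((\<otimes>\<^bsub>R\<^esub>) (last bs)) (butlast as))
     (map ((\<otimes>\<^bsub>R\<^esub>) (\<ominus>\<^bsub>R\<^esub> last as)) (replicate (length as - length bs) \<zero>\<^bsub>R\<^esub> @ butlast bs))"

context cring
begin

lemma head_reduce:
  assumes "t \<in> carrier R" "set as \<subseteq> carrier R" "set bs \<subseteq> carrier R" "bs \<noteq> []" "length bs \<le> length as"
  shows "horner R t (head_reduce R as bs) =
      last bs \<otimes> horner R t as \<oplus> \<ominus> last as \<otimes> (t [^] (length as - length bs) \<otimes> horner R t bs)"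
    and "length (head_reduce R as bs) = length as - 1"
proof -
  have ne: "as \<noteq> []" using assms(4,5) by auto
  obtain as' a where as: "as = as' @ [a]" using ne by (metis append_butlast_last_id)
  obtain bs' b where bs: "bs = bs' @ [b]" using assms(4) by (metis append_butlast_last_id)
  let ?m = "length as - length bs"
  let ?r = "replicate ?m \<zero> @ bs"
  have c: "a \<in> carrier R" "b \<in> carrier R" "set as' \<subseteq> carrier R" "set bs' \<subseteq> carrier R"
    using assms as bs by auto
  have hc: "set (head_reduce R as bs) \<subseteq> carrier R"
    unfolding head_reduce_def using as bs c by (intro set_list_add) (auto simp: set_replicate_conv_if)
  \<comment> \<open>With the top entries restored, the last entry is b a - a b = 0, so deleting it
    does not change the value.\<close>
  have "list_add R (map ((\<otimes>) b) as) (map ((\<otimes>) (\<ominus> a)) ?r) = head_reduce R as bs @ [b \<otimes> a \<oplus> \<ominus> a \<otimes> b]"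
    unfolding as bs head_reduce_def using assms(5) as bs
    by (simp add: list_add_snoc flip: append_assoc)
  also have "b \<otimes> a \<oplus> \<ominus> a \<otimes> b = \<zero>" using c by algebra
  finally have "horner R t (head_reduce R as bs @ replicate 1 \<zero>) =
      horner R t (list_add R (map ((\<otimes>) b) as) (map ((\<otimes>) (\<ominus> a)) ?r))" by simp
  also have "\<dots> = b \<otimes> horner R t as \<oplus> \<ominus> a \<otimes> horner R t ?r"
  proof -
    have "set ?r \<subseteq> carrier R" using assms by (auto simp: set_replicate_conv_if)
    moreover from this have "set (map ((\<otimes>) (\<ominus> a)) ?r) \<subseteq> carrier R" using c(1) by auto
    moreover have "set (map ((\<otimes>) b) as) \<subseteq> carrier R" using c(2) assms(2) by auto
    ultimately show ?thesis using assms(1,2) c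
      by (simp only: horner_list_add horner_map_mult a_inv_closed)
  qed
  finally show "horner R t (head_reduce R as bs) =
      last bs \<otimes> horner R t as \<oplus> \<ominus> last as \<otimes> (t [^] ?m \<otimes> horner R t bs)"
    using horner_snoc_zero[OF assms(1) hc, of 1] horner_shift[OF assms(1,3)] as bs by simp
  show "length (head_reduce R as bs) = length as - 1"
    using assms(5) as bs by (simp add: head_reduce_def)
qed

lemma head_reduce_subring:
  assumes "subring B R" "set as \<subseteq> B" "set bs \<subseteq> B" "bs \<noteq> []" "as \<noteq> []"
  shows "set (head_reduce R as bs) \<subseteq> B"
proof -
  note Bp = subringE[OF assms(1)]
  have "last as \<in> B" "last bs \<in> B" "set (butlast as) \<subseteq> B" "set (butlast bs) \<subseteq> B"
    using assms last_in_set[of as] last_in_set[of bs] by (auto dest: in_set_butlastD)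
  then show ?thesis unfolding head_reduce_def
    using Bp by (intro set_list_add) (auto simp: set_replicate_conv_if)
qed

end

text \<open>\<open>\<Theta>\<close> takes the entries b^m of the divisor out as b^n. Hence it
  carries pseudo-division by the entrywise m-th power of \<open>bs\<close> to pseudo-division by the
  entrywise n-th power. Positivity of the exponents keeps the padding by zeros intact.\<close>

lemma (in cring_char_p) map_head_reduce:
  assumes B: "subring B R" and L: "frob_linear R B m n \<Theta>" and m: "0 < m" "0 < n"
    and as: "set as \<subseteq> B" "as \<noteq> []" and bs: "set bs \<subseteq> B" "bs \<noteq> []"
  shows "map \<Theta> (head_reduce R as (map (\<lambda>b. b [^] m) bs)) =
    head_reduce R (map \<Theta> as) (map (\<lambda>b. b [^] n) bs)"
proof -
  note Bp = subringE[OF B]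
  have l: "last as \<in> B" "last bs \<in> B" "set (butlast as) \<subseteq> B" "set (butlast bs) \<subseteq> B"
    using as bs last_in_set[of as] last_in_set[of bs] by (auto dest: in_set_butlastD)
  have zp: "\<zero> [^] m = \<zero>" "\<zero> [^] n = \<zero>" using m by (auto simp: nat_pow_zero)
  have 1: "map \<Theta> (map ((\<otimes>) (last bs [^] m)) (butlast as)) = map ((\<otimes>) (last bs [^] n)) (map \<Theta> (butlast as))"
    using L l by (auto simp: frob_linear_def subset_eq)
  have 2: "\<Theta> (\<ominus> last as \<otimes> b [^] m) = \<ominus> \<Theta> (last as) \<otimes> b [^] n" if "b \<in> B" for b
  proof -
    have c: "\<Theta> (\<ominus> last as) \<in> carrier R" "b \<in> carrier R" "last as \<in> carrier R"
      using L l that Bp(1,5) by (auto simp: frob_linear_def)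
    have "\<Theta> (\<ominus> last as \<otimes> b [^] m) = \<Theta> (b [^] m \<otimes> \<ominus> last as)" using c by (simp add: m_comm)
    also have "\<dots> = b [^] n \<otimes> \<Theta> (\<ominus> last as)" using L l that Bp(5) by (auto simp: frob_linear_def)
    finally show ?thesis using c frob_linear_minus[OF B L l(1)] by (simp add: m_comm)
  qed
  have 3: "map \<Theta> (map ((\<otimes>) (\<ominus> last as)) (replicate k \<zero> @ map (\<lambda>b. b [^] m) (butlast bs))) =
     map ((\<otimes>) (\<ominus> \<Theta> (last as))) (replicate k \<zero> @ map (\<lambda>b. b [^] n) (butlast bs))" for k
    using 2[of \<zero>] zp 2 l Bp(2) by (auto simp: subset_eq)
  have "map \<Theta> (head_reduce R as (map (\<lambda>b. b [^] m) bs)) =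
      list_add R (map \<Theta> (map ((\<otimes>) (last bs [^] m)) (butlast as)))
        (map \<Theta> (map ((\<otimes>) (\<ominus> last as)) (replicate (length as - length bs) \<zero> @ map (\<lambda>b. b [^] m) (butlast bs))))"
  proof -
    have "set (map ((\<otimes>) (last bs [^] m)) (butlast as)) \<subseteq> B"
      using l subring_pow[OF B] Bp(6) by auto
    moreover have "set (map ((\<otimes>) (\<ominus> last as)) (replicate k \<zero> @ map (\<lambda>b. b [^] m) (butlast bs))) \<subseteq> B" for k
      using l subring_pow[OF B] Bp(2,5,6) by (auto simp: set_replicate_conv_if)
    moreover have "\<Theta> (a \<oplus> b) = \<Theta> a \<oplus> \<Theta> b" if "a \<in> B" "b \<in> B" for a b
      using L that by (simp add: frob_linear_def)
    ultimately show ?thesis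
      unfolding head_reduce_def using bs
      by (simp only: map_list_add[of B] last_map map_butlast length_map simp_thms)
  qed
  also have "\<dots> = head_reduce R (map \<Theta> as) (map (\<lambda>b. b [^] n) bs)"
    unfolding 1 3 head_reduce_def using as bs by (simp add: last_map map_butlast)
  finally show ?thesis .
qed

text \<open>Keeps the positions k, k + m, k + 2m, and so on. For k < m, evaluation of the result
  realizes the map that sends a t^(k + m j) to (f a) s^j, with s the new variable, and kills the
  other residue classes of exponents.\<close>

primrec select_coeffs :: "('a \<Rightarrow> 'a) \<Rightarrow> nat \<Rightarrow> nat \<Rightarrow> 'a list \<Rightarrow> 'a list" where
  "select_coeffs f m k [] = []"
| "select_coeffs f m k (a # as) =
    (if k = 0 then f a # select_coeffs f m (m - 1) as else select_coeffs f m (k - 1) as)"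

lemma set_select_coeffs: "set (select_coeffs f m k as) \<subseteq> f ` set as"
  by (induction as arbitrary: k) auto

lemma select_coeffs_list_add:
  assumes "\<And>a b. a \<in> B \<Longrightarrow> b \<in> B \<Longrightarrow> f (a \<oplus>\<^bsub>R\<^esub> b) = f a \<oplus>\<^bsub>R\<^esub> f b" "set as \<subseteq> B" "set bs \<subseteq> B"
  shows "select_coeffs f m k (list_add R as bs) =
    list_add R (select_coeffs f m k as) (select_coeffs f m k bs)"
  using assms(2,3)
  by (induction as bs arbitrary: k rule: list_induct2') (auto simp: assms(1))

lemma select_coeffs_map:
  assumes "\<And>a. a \<in> B \<Longrightarrow> f (g a) = h (f a)" "set as \<subseteq> B"
  shows "select_coeffs f m k (map g as) = map h (select_coeffs f m k as)"
  using assms by (induction as arbitrary: k) auto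

lemma select_coeffs_replicate_le:
  "r \<le> k \<Longrightarrow> select_coeffs f m k (replicate r z @ as) = select_coeffs f m (k - r) as"
  by (induction r arbitrary: k) (auto simp: Suc_le_eq)

text \<open>Inserting m zeros in front is multiplication by t^m; the selection meets exactly one of
  them, so the result is multiplied by the new variable if \<open>f z\<close> is zero.\<close>

lemma select_coeffs_replicate:
  assumes "k < m"
  shows "select_coeffs f m k (replicate m z @ as) = f z # select_coeffs f m k as"
proof -
  obtain r where r: "m = k + Suc r" using assms less_imp_Suc_add by auto
  have "select_coeffs f m k (replicate k z @ (z # replicate r z @ as)) =
      f z # select_coeffs f m (m - 1) (replicate r z @ as)"
    by (subst select_coeffs_replicate_le) auto
  also have "select_coeffs f m (m - 1) (replicate r z @ as) = select_coeffs f m k as"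
    using r by (subst select_coeffs_replicate_le) auto
  finally have "select_coeffs f m k (replicate k z @ (z # replicate r z @ as)) = f z # select_coeffs f m k as" .
  moreover have "replicate m z @ as = replicate k z @ (z # replicate r z @ as)"
    unfolding r by (simp only: replicate_add replicate.simps append_assoc append_Cons)
  ultimately show ?thesis by (simp only:)
qed

lemma select_coeffs_single:
  assumes "k < length as" "length as \<le> m + k"
  shows "select_coeffs f m k as = [f (as ! k)]"
proof -
  have nil: "select_coeffs f m j xs = []" if "length xs \<le> j" for j xs
    using that by (induction xs arbitrary: j) auto
  show ?thesis using assms
  proof (induction as arbitrary: k)
    case (Cons a as)
    show ?case
    proof (cases k)
      case 0
      then show ?thesis using Cons.prems nil[of as "m - 1"] by auto
    next
      case (Suc k')
      then show ?thesis using Cons.IH[of k'] Cons.prems by auto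
    qed
  qed simp
qed

section \<open>Uniform splittings under adjunction of one element\<close>

context domain_char_p
begin

text \<open>Precompose with the p^k-th power map, which is additive and takes B' into B. The value
  \<open>c\<close> is kept and f0 becomes f0 + k. This is how the result passes from B[r^(p^k)] back
  to B[r].\<close>

lemma uniform_splitting_root:
  assumes T: "uniform_splitting R p B" and "B \<subseteq> B'" and B': "subring B' R"
    and pw: "\<And>s. s \<in> B' \<Longrightarrow> s [^] (p ^ k) \<in> B"
  shows "uniform_splitting R p B'"
proof -
  obtain c f0 where c: "c \<in> B" "c \<noteq> \<zero>" and T': "\<And>d. d \<in> B \<Longrightarrow> d \<noteq> \<zero> \<Longrightarrow>
    \<exists>f\<^sub>1. \<forall>f\<ge>f\<^sub>1. \<exists>\<Theta>. frob_linear R B (p ^ f) (p ^ f0) \<Theta> \<and> \<Theta> d = c"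
    using T by (auto simp: uniform_splitting_def)
  have sub: "x \<in> carrier R" if "x \<in> B'" for x using that subringE(1)[OF B'] by auto
  have "\<exists>f\<^sub>1. \<forall>f\<ge>f\<^sub>1. \<exists>\<Theta>. frob_linear R B' (p ^ f) (p ^ (f0 + k)) \<Theta> \<and> \<Theta> d = c"
    if d: "d \<in> B'" "d \<noteq> \<zero>" for d
  proof -
    have "d [^] (p ^ k) \<noteq> \<zero>" using d sub[OF d(1)] 
    proof -
      have "d [^] n \<noteq> \<zero>" for n :: nat
        using d(2) sub[OF d(1)] by (induction n) (auto simp: integral_iff)
      then show ?thesis .
    qed
    then obtain f1 where f1: "\<And>f. f \<ge> f1 \<Longrightarrow> \<exists>\<Theta>. frob_linear R B (p ^ f) (p ^ f0) \<Theta> \<and> \<Theta> (d [^] (p ^ k)) = c"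
      using T'[OF pw[OF d(1)]] by auto
    have "\<exists>\<Theta>. frob_linear R B' (p ^ f) (p ^ (f0 + k)) \<Theta> \<and> \<Theta> d = c" if f: "f \<ge> f1" for f
    proof -
      obtain \<Theta> where \<Theta>: "frob_linear R B (p ^ f) (p ^ f0) \<Theta>" "\<Theta> (d [^] (p ^ k)) = c"
        using f1[OF f] by auto
      have "\<Theta> ((s [^] (p ^ f) \<otimes> b) [^] (p ^ k)) = s [^] (p ^ (f0 + k)) \<otimes> \<Theta> (b [^] (p ^ k))"
        if "s \<in> B'" "b \<in> B'" for s b
      proof -
        have "(s [^] (p ^ f) \<otimes> b) [^] (p ^ k) = (s [^] (p ^ k)) [^] (p ^ f) \<otimes> b [^] (p ^ k)"
          using sub that by (simp add: nat_pow_distrib pow_pow add.commute)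
        then have "\<Theta> ((s [^] (p ^ f) \<otimes> b) [^] (p ^ k)) = (s [^] (p ^ k)) [^] (p ^ f0) \<otimes> \<Theta> (b [^] (p ^ k))"
          using \<Theta>(1) pw that by (simp add: frob_linear_def)
        then show ?thesis using sub that by (simp add: pow_pow add.commute)
      qed
      then have "frob_linear R B' (p ^ f) (p ^ (f0 + k)) (\<lambda>u. \<Theta> (u [^] (p ^ k)))"
        using \<Theta>(1) assms(2) pw sub unfolding frob_linear_def by (auto simp: frob_add)
      then show ?thesis using \<Theta>(2) by blast
    qed
    then show ?thesis by blast
  qed
  then show ?thesis using c assms(2) unfolding uniform_splitting_def by blast
qed

text \<open>The powers of t are free over B, so a functional on B can be applied to the coefficients
  in one residue class of exponents modulo q, with t^q going to t^(p^f0).\<close>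

lemma uniform_splitting_transcendental:
  assumes T: "uniform_splitting R p B" and B: "subring B R" and t: "t \<in> carrier R"
    and tr: "\<And>as. set as \<subseteq> B \<Longrightarrow> horner R t as = \<zero> \<Longrightarrow> set as \<subseteq> {\<zero>}"
  shows "uniform_splitting R p (adjoin R B t)"
proof -
  note Bp = subringE[OF B]
  let ?A = "adjoin R B t"
  have A: "subring ?A R" and tA: "t \<in> ?A" and BA: "B \<subseteq> ?A"
    using adjoin_subring[OF B t] subset_adjoin[OF B t] by auto
  note Ap = subringE[OF A]
  obtain c f0 where c: "c \<in> B" "c \<noteq> \<zero>" and T': "\<And>d. d \<in> B \<Longrightarrow> d \<noteq> \<zero> \<Longrightarrow>
    \<exists>f\<^sub>1. \<forall>f\<ge>f\<^sub>1. \<exists>\<Theta>. frob_linear R B (p ^ f) (p ^ f0) \<Theta> \<and> \<Theta> d = c"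
    using T by (auto simp: uniform_splitting_def)
  have "\<exists>f\<^sub>1. \<forall>f\<ge>f\<^sub>1. \<exists>\<Theta>. frob_linear R ?A (p ^ f) (p ^ f0) \<Theta> \<and> \<Theta> d = c"
    if d: "d \<in> ?A" "d \<noteq> \<zero>" for d
  proof -
    obtain ds where ds: "set ds \<subseteq> B" "d = horner R t ds" using d(1) by (rule adjoinE)
    have "\<not> set ds \<subseteq> {\<zero>}" using d(2) ds horner_zeros[OF t] by auto
    then obtain a where "a \<in> set ds" "a \<noteq> \<zero>" by auto
    \<comment> \<open>A nonzero coefficient of d chooses the residue class; the functional on B will
      be the one that sends this coefficient to c.\<close>
    then obtain i where i: "i < length ds" "ds ! i \<noteq> \<zero>" by (metis in_set_conv_nth)
    have diB: "ds ! i \<in> B" using i ds by auto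
    obtain f1 where f1: "\<And>f. f \<ge> f1 \<Longrightarrow> \<exists>\<Theta>. frob_linear R B (p ^ f) (p ^ f0) \<Theta> \<and> \<Theta> (ds ! i) = c"
      using T'[OF diB i(2)] by auto
    \<comment> \<open>Once q exceeds the number of coefficients of d, no other exponent in d is
      congruent to i modulo q, and d itself is sent to c.\<close>
    have "\<exists>\<Theta>. frob_linear R ?A (p ^ f) (p ^ f0) \<Theta> \<and> \<Theta> d = c" if f: "f \<ge> max f1 (length ds)" for f
    proof -
      let ?q = "p ^ f" and ?r = "p ^ f0"
      have q: "length ds < ?q"
      proof -
        have "f < 2 ^ f" by (rule less_exp)
        also have "\<dots> \<le> ?q" using prime_ge_2_nat[OF prime_p] by (rule power_mono) simp
        finally show ?thesis using f by simp
      qed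
      obtain \<Theta> where \<Theta>: "frob_linear R B ?q ?r \<Theta>" "\<Theta> (ds ! i) = c" using f1[of f] f by auto
      have \<Theta>B: "\<Theta> b \<in> B" if "b \<in> B" for b using \<Theta> that by (auto simp: frob_linear_def)
      have \<Theta>0: "\<Theta> \<zero> = \<zero>" by (rule frob_linear_zero[OF B \<Theta>(1)])
      define S where "S = select_coeffs \<Theta> ?q i"
      define \<Psi> where "\<Psi> = (\<lambda>as. horner R (t [^] ?r) (S as))"
      have SB: "set (S as) \<subseteq> B" if "set as \<subseteq> B" for as
        using set_select_coeffs[of \<Theta> ?q i as] \<Theta>B that unfolding S_def by auto
      have Sc: "set (S as) \<subseteq> carrier R" if "set as \<subseteq> B" for as using SB[OF that] Bp(1) by auto
      have tq: "t [^] k \<in> carrier R" for k :: nat using t by simp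
      have \<Psi>A: "\<Psi> as \<in> ?A" if "set as \<subseteq> B" for as
        unfolding \<Psi>_def using SB[OF that] subring_pow[OF A tA] BA
        by (intro horner_in_subring[OF A]) auto
      have S_add: "S (list_add R as bs) = list_add R (S as) (S bs)" if "set as \<subseteq> B" "set bs \<subseteq> B" for as bs
        unfolding S_def by (rule select_coeffs_list_add[of B]) (use that \<Theta> in \<open>auto simp: frob_linear_def\<close>)
      have \<Psi>_add: "\<Psi> (list_add R as bs) = \<Psi> as \<oplus> \<Psi> bs" if "set as \<subseteq> B" "set bs \<subseteq> B" for as bs
        unfolding \<Psi>_def S_add[OF that] by (rule horner_list_add[OF tq Sc[OF that(1)] Sc[OF that(2)]])
      have ker: "\<Psi> as = \<zero>" if "set as \<subseteq> B" "horner R t as = \<zero>" for as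
      proof -
        have "set (S as) \<subseteq> {\<zero>}"
          using tr[OF that] set_select_coeffs[of \<Theta> ?q i as] \<Theta>0 unfolding S_def by auto
        then show ?thesis unfolding \<Psi>_def by (rule horner_zeros[OF tq])
      qed
      obtain \<Phi> where \<Phi>: "\<And>as. set as \<subseteq> B \<Longrightarrow> \<Phi> (horner R t as) = \<Psi> as"
        using lift_from_lists[OF B t, of \<Psi>] \<Psi>A Ap(1) \<Psi>_add ker by blast
      have cl: "\<Phi> u \<in> ?A" if "u \<in> ?A" for u using that \<Phi> \<Psi>A by (elim adjoinE) auto
      have add: "u \<oplus> v \<in> ?A \<and> \<Phi> (u \<oplus> v) = \<Phi> u \<oplus> \<Phi> v" if u: "u \<in> ?A" and v: "v \<in> ?A" for u v
      proof -
        obtain as bs where *: "set as \<subseteq> B" "u = horner R t as" "set bs \<subseteq> B" "v = horner R t bs"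
          using u v by (auto elim!: adjoinE)
        have "horner R t (list_add R as bs) = u \<oplus> v"
          using horner_list_add[OF t, of as bs] * Bp(1) by auto
        then show ?thesis using \<Phi>[of "list_add R as bs"] \<Phi>[of as] \<Phi>[of bs] * \<Psi>_add[OF *(1,3)]
          set_list_add[OF Bp(7) *(1,3)] Ap(7)[OF u v] by simp
      qed
      have scale: "s [^] ?q \<otimes> v \<in> ?A \<and> \<Phi> (s [^] ?q \<otimes> v) = s [^] ?r \<otimes> \<Phi> v"
        if s: "s \<in> B \<union> {t}" and v: "v \<in> ?A" for s v
      proof -
        obtain as where as: "set as \<subseteq> B" "v = horner R t as" using v by (rule adjoinE)
        have asc: "set as \<subseteq> carrier R" using as(1) Bp(1) by auto
        have inA: "s [^] ?q \<otimes> v \<in> ?A" using s BA tA v subring_pow[OF A] Ap(6) by auto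
        consider "s \<in> B" | "s = t" using s by auto
        then show ?thesis
        proof cases
          case 1
          let ?as = "map ((\<otimes>) (s [^] ?q)) as"
          have sc: "s [^] k \<in> carrier R" for k :: nat using 1 Bp(1) by auto
          have "set ?as \<subseteq> B" using subring_pow[OF B 1] as Bp(6) by auto
          moreover have "horner R t ?as = s [^] ?q \<otimes> v"
            unfolding as(2) by (rule horner_map_mult[OF t sc asc])
          moreover have "S ?as = map ((\<otimes>) (s [^] ?r)) (S as)"
            unfolding S_def by (rule select_coeffs_map[of B]) (use \<Theta> 1 as in \<open>auto simp: frob_linear_def\<close>)
          ultimately show ?thesis using \<Phi>[of ?as] \<Phi>[of as] as inA horner_map_mult[OF tq sc Sc[OF as(1)]]
            by (simp add: \<Psi>_def)
        next
          case 2
          let ?as = "replicate ?q \<zero> @ as"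
          have "set ?as \<subseteq> B" using as Bp(2) by (auto simp: set_replicate_conv_if)
          moreover have "horner R t ?as = s [^] ?q \<otimes> v"
            unfolding as(2) 2 by (rule horner_shift[OF t asc])
          moreover have "S ?as = \<zero> # S as"
            unfolding S_def using select_coeffs_replicate[of i ?q \<Theta> \<zero> as] i q \<Theta>0 by simp
          ultimately show ?thesis using \<Phi>[of ?as] \<Phi>[of as] as inA 2 tq horner_closed[OF tq Sc[OF as(1)]]
            by (simp add: \<Psi>_def)
        qed
      qed
      have "frob_linear R ?A ?q ?r \<Phi>"
      proof -
        have "\<Phi> (s [^] ?q \<otimes> v) = s [^] ?r \<otimes> \<Phi> v" if "s \<in> ?A" "v \<in> ?A" for s v
          using semilinear_adjoin[OF B t Ap(1,2) add _ scale that] cl Ap(1) by blast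
        then show ?thesis using add cl by (auto simp: frob_linear_def)
      qed
      moreover have "\<Phi> d = c"
      proof -
        have "S ds = [c]" unfolding S_def
          using select_coeffs_single[of i ds ?q \<Theta>] i q \<Theta>(2) by simp
        then show ?thesis using \<Phi>[OF ds(1)] ds(2) c Bp(1) tq by (auto simp: \<Psi>_def)
      qed
      ultimately show ?thesis by blast
    qed
    then show ?thesis by blast
  qed
  then show ?thesis using c BA unfolding uniform_splitting_def by blast
qed


lemma pow_nonzero: "x \<in> carrier R \<Longrightarrow> x \<noteq> \<zero> \<Longrightarrow> x [^] (n::nat) \<noteq> \<zero>"
  by (induction n) (auto simp: integral_iff)

text \<open>Each pseudo-division step by \<open>bs\<close> multiplies by its nonzero leading
  coefficient and shortens the list, until only powers of t below the degree
  \<open>length bs - 1\<close> remain.\<close>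

lemma adjoin_algebraic_span:
  assumes B: "subring B R" and t: "t \<in> carrier R"
    and bs: "set bs \<subseteq> B" "bs \<noteq> []" "last bs \<noteq> \<zero>" "horner R t bs = \<zero>"
    and u: "u \<in> adjoin R B t"
  shows "\<exists>b\<in>B. b \<noteq> \<zero> \<and> (\<exists>cs. set cs \<subseteq> B \<and> length cs = length bs - 1 \<and> b \<otimes> u = horner R t cs)"
proof -
  note Bp = subringE[OF B]
  have lb: "last bs \<in> B" using bs by auto
  have main: "\<exists>b\<in>B. b \<noteq> \<zero> \<and> (\<exists>cs. set cs \<subseteq> B \<and> length cs = length bs - 1 \<and> b \<otimes> horner R t as = horner R t cs)"
    if "set as \<subseteq> B" for as
    using that
  proof (induction "length as" arbitrary: as rule: less_induct)
    case less
    have asc: "set as \<subseteq> carrier R" "set bs \<subseteq> carrier R" using less.prems bs Bp(1) by auto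
    show ?case
    proof (cases "length as < length bs")
      case True
      let ?cs = "as @ replicate (length bs - 1 - length as) \<zero>"
      have "horner R t ?cs = \<one> \<otimes> horner R t as" using horner_snoc_zero[OF t asc(1)] t asc by simp
      moreover have "set ?cs \<subseteq> B" using less.prems Bp(2) by (auto simp: set_replicate_conv_if)
      moreover have "length ?cs = length bs - 1" using True by simp
      ultimately show ?thesis using Bp(3) one_not_zero by metis
    next
      case False
      then have len: "length bs \<le> length as" and ne: "as \<noteq> []" using bs(2) by auto
      let ?cs = "head_reduce R as bs"
      have lc: "last as \<in> carrier R" "last bs \<in> carrier R" using ne bs(2) asc last_in_set by blast+
      have h: "horner R t ?cs = last bs \<otimes> horner R t as" "length ?cs = length as - 1"
        using head_reduce[OF t asc bs(2) len] bs(4) t asc lc by simp_all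
      have "\<exists>b\<in>B. b \<noteq> \<zero> \<and> (\<exists>cs. set cs \<subseteq> B \<and> length cs = length bs - 1 \<and> b \<otimes> horner R t ?cs = horner R t cs)"
        by (rule less.hyps) (use h(2) ne head_reduce_subring[OF B less.prems bs(1,2) ne] in auto)
      then obtain b cs where b: "b \<in> B" "b \<noteq> \<zero>" "set cs \<subseteq> B" "length cs = length bs - 1"
        "b \<otimes> horner R t ?cs = horner R t cs" by auto
      have bc: "b \<in> carrier R" using b(1) Bp(1) by auto
      have "(b \<otimes> last bs) \<otimes> horner R t as = horner R t cs"
        using b(5) h(1) bc lc t asc by (simp add: m_assoc)
      moreover have "b \<otimes> last bs \<noteq> \<zero>" using b(2) bs(3) bc lc by (simp add: integral_iff)
      ultimately show ?thesis using b lb Bp(6) by metis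
    qed
  qed
  show ?thesis using u main by (elim adjoinE) auto
qed

text \<open>Over the fraction field of B, the \<open>length bs - 1\<close> lowest powers of t span
  B[t], so one more element forces a dependence. Denominators are cleared element by element and
  moved into the coefficients afterwards.\<close>

lemma adjoin_algebraic_dependent:
  assumes B: "subring B R" and t: "t \<in> carrier R"
    and bs: "set bs \<subseteq> B" "bs \<noteq> []" "last bs \<noteq> \<zero>" "horner R t bs = \<zero>"
    and vs: "set vs \<subseteq> adjoin R B t" "length bs \<le> length vs"
  shows "\<exists>cs. set cs \<subseteq> B \<and> length cs = length vs \<and> \<not> set cs \<subseteq> {\<zero>} \<and> lincomb R cs vs = \<zero>"
proof -
  note Bp = subringE[OF B]
  obtain g where g: "\<And>u. u \<in> adjoin R B t \<Longrightarrow> g u \<in> B \<and> g u \<noteq> \<zero> \<and>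
      (\<exists>cs. set cs \<subseteq> B \<and> length cs = length bs - 1 \<and> g u \<otimes> u = horner R t cs)"
    using adjoin_algebraic_span[OF B t bs] by metis
  let ?ws = "map (\<lambda>i. t [^] i) [0..<length bs - 1]"
  have "\<exists>cs. set cs \<subseteq> B \<and> length cs = length (map (\<lambda>u. g u \<otimes> u) vs) \<and> \<not> set cs \<subseteq> {\<zero>} \<and>
      lincomb R cs (map (\<lambda>u. g u \<otimes> u) vs) = \<zero>"
  proof (rule lincomb_dependent[OF B, of ?ws])
    show "set ?ws \<subseteq> carrier R" using t by auto
    show "length ?ws < length (map (\<lambda>u. g u \<otimes> u) vs)" using vs(2) bs(2) by (cases bs) auto
    fix w assume "w \<in> set (map (\<lambda>u. g u \<otimes> u) vs)"
    then obtain u where u: "u \<in> adjoin R B t" "w = g u \<otimes> u" using vs(1) by auto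
    obtain cs where cs: "set cs \<subseteq> B" "length cs = length bs - 1" "g u \<otimes> u = horner R t cs"
      using g[OF u(1)] by auto
    then have "w = lincomb R cs ?ws"
      using lincomb_powers[OF t, of cs] u(2) Bp(1) by (metis order_trans)
    then show "\<exists>cs. set cs \<subseteq> B \<and> length cs = length ?ws \<and> w = lincomb R cs ?ws" using cs by auto
  qed
  then obtain cs where cs: "set cs \<subseteq> B" "length cs = length vs" "\<not> set cs \<subseteq> {\<zero>}"
    "lincomb R cs (map (\<lambda>u. g u \<otimes> u) vs) = \<zero>" by auto
  have vc: "set vs \<subseteq> carrier R" using vs(1) subringE(1)[OF adjoin_subring(1)[OF B t]] by auto
  have gB: "g u \<in> B" "g u \<noteq> \<zero>" if "u \<in> set vs" for u using g that vs(1) by auto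
  let ?ds = "map2 (\<lambda>c w. c \<otimes> g w) cs vs"
  have "lincomb R ?ds vs = \<zero>"
    using lincomb_scaled[OF cs(2) order_trans[OF cs(1) Bp(1)] vc, of g] cs(4) subsetD[OF Bp(1) gB(1)] by simp
  moreover have "set ?ds \<subseteq> B" 
  proof
    fix x assume "x \<in> set ?ds"
    then obtain c w where "(c, w) \<in> set (zip cs vs)" "x = c \<otimes> g w" by auto
    then show "x \<in> B" using cs(1) gB Bp(6) by (metis set_zip_leftD set_zip_rightD subsetD)
  qed
  moreover have "\<not> set ?ds \<subseteq> {\<zero>}"
  proof -
    obtain c where "c \<in> set cs" "c \<noteq> \<zero>" using cs(3) by auto
    then obtain i where i: "i < length cs" "cs ! i \<noteq> \<zero>" by (metis in_set_conv_nth)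
    have "cs ! i \<in> carrier R" "g (vs ! i) \<in> carrier R" "g (vs ! i) \<noteq> \<zero>"
      using i cs(1,2) gB[of "vs ! i"] Bp(1) nth_mem by (auto simp: subset_eq)
    then have "?ds ! i \<noteq> \<zero>" using i cs(2) by (simp add: integral_iff)
    moreover have "?ds ! i \<in> set ?ds" by (rule nth_mem) (use i cs(2) in simp)
    ultimately show ?thesis by auto
  qed
  ultimately show ?thesis using cs(2) by (metis length_map length_zip min.idem)
qed

text \<open>Cancel powers of d from its relation until the constant term is nonzero; this term is
  then d times an element of B[d]. It reduces a prescribed value at d to a prescribed value at an
  element of B.\<close>

lemma multiple_in_subring:
  assumes B: "subring B R" and d: "d \<in> carrier R" "d \<noteq> \<zero>"
    and cs: "set cs \<subseteq> B" "\<not> set cs \<subseteq> {\<zero>}" "horner R d cs = \<zero>"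
  shows "\<exists>h \<in> adjoin R B d. d \<otimes> h \<in> B \<and> d \<otimes> h \<noteq> \<zero>"
  using cs
proof (induction cs)
  case (Cons c cs)
  note Bp = subringE[OF B]
  have cc: "c \<in> carrier R" "horner R d cs \<in> carrier R" using Cons.prems Bp(1) d by auto
  show ?case
  proof (cases "c = \<zero>")
    case True
    then have "horner R d cs = \<zero>" using Cons.prems(3) d cc integral by fastforce
    then show ?thesis using Cons True by auto
  next
    case False
    let ?h = "\<ominus> horner R d cs"
    have "c = d \<otimes> ?h" using Cons.prems(3) cc d by (simp add: r_minus sum_zero_eq_neg)
    moreover have "?h \<in> adjoin R B d"
      using subringE(5)[OF adjoin_subring(1)[OF B d(1)]] Cons.prems(1) by (auto intro!: adjoin_mem)
    ultimately show ?thesis using Cons.prems(1) False by auto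
  qed
qed simp

text \<open>With n = \<open>length bs - 1\<close>, the first n powers of t^p are independent over B,
  but together with t they are n + 1 elements of B[t], hence dependent. So t occurs with nonzero
  coefficient: over the fraction field F of B, t lies in F(t^p), which is separability.\<close>

lemma separable_multiple:
  assumes B: "subring B R" and t: "t \<in> carrier R"
    and bs: "set bs \<subseteq> B" "bs \<noteq> []" "last bs \<noteq> \<zero>" "horner R t bs = \<zero>"
    and indep: "\<And>as. set as \<subseteq> B \<Longrightarrow> length as < length bs \<Longrightarrow> horner R (t [^] p) as = \<zero> \<Longrightarrow> set as \<subseteq> {\<zero>}"
  shows "\<exists>b\<in>B. b \<noteq> \<zero> \<and> b \<otimes> t \<in> adjoin R B (t [^] p)"
proof -
  note Bp = subringE[OF B]
  note A = adjoin_subring[OF B t]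
  have tp: "t [^] p \<in> carrier R" using t by simp
  let ?n = "length bs - 1"
  let ?ws = "map (\<lambda>i. (t [^] p) [^] i) [0..<?n]"
  have "set (?ws @ [t]) \<subseteq> adjoin R B t" using A subring_pow[OF A(1)] by auto
  then obtain cs where cs: "set cs \<subseteq> B" "length cs = length (?ws @ [t])" "\<not> set cs \<subseteq> {\<zero>}"
    "lincomb R cs (?ws @ [t]) = \<zero>"
    using adjoin_algebraic_dependent[OF B t bs, of "?ws @ [t]"] bs(2) by (cases bs) auto
  then obtain cs' c where cs': "cs = cs' @ [c]" by (metis append_butlast_last_id length_greater_0_conv
      length_append_singleton zero_less_Suc)
  have len: "length cs' = ?n" using cs cs' by simp
  have cc: "c \<in> carrier R" "c \<in> B" "set cs' \<subseteq> carrier R" "set cs' \<subseteq> B" using cs cs' Bp(1) by auto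
  have "lincomb R cs' ?ws = horner R (t [^] p) cs'"
    using lincomb_powers[OF tp cc(3)] len by simp
  moreover have "lincomb R (cs' @ [c]) (?ws @ [t]) = lincomb R cs' ?ws \<oplus> lincomb R [c] [t]"
    by (rule lincomb_append) (use len cc t in auto)
  ultimately have e: "horner R (t [^] p) cs' \<oplus> c \<otimes> t = \<zero>" using cs(4) cs' cc t by simp
  have hc: "horner R (t [^] p) cs' \<in> carrier R" using tp cc by simp
  have "c \<noteq> \<zero>"
  proof
    assume "c = \<zero>"
    then have "horner R (t [^] p) cs' = \<zero>" using e t hc by simp
    then have "set cs' \<subseteq> {\<zero>}" using indep[OF cc(4)] len bs(2) by (cases bs) auto
    then show False using cs(3) cs' \<open>c = \<zero>\<close> by auto
  qed
  moreover have "c \<otimes> t = \<ominus> horner R (t [^] p) cs'"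
    using e hc cc t by (metis a_comm m_closed sum_zero_eq_neg)
  moreover have "\<ominus> horner R (t [^] p) cs' \<in> adjoin R B (t [^] p)"
    using subringE(5)[OF adjoin_subring(1)[OF B tp]] cc(4) by (auto intro!: adjoin_mem)
  ultimately show ?thesis using cc(2) by auto
qed

text \<open>Put C = B[t^p]. Then B[t] is spanned over C by the t^i with i < p, and b t in C shows
  that b^p moves all of them into C.\<close>

lemma separable_conductor:
  assumes B: "subring B R" and t: "t \<in> carrier R"
    and b: "b \<in> B" "b \<otimes> t \<in> adjoin R B (t [^] p)" and u: "u \<in> adjoin R B t"
  shows "b [^] p \<otimes> u \<in> adjoin R B (t [^] p)"
proof -
  note Bp = subringE[OF B]
  let ?C = "adjoin R B (t [^] p)"
  have tp: "t [^] p \<in> carrier R" using t by simp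
  note C = adjoin_subring[OF B tp]
  note Cp = subringE[OF C(1)]
  have BC: "B \<subseteq> ?C" by (rule subset_adjoin[OF B tp])
  have 1: "\<exists>cs. set cs \<subseteq> ?C \<and> length cs = p \<and> horner R t as = horner R t cs" if "set as \<subseteq> B" for as
    using that
  proof (induction as)
    case Nil
    then show ?case using Cp(2) t
      by (intro exI[of _ "replicate p \<zero>"]) (auto simp: set_replicate_conv_if horner_zeros)
  next
    case (Cons a as)
    then obtain cs where cs: "set cs \<subseteq> ?C" "length cs = p" "horner R t as = horner R t cs" by auto
    then obtain cs' c where cs': "cs = cs' @ [c]" by (metis append_butlast_last_id length_greater_0_conv p_gt_0)
    have cc: "set cs' \<subseteq> carrier R" "c \<in> carrier R" "a \<in> carrier R" using cs cs' Cp(1) Cons.prems Bp(1) by auto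
    have len: "p = Suc (length cs')" using cs cs' by simp
    have hc: "horner R t cs' \<in> carrier R" using cc t by simp
    have "horner R t (a # as) = a \<oplus> t \<otimes> (horner R t cs' \<oplus> t [^] length cs' \<otimes> c)"
      using horner_append[OF t cc(1), of "[c]"] cs(3) cs' cc t by simp
    also have "\<dots> = (a \<oplus> t [^] p \<otimes> c) \<oplus> t \<otimes> horner R t cs'"
    proof -
      have *: "t [^] length cs' \<in> carrier R" using t by simp
      have "t [^] p = t [^] length cs' \<otimes> t" by (subst len) (rule nat_pow_Suc)
      then show ?thesis using * hc cc t by (simp add: r_distr a_assoc m_ac a_lcomm a_comm)
    qed
    finally have "horner R t (a # as) = horner R t ((a \<oplus> t [^] p \<otimes> c) # cs')" by simp
    moreover have "set ((a \<oplus> t [^] p \<otimes> c) # cs') \<subseteq> ?C"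
      using cs cs' C(2) Cp(6,7) BC Cons.prems by auto
    ultimately show ?case using len by (metis length_Cons)
  qed
  have 2: "b [^] k \<otimes> horner R t cs \<in> ?C" if "set cs \<subseteq> ?C" "length cs \<le> k" for cs k
    using that
  proof (induction cs arbitrary: k)
    case Nil
    then show ?case using Cp(2) b(1) Bp(1) by auto
  next
    case (Cons c cs)
    then obtain k' where k: "k = Suc k'" by (cases k) auto
    have IH: "b [^] k' \<otimes> horner R t cs \<in> ?C" using Cons k by auto
    have cc: "b \<in> carrier R" "b [^] k' \<in> carrier R" "c \<in> carrier R" "horner R t cs \<in> carrier R"
      using Cons.prems Cp(1) b(1) Bp(1) t by (auto simp: subset_eq)
    have "b [^] k \<otimes> horner R t (c # cs) = b [^] k \<otimes> c \<oplus> (b \<otimes> t) \<otimes> (b [^] k' \<otimes> horner R t cs)"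
      unfolding k using cc t by (simp del: nat_pow_closed) algebra
    moreover have "b [^] k \<in> ?C" using b(1) BC subring_pow[OF C(1)] by auto
    ultimately show ?case using IH b(2) Cp(6,7) Cons.prems by auto
  qed
  obtain as where "set as \<subseteq> B" "u = horner R t as" using u by (rule adjoinE)
  then show ?thesis using 1[of as] 2[of _ p] by fastforce
qed

text \<open>Successive stages would require \<open>\<beta>\<close> to the power 1 + p + ... +
  p^(f-1). Rounding this up to p^f matters: a map that is semilinear for q = p^f takes a q-th power
  out as a power independent of f.\<close>

lemma iterated_conductor:
  assumes B: "subring B R" and t: "t \<in> carrier R" and \<beta>: "\<beta> \<in> B"
    and cond: "\<And>u. u \<in> adjoin R B t \<Longrightarrow> \<beta> \<otimes> u \<in> adjoin R B (t [^] p)"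
    and u: "u \<in> adjoin R B t"
  shows "\<beta> [^] (p ^ f) \<otimes> u \<in> adjoin R B (t [^] (p ^ f))"
proof (induction f)
  case 0
  then show ?case using subringE(6)[OF adjoin_subring(1)[OF B t]] subset_adjoin[OF B t] \<beta> u t
    subringE(1)[OF B] by (auto simp: subset_eq)
next
  case (Suc f)
  note Bp = subringE[OF B]
  let ?q = "p ^ f" let ?C = "adjoin R B (t [^] (p ^ Suc f))"
  have tq: "t [^] (p ^ Suc f) \<in> carrier R" using t by simp
  note C = adjoin_subring[OF B tq]
  note Cp = subringE[OF C(1)]
  note A = adjoin_subring[OF B t]
  note Ap = subringE[OF A(1)]
  have BC: "B \<subseteq> ?C" by (rule subset_adjoin[OF B tq])
  have \<beta>c: "\<beta> \<in> carrier R" using \<beta> Bp(1) by auto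
  have 1: "\<beta> [^] ?q \<otimes> w [^] ?q \<in> ?C" if "w \<in> adjoin R B t" for w
  proof -
    have wc: "w \<in> carrier R" using that Ap(1) by auto
    have "(\<beta> \<otimes> w) [^] ?q \<in> adjoin R B ((t [^] p) [^] ?q)"
      by (rule adjoin_frob[OF B _ cond[OF that]]) (use t in simp)
    moreover have "(t [^] p) [^] ?q = t [^] (p ^ Suc f)" using nat_pow_pow[OF t, of p ?q] by simp
    ultimately show ?thesis using wc \<beta>c by (simp add: nat_pow_distrib)
  qed
  \<comment> \<open>The factor w^q collects the powers of t^q met on the way down the list, so that
    \<open>1\<close> handles each coefficient and \<open>\<beta>\<close>^q is spent only once for
    the whole sum.\<close>
  have 2: "\<beta> [^] ?q \<otimes> w [^] ?q \<otimes> horner R (t [^] ?q) as \<in> ?C" if "w \<in> adjoin R B t" "set as \<subseteq> B" for w as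
    using that
  proof (induction as arbitrary: w)
    case Nil
    then show ?case using Cp(2) \<beta>c Ap(1) by auto
  next
    case (Cons a as)
    have wc: "w \<in> carrier R" using Cons.prems Ap(1) by auto
    have cc: "a \<in> carrier R" "horner R (t [^] ?q) as \<in> carrier R" "\<beta> [^] ?q \<in> carrier R" "w [^] ?q \<in> carrier R"
      "t [^] ?q \<in> carrier R"
      using Cons.prems Bp(1) wc \<beta>c t by auto
    have "\<beta> [^] ?q \<otimes> w [^] ?q \<otimes> horner R (t [^] ?q) (a # as) =
        (\<beta> [^] ?q \<otimes> w [^] ?q) \<otimes> a \<oplus> \<beta> [^] ?q \<otimes> (w [^] ?q \<otimes> t [^] ?q) \<otimes> horner R (t [^] ?q) as"
      using cc by (simp del: nat_pow_closed) algebra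
    also have "w [^] ?q \<otimes> t [^] ?q = (w \<otimes> t) [^] ?q" using wc t by (simp add: nat_pow_distrib)
    finally have e: "\<beta> [^] ?q \<otimes> w [^] ?q \<otimes> horner R (t [^] ?q) (a # as) =
        (\<beta> [^] ?q \<otimes> w [^] ?q) \<otimes> a \<oplus> \<beta> [^] ?q \<otimes> (w \<otimes> t) [^] ?q \<otimes> horner R (t [^] ?q) as" .
    have "\<beta> [^] ?q \<otimes> (w \<otimes> t) [^] ?q \<otimes> horner R (t [^] ?q) as \<in> ?C"
      by (rule Cons.IH) (use Cons.prems A(2) Ap(6) in auto)
    moreover have "(\<beta> [^] ?q \<otimes> w [^] ?q) \<otimes> a \<in> ?C"
      using 1[OF Cons.prems(1)] BC Cons.prems(2) Cp(6) by auto
    ultimately show ?case unfolding e by (intro Cp(7))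
  qed
  obtain as where as: "set as \<subseteq> B" "\<beta> [^] ?q \<otimes> u = horner R (t [^] ?q) as" using Suc by (rule adjoinE)
  have uc: "u \<in> carrier R" using u Ap(1) by auto
  have 3: "\<beta> [^] ?q \<otimes> (\<beta> [^] ?q \<otimes> u) \<in> ?C"
    using 2[of \<one> as] as Ap(3) \<beta>c uc by simp
  \<comment> \<open>The previous stage and this one cost an exponent q each, and p q is at least 2
    q.\<close>
  have "2 * ?q \<le> p ^ Suc f" using prime_ge_2_nat[OF prime_p] by simp
  then obtain k where k: "p ^ Suc f = k + (?q + ?q)" by (metis le_add_diff_inverse2 mult_2)
  have "\<beta> [^] (p ^ Suc f) \<otimes> u = \<beta> [^] k \<otimes> (\<beta> [^] ?q \<otimes> (\<beta> [^] ?q \<otimes> u))"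
    unfolding k using \<beta>c uc by (simp add: nat_pow_mult[symmetric] m_assoc)
  moreover have "\<beta> [^] k \<in> ?C" using \<beta> BC subring_pow[OF C(1)] by auto
  ultimately show ?case using 3 Cp(6) by auto
qed

text \<open>This makes the coefficientwise action of \<open>\<Theta>\<close> well defined on B[t^q].
  Pseudo-division by the Frobenius twist of \<open>bs\<close> shortens a relation until independence
  makes it trivial. \<open>\<Theta>\<close> commutes with every step, and the leading coefficient
  picked up on the other side is nonzero in a domain.\<close>

lemma horner_image_kernel:
  assumes B: "subring B R" and t: "t \<in> carrier R"
    and bs: "set bs \<subseteq> B" "bs \<noteq> []" "last bs \<noteq> \<zero>" "horner R t bs = \<zero>"
    and indep: "\<And>as. set as \<subseteq> B \<Longrightarrow> length as < length bs \<Longrightarrow> horner R (t [^] (p ^ f)) as = \<zero> \<Longrightarrow> set as \<subseteq> {\<zero>}"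
    and L: "frob_linear R B (p ^ f) (p ^ g) \<Theta>"
    and "set as \<subseteq> B" "horner R (t [^] (p ^ f)) as = \<zero>"
  shows "horner R (t [^] (p ^ g)) (map \<Theta> as) = \<zero>"
  using assms(9,10)
proof (induction "length as" arbitrary: as rule: less_induct)
  case less
  note Bp = subringE[OF B]
  have tc: "t [^] k \<in> carrier R" for k :: nat using t by simp
  have \<Theta>B: "\<Theta> b \<in> B" if "b \<in> B" for b using L that by (auto simp: frob_linear_def)
  show ?case
  proof (cases "length as < length bs")
    case True
    then have "set as \<subseteq> {\<zero>}" using indep less.prems by blast
    then have "set (map \<Theta> as) \<subseteq> {\<zero>}" using frob_linear_zero[OF B L] by auto
    then show ?thesis by (rule horner_zeros[OF tc])
  next
    case False
    let ?bs = "\<lambda>k. map (\<lambda>b. b [^] (p ^ k)) bs"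
    have len: "length (?bs k) \<le> length as" and ne: "as \<noteq> []" for k using bs(2) False by auto
    have bsB: "set (?bs k) \<subseteq> B" "set (?bs k) \<subseteq> carrier R" "?bs k \<noteq> []" "last (?bs k) = last bs [^] (p ^ k)" for k
      using subring_pow[OF B] bs(1,2) Bp(1) by (auto simp: last_map)
    have hbs: "horner R (t [^] (p ^ k)) (?bs k) = \<zero>" for k
      using frob_horner[OF t, of bs k] bs Bp(1) by auto
    have asc: "set as \<subseteq> carrier R" "set (map \<Theta> as) \<subseteq> carrier R" using less.prems(1) \<Theta>B Bp(1) by auto
    have lc: "last as \<in> carrier R" "\<Theta> (last as) \<in> carrier R" "last bs \<in> carrier R"
      using asc ne last_in_set bs(1,2) Bp(1) by (auto simp: subset_eq)
    let ?cs = "head_reduce R as (?bs f)"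
    have cs: "set ?cs \<subseteq> B" by (rule head_reduce_subring[OF B less.prems(1) bsB(1,3) ne])
    have "horner R (t [^] (p ^ f)) ?cs = \<zero>" "length ?cs = length as - 1"
      using head_reduce[OF tc asc(1) bsB(2,3) len] less.prems(2) hbs lc tc bsB(4) by simp_all
    then have "horner R (t [^] (p ^ g)) (map \<Theta> ?cs) = \<zero>"
      using less.hyps[OF _ cs] ne by auto
    moreover have "map \<Theta> ?cs = head_reduce R (map \<Theta> as) (?bs g)"
      by (rule map_head_reduce[OF B L _ _ less.prems(1) ne bs(1,2)]) auto
    moreover have "horner R (t [^] (p ^ g)) (head_reduce R (map \<Theta> as) (?bs g)) =
        last bs [^] (p ^ g) \<otimes> horner R (t [^] (p ^ g)) (map \<Theta> as)"
      using head_reduce(1)[OF tc[of "p ^ g"] asc(2) bsB(2,3), of g] len[of g] hbs[of g] bsB(4)[of g] lc tc ne asc(2)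
      by (simp add: last_map)
    ultimately have "last bs [^] (p ^ g) \<otimes> horner R (t [^] (p ^ g)) (map \<Theta> as) = \<zero>" by simp
    moreover have "last bs [^] (p ^ g) \<noteq> \<zero>" by (rule pow_nonzero[OF lc(3) bs(3)])
    ultimately show ?thesis using integral_iff lc(3) asc(2) tc by simp
  qed
qed


text \<open>\<open>\<Theta>\<close> extends coefficientwise to a map on B[t^q]. Multiplication by
  \<open>\<beta>\<close>^q moves B[t] into this domain, and a factor h with d h in B reduces the
  value at d to a value of \<open>\<Theta>\<close>. Since \<open>\<beta>\<close>^q comes out as
  \<open>\<beta>\<close> to the power p^f0, the value at d depends neither on f nor on d or
  h.\<close>

lemma uniform_splitting_separable:
  assumes T: "uniform_splitting R p B" and B: "subring B R" and t: "t \<in> carrier R"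
    and bs: "set bs \<subseteq> B" "bs \<noteq> []" "last bs \<noteq> \<zero>" "horner R t bs = \<zero>"
    and indep: "\<And>f as. set as \<subseteq> B \<Longrightarrow> length as < length bs \<Longrightarrow>
      horner R (t [^] (p ^ f)) as = \<zero> \<Longrightarrow> set as \<subseteq> {\<zero>}"
  shows "uniform_splitting R p (adjoin R B t)"
proof -
  note Bp = subringE[OF B]
  let ?A = "adjoin R B t"
  have A: "subring ?A R" and tA: "t \<in> ?A" and BA: "B \<subseteq> ?A"
    using adjoin_subring[OF B t] subset_adjoin[OF B t] by auto
  note Ap = subringE[OF A]
  obtain c f0 where c: "c \<in> B" "c \<noteq> \<zero>" and T': "\<And>d. d \<in> B \<Longrightarrow> d \<noteq> \<zero> \<Longrightarrow>
    \<exists>f\<^sub>1. \<forall>f\<ge>f\<^sub>1. \<exists>\<Theta>. frob_linear R B (p ^ f) (p ^ f0) \<Theta> \<and> \<Theta> d = c"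
    using T by (auto simp: uniform_splitting_def)
  obtain b where b: "b \<in> B" "b \<noteq> \<zero>" "b \<otimes> t \<in> adjoin R B (t [^] p)"
    using separable_multiple[OF B t bs] indep[of _ 1] by auto
  define \<beta> where "\<beta> = b [^] p"
  have \<beta>: "\<beta> \<in> B" "\<beta> \<noteq> \<zero>" "\<beta> \<in> carrier R"
    using subring_pow[OF B] b pow_nonzero Bp(1) by (auto simp: \<beta>_def subset_eq)
  have cond: "\<beta> [^] (p ^ f) \<otimes> u \<in> adjoin R B (t [^] (p ^ f))" if "u \<in> ?A" for f u
    by (rule iterated_conductor[OF B t \<beta>(1) _ that])
       (simp add: \<beta>_def separable_conductor[OF B t b(1,3)])
  have "\<exists>f\<^sub>1. \<forall>f\<ge>f\<^sub>1. \<exists>\<Phi>. frob_linear R ?A (p ^ f) (p ^ f0) \<Phi> \<and> \<Phi> d = \<beta> [^] (p ^ f0) \<otimes> c"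
    if d: "d \<in> ?A" "d \<noteq> \<zero>" for d
  proof -
    have dc: "d \<in> carrier R" using d Ap(1) by auto
    \<comment> \<open>So many powers of d are dependent over B, which gives a nontrivial relation
      for d.\<close>
    let ?vs = "map (\<lambda>i. d [^] i) [0..<length bs]"
    have "set ?vs \<subseteq> ?A" using subring_pow[OF A d(1)] by auto
    then obtain cs where cs: "set cs \<subseteq> B" "length cs = length bs" "\<not> set cs \<subseteq> {\<zero>}" "lincomb R cs ?vs = \<zero>"
      using adjoin_algebraic_dependent[OF B t bs, of ?vs] by auto
    have "horner R d cs = \<zero>" using lincomb_powers[OF dc, of cs] cs Bp(1) by auto
    then obtain h where h: "h \<in> adjoin R B d" "d \<otimes> h \<in> B" "d \<otimes> h \<noteq> \<zero>"
      using multiple_in_subring[OF B dc d(2) cs(1,3)] by auto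
    have hA: "h \<in> ?A" using adjoin_minimal[OF A BA d(1)] h(1) by auto
    have hc: "h \<in> carrier R" using hA Ap(1) by auto
    obtain f1 where f1: "\<And>f. f \<ge> f1 \<Longrightarrow> \<exists>\<Theta>. frob_linear R B (p ^ f) (p ^ f0) \<Theta> \<and> \<Theta> (d \<otimes> h) = c"
      using T'[OF h(2,3)] by auto
    have "\<exists>\<Phi>. frob_linear R ?A (p ^ f) (p ^ f0) \<Phi> \<and> \<Phi> d = \<beta> [^] (p ^ f0) \<otimes> c" if f: "f \<ge> f1" for f
    proof -
      let ?q = "p ^ f" and ?r = "p ^ f0"
      let ?V = "adjoin R B (t [^] ?q)"
      obtain \<Theta> where \<Theta>: "frob_linear R B ?q ?r \<Theta>" "\<Theta> (d \<otimes> h) = c" using f1[OF f] by auto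
      have \<Theta>B: "\<Theta> b \<in> B" if "b \<in> B" for b using \<Theta> that by (auto simp: frob_linear_def)
      have \<Theta>0: "\<Theta> \<zero> = \<zero>" by (rule frob_linear_zero[OF B \<Theta>(1)])
      have tc: "t [^] k \<in> carrier R" for k :: nat using t by simp
      have V: "subring ?V R" "t [^] ?q \<in> ?V" "B \<subseteq> ?V"
        using adjoin_subring[OF B tc] subset_adjoin[OF B tc] by auto
      note Vp = subringE[OF V(1)]
      define \<Psi> where "\<Psi> = (\<lambda>as. horner R (t [^] ?r) (map \<Theta> as))"
      have MB: "set (map \<Theta> as) \<subseteq> B" "set (map \<Theta> as) \<subseteq> carrier R" if "set as \<subseteq> B" for as
        using \<Theta>B that Bp(1) by auto
      have \<Psi>A: "\<Psi> as \<in> ?A" if "set as \<subseteq> B" for as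
        unfolding \<Psi>_def using MB(1)[OF that] subring_pow[OF A tA] BA
        by (intro horner_in_subring[OF A]) auto
      have M_add: "map \<Theta> (list_add R as bs) = list_add R (map \<Theta> as) (map \<Theta> bs)" if "set as \<subseteq> B" "set bs \<subseteq> B" for as bs
        by (rule map_list_add[of B]) (use that \<Theta> in \<open>auto simp: frob_linear_def\<close>)
      have \<Psi>_add: "\<Psi> (list_add R as bs) = \<Psi> as \<oplus> \<Psi> bs" if "set as \<subseteq> B" "set bs \<subseteq> B" for as bs
        unfolding \<Psi>_def M_add[OF that] by (rule horner_list_add[OF tc MB(2)[OF that(1)] MB(2)[OF that(2)]])
      have ker: "\<Psi> as = \<zero>" if "set as \<subseteq> B" "horner R (t [^] ?q) as = \<zero>" for as
        unfolding \<Psi>_def by (rule horner_image_kernel[OF B t bs indep \<Theta>(1) that])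
      obtain \<Phi> where \<Phi>: "\<And>as. set as \<subseteq> B \<Longrightarrow> \<Phi> (horner R (t [^] ?q) as) = \<Psi> as"
        using lift_from_lists[OF B tc[of ?q], of \<Psi>] \<Psi>A Ap(1) \<Psi>_add ker by blast
      have cl: "\<Phi> u \<in> ?A" if "u \<in> ?V" for u using that \<Phi> \<Psi>A by (elim adjoinE) auto
      have add: "u \<oplus> v \<in> ?V \<and> \<Phi> (u \<oplus> v) = \<Phi> u \<oplus> \<Phi> v" if u: "u \<in> ?V" and v: "v \<in> ?V" for u v
      proof -
        obtain as bs where *: "set as \<subseteq> B" "u = horner R (t [^] ?q) as" "set bs \<subseteq> B" "v = horner R (t [^] ?q) bs"
          using u v by (auto elim!: adjoinE)
        have "horner R (t [^] ?q) (list_add R as bs) = u \<oplus> v"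
          using horner_list_add[OF tc, of as bs] * Bp(1) by auto
        then show ?thesis using \<Phi>[of "list_add R as bs"] \<Phi>[of as] \<Phi>[of bs] * \<Psi>_add[OF *(1,3)]
          set_list_add[OF Bp(7) *(1,3)] Vp(7)[OF u v] by simp
      qed
      have scale: "s [^] ?q \<otimes> v \<in> ?V \<and> \<Phi> (s [^] ?q \<otimes> v) = s [^] ?r \<otimes> \<Phi> v"
        if s: "s \<in> B \<union> {t}" and v: "v \<in> ?V" for s v
      proof -
        obtain as where as: "set as \<subseteq> B" "v = horner R (t [^] ?q) as" using v by (rule adjoinE)
        have asc: "set as \<subseteq> carrier R" using as(1) Bp(1) by auto
        consider "s \<in> B" | "s = t" using s by auto
        then show ?thesis
        proof cases
          case 1
          let ?as = "map ((\<otimes>) (s [^] ?q)) as"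
          have sc: "s [^] k \<in> carrier R" for k :: nat using 1 Bp(1) by auto
          have "s [^] ?q \<otimes> v \<in> ?V" using 1 V(3) v subring_pow[OF V(1)] Vp(6) by auto
          moreover have "set ?as \<subseteq> B" using subring_pow[OF B 1] as Bp(6) by auto
          moreover have "horner R (t [^] ?q) ?as = s [^] ?q \<otimes> v"
            unfolding as(2) by (rule horner_map_mult[OF tc sc asc])
          moreover have "map \<Theta> ?as = map ((\<otimes>) (s [^] ?r)) (map \<Theta> as)"
            using \<Theta>(1) 1 as(1) by (auto simp: frob_linear_def subset_eq)
          ultimately show ?thesis using \<Phi>[of ?as] \<Phi>[of as] as horner_map_mult[OF tc[of ?r] sc MB(2)[OF as(1)]]
            by (simp add: \<Psi>_def del: map_map)
        next
          case 2
          have "s [^] ?q \<otimes> v \<in> ?V" using 2 V(2) v Vp(6) by auto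
          moreover have "set (\<zero> # as) \<subseteq> B" using as Bp(2) by auto
          ultimately show ?thesis using \<Phi>[of "\<zero> # as"] \<Phi>[of as] as \<Theta>0 2 tc
              horner_closed[OF tc MB(2)[OF as(1)]] horner_closed[OF tc asc]
            by (simp add: \<Psi>_def)
        qed
      qed
      have lin: "\<Phi> (s [^] ?q \<otimes> v) = s [^] ?r \<otimes> \<Phi> v" if "s \<in> ?A" "v \<in> ?V" for s v
        using semilinear_adjoin[OF B t Vp(1,2) add _ scale that] cl Ap(1) by blast
      let ?\<Phi> = "\<lambda>u. \<Phi> (\<beta> [^] ?q \<otimes> (h \<otimes> u))"
      have inV: "\<beta> [^] ?q \<otimes> (h \<otimes> u) \<in> ?V" if "u \<in> ?A" for u
        using cond that hA Ap(6) by blast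
      have uc: "u \<in> carrier R" if "u \<in> ?A" for u using that Ap(1) by auto
      have "frob_linear R ?A ?q ?r ?\<Phi>"
      proof -
        have "?\<Phi> (u \<oplus> v) = ?\<Phi> u \<oplus> ?\<Phi> v" if "u \<in> ?A" "v \<in> ?A" for u v
          using add[OF inV[OF that(1)] inV[OF that(2)]] uc[OF that(1)] uc[OF that(2)] \<beta>(3) hc
          by (simp add: r_distr)
        moreover have "?\<Phi> (s [^] ?q \<otimes> u) = s [^] ?r \<otimes> ?\<Phi> u" if "s \<in> ?A" "u \<in> ?A" for s u
        proof -
          have "\<beta> [^] ?q \<otimes> (h \<otimes> (s [^] ?q \<otimes> u)) = s [^] ?q \<otimes> (\<beta> [^] ?q \<otimes> (h \<otimes> u))"
            using uc[OF that(1)] uc[OF that(2)] \<beta>(3) hc by (simp add: m_lcomm)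
          then show ?thesis using lin[OF that(1) inV[OF that(2)]] by simp
        qed
        ultimately show ?thesis using cl inV by (auto simp: frob_linear_def)
      qed
      moreover have "?\<Phi> d = \<beta> [^] ?r \<otimes> c"
      proof -
        have "\<beta> [^] ?q \<otimes> (h \<otimes> d) = \<beta> [^] ?q \<otimes> (d \<otimes> h)" using dc hc by (simp add: m_comm)
        moreover have "\<beta> [^] ?q \<otimes> (d \<otimes> h) \<in> B" using subring_pow[OF B \<beta>(1)] h Bp(6) by auto
        moreover have "\<Theta> (\<beta> [^] ?q \<otimes> (d \<otimes> h)) = \<beta> [^] ?r \<otimes> c" using \<Theta> \<beta>(1) h(2) by (auto simp: frob_linear_def)
        moreover have "\<beta> [^] ?r \<otimes> c \<in> carrier R" using \<beta>(3) c(1) Bp(1) by auto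
        ultimately show ?thesis using \<Phi>[of "[\<beta> [^] ?q \<otimes> (d \<otimes> h)]"] tc \<beta>(3) dc hc by (simp add: \<Psi>_def)
      qed
      ultimately show ?thesis by blast
    qed
    then show ?thesis by blast
  qed
  moreover have "\<beta> [^] (p ^ f0) \<otimes> c \<in> ?A" using subring_pow[OF B \<beta>(1)] c(1) Bp(6) BA by auto
  moreover have "\<beta> [^] (p ^ f0) \<otimes> c \<noteq> \<zero>"
    using c Bp(1) \<beta> pow_nonzero by (auto simp: integral_iff subset_eq)
  ultimately show ?thesis unfolding uniform_splitting_def by blast
qed

text \<open>The degree of \<open>r [^] (p ^ f)\<close> over \<open>B\<close> is minimal for some \<open>f\<close>; this power is separable.\<close>

lemma uniform_splitting_adjoin:
  assumes T: "uniform_splitting R p B" and B: "subring B R" and r: "r \<in> carrier R"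
  shows "uniform_splitting R p (adjoin R B r)"
proof -
  note Bp = subringE[OF B]
  \<comment> \<open>All powers r^(p^f) compete at once: a shortest relation, attained for t =
    r^(p^f), is then at most as long as any relation of any t^(p^g). This is the independence that
    the separable case asks for.\<close>
  define P where "P = (\<lambda>n. \<exists>f bs. set bs \<subseteq> B \<and> \<not> set bs \<subseteq> {\<zero>} \<and> horner R (r [^] (p ^ f)) bs = \<zero> \<and> length bs = n)"
  show ?thesis
  proof (cases "\<exists>n. P n")
    case False
    then have "set as \<subseteq> {\<zero>}" if "set as \<subseteq> B" "horner R r as = \<zero>" for as
      using that r unfolding P_def by (metis nat_pow_eone power_0)
    then show ?thesis by (rule uniform_splitting_transcendental[OF T B r])
  next
    case True
    define n where "n = (LEAST n. P n)"
    have "P n" unfolding n_def using True by (rule LeastI_ex)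
    then obtain f bs where bs: "set bs \<subseteq> B" "\<not> set bs \<subseteq> {\<zero>}" "horner R (r [^] (p ^ f)) bs = \<zero>" "length bs = n"
      by (auto simp: P_def)
    define t where "t = r [^] (p ^ f)"
    have t: "t \<in> carrier R" using r by (simp add: t_def)
    have indep: "set as \<subseteq> {\<zero>}" if as: "set as \<subseteq> B" "length as < length bs" "horner R (t [^] (p ^ g)) as = \<zero>" for g as
    proof (rule ccontr)
      assume "\<not> set as \<subseteq> {\<zero>}"
      then have "P (length as)" unfolding P_def using as r by (auto simp: t_def pow_pow intro!: exI[of _ "f + g"] exI[of _ as])
      then have "n \<le> length as" unfolding n_def by (rule Least_le)
      then show False using as bs by simp
    qed
    have ne: "bs \<noteq> []" using bs(2) by auto
    have "last bs \<noteq> \<zero>"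
    proof
      assume l: "last bs = \<zero>"
      then have e: "bs = butlast bs @ replicate 1 \<zero>" using ne by (simp add: append_butlast_last_id flip: l)
      have bB: "set (butlast bs) \<subseteq> B" using bs(1) by (auto dest: in_set_butlastD)
      have "horner R t (butlast bs) = \<zero>"
        using horner_snoc_zero[OF t order_trans[OF bB Bp(1)], of 1] e bs(3) by (simp add: t_def)
      then have "set (butlast bs) \<subseteq> {\<zero>}" using indep[OF bB, of 0] ne t by simp
      then have "set (butlast bs @ replicate 1 \<zero>) \<subseteq> {\<zero>}" by simp
      then show False using bs(2) e by metis
    qed
    then have sep: "uniform_splitting R p (adjoin R B t)"
      using uniform_splitting_separable[OF T B t bs(1) ne _ bs(3)[folded t_def]] indep by blast
    have A: "subring (adjoin R B r) R" "r \<in> adjoin R B r" by (rule adjoin_subring[OF B r])+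
    show ?thesis
    proof (rule uniform_splitting_root[OF sep _ A(1)])
      show "adjoin R B t \<subseteq> adjoin R B r"
        by (rule adjoin_minimal[OF A(1) subset_adjoin[OF B r]]) (use A subring_pow in \<open>simp add: t_def\<close>)
      show "s [^] (p ^ f) \<in> adjoin R B t" if "s \<in> adjoin R B r" for s
        unfolding t_def by (rule adjoin_frob[OF B r that])
    qed
  qed
qed

text \<open>A functional on \<open>K\<close> over \<open>K\<^sup>q\<close> with value \<open>\<one>\<close> at \<open>d\<close> is read off a maximal
  \<open>K\<^sup>q\<close>-subspace \<open>M\<close> that does not contain \<open>d\<close>, since then \<open>K = M \<oplus> K\<^sup>q d\<close>.\<close>

lemma uniform_splitting_subfield:
  assumes K: "subfield K R"
  shows "uniform_splitting R p K"
proof -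
  have Kr: "subring K R" by (rule subfieldE(1)[OF K])
  note Kp = subringE[OF Kr]
  have kc: "k \<in> carrier R" if "k \<in> K" for k using that Kp(1) by auto
  have "\<exists>\<Theta>. frob_linear R K (p ^ f) (p ^ 0) \<Theta> \<and> \<Theta> d = \<one>" if d: "d \<in> K" "d \<noteq> \<zero>" for d f
  proof -
    let ?q = "p ^ f"
    \<comment> \<open>These are the K^q-subspaces of K, with scalars written as q-th powers.\<close>
    define sub where "sub = (\<lambda>V. V \<subseteq> K \<and> \<zero> \<in> V \<and> (\<forall>v\<in>V. \<forall>w\<in>V. v \<oplus> w \<in> V) \<and> (\<forall>s\<in>K. \<forall>v\<in>V. s [^] ?q \<otimes> v \<in> V))"
    define \<A> where "\<A> = {V. sub V \<and> d \<notin> V}"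
    \<comment> \<open>K may have infinite degree over K^q, so the subspace comes from Zorn's
      lemma.\<close>
    have "\<exists>M\<in>\<A>. \<forall>X\<in>\<A>. M \<subseteq> X \<longrightarrow> X = M"
    proof (rule subset_Zorn_nonempty)
      have "{\<zero>} \<in> \<A>" using d Kp(2) kc by (auto simp: \<A>_def sub_def)
      then show "\<A> \<noteq> {}" by auto
    next
      fix \<C> assume C: "\<C> \<noteq> {}" "subset.chain \<A> \<C>"
      have add: "v \<oplus> w \<in> \<Union>\<C>" if vw: "v \<in> \<Union>\<C>" "w \<in> \<Union>\<C>" for v w
      proof -
        obtain X Y where "X \<in> \<C>" "Y \<in> \<C>" "v \<in> X" "w \<in> Y" using vw by auto
        moreover from this have "X \<subseteq> Y \<or> Y \<subseteq> X" using C(2) by (auto simp: subset.chain_def)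
        ultimately obtain Z where Z: "Z \<in> \<C>" "v \<in> Z" "w \<in> Z" by auto
        then have "sub Z" using C(2) by (auto simp: subset.chain_def \<A>_def)
        then show ?thesis using Z unfolding sub_def by blast
      qed
      have CA: "sub X" "d \<notin> X" if "X \<in> \<C>" for X
        using C(2) that by (auto simp: subset.chain_def \<A>_def)
      have "sub (\<Union>\<C>)"
        unfolding sub_def
      proof (intro conjI ballI add)
        show "\<Union>\<C> \<subseteq> K" by (rule Union_least) (use CA(1) in \<open>simp add: sub_def\<close>)
        obtain X where "X \<in> \<C>" using C(1) by auto
        then show "\<zero> \<in> \<Union>\<C>" using CA(1)[of X] by (auto simp: sub_def)
        fix s v assume "s \<in> K" "v \<in> \<Union>\<C>"
        then obtain X where X: "X \<in> \<C>" "v \<in> X" by auto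
        then have "s [^] ?q \<otimes> v \<in> X" using CA(1)[OF X(1)] \<open>s \<in> K\<close> by (simp add: sub_def)
        then show "s [^] ?q \<otimes> v \<in> \<Union>\<C>" using X(1) by blast
      qed
      then show "\<Union>\<C> \<in> \<A>" using CA(2) by (auto simp: \<A>_def)
    qed
    then obtain M where M: "sub M" "d \<notin> M" and max: "\<And>X. sub X \<Longrightarrow> d \<notin> X \<Longrightarrow> M \<subseteq> X \<Longrightarrow> X = M"
      by (auto simp: \<A>_def)
    have Mp: "M \<subseteq> K" "\<zero> \<in> M" "\<And>v w. v \<in> M \<Longrightarrow> w \<in> M \<Longrightarrow> v \<oplus> w \<in> M"
      "\<And>s v. s \<in> K \<Longrightarrow> v \<in> M \<Longrightarrow> s [^] ?q \<otimes> v \<in> M"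
      using M(1) by (auto simp: sub_def)
    have mc: "v \<in> carrier R" if "v \<in> M" for v using that Mp(1) kc by auto
    have neg: "\<ominus> v \<in> M" if "v \<in> M" for v
    proof -
      have "(\<ominus> \<one>) [^] ?q \<otimes> v = \<ominus> v" using mc[OF that] by (simp add: frob_minus l_minus)
      then show ?thesis using Mp(4)[of "\<ominus> \<one>" v] that Kp(3,5) by simp
    qed
    have inv: "\<exists>s'\<in>K. s' [^] ?q \<otimes> s [^] ?q = \<one>" if "s \<in> K" "s \<noteq> \<zero>" for s
    proof -
      have "inv s \<in> K" "inv s \<otimes> s = \<one>" using subfield_m_inv[OF K, of s] that by auto
      then show ?thesis using kc that by (metis nat_pow_distrib nat_pow_one)
    qed
    have ex: "\<exists>s\<in>K. \<exists>v\<in>M. b = v \<oplus> s [^] ?q \<otimes> d" if b: "b \<in> K" for b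
    proof (cases "b \<in> M")
      case True
      then show ?thesis using Kp(2) kc[OF d(1)] mc by (intro bexI[of _ \<zero>] bexI[of _ b]) auto
    next
      case False
      \<comment> \<open>M + K^q b is strictly larger than M, so by maximality it contains d. The
        coefficient of b in that expression is a nonzero q-th power, hence invertible, and one
        solves for b.\<close>
      let ?X = "{v \<oplus> s [^] ?q \<otimes> b | v s. v \<in> M \<and> s \<in> K}"
      have bX: "b \<in> ?X"
      proof -
        have "b = \<zero> \<oplus> \<one> [^] ?q \<otimes> b" using kc[OF b] by simp
        then show ?thesis using Mp(2) Kp(3) by blast
      qed
      have MX: "M \<subseteq> ?X"
      proof
        fix v assume v: "v \<in> M"
        have "v = v \<oplus> \<zero> [^] ?q \<otimes> b" using kc[OF b] mc[OF v] by simp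
        then show "v \<in> ?X" using v Kp(2) by blast
      qed
      have "sub ?X"
        unfolding sub_def
      proof (intro conjI ballI)
        show "?X \<subseteq> K" using Mp(1) Kp(6,7) b subring_pow[OF Kr] by auto
        show "\<zero> \<in> ?X" using MX Mp(2) by auto
        fix x assume "x \<in> ?X"
        then obtain v s where x: "x = v \<oplus> s [^] ?q \<otimes> b" "v \<in> M" "s \<in> K" by auto
        {
          fix y assume "y \<in> ?X"
          then obtain w s' where y: "y = w \<oplus> s' [^] ?q \<otimes> b" "w \<in> M" "s' \<in> K" by auto
          have "x \<oplus> y = (v \<oplus> w) \<oplus> (s \<oplus> s') [^] ?q \<otimes> b"
            using x y mc kc b by (simp add: frob_add l_distr a_ac)
          then show "x \<oplus> y \<in> ?X" using x y Mp(3) Kp(7) by blast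
        }
        fix r assume r: "r \<in> K"
        have "r [^] ?q \<otimes> x = r [^] ?q \<otimes> v \<oplus> (r \<otimes> s) [^] ?q \<otimes> b"
          using x mc kc b r by (simp add: nat_pow_distrib r_distr m_assoc)
        then show "r [^] ?q \<otimes> x \<in> ?X" using x r Mp(4) Kp(6) by blast
      qed
      then have "d \<in> ?X" using max[of ?X] MX bX False by auto
      then obtain v s where ds: "d = v \<oplus> s [^] ?q \<otimes> b" "v \<in> M" "s \<in> K" by auto
      have "s \<noteq> \<zero>" using ds M(2) mc kc[OF b] by auto
      then obtain s' where s': "s' \<in> K" "s' [^] ?q \<otimes> s [^] ?q = \<one>" using inv[OF ds(3)] by auto
      have cc: "s [^] ?q \<in> carrier R" "s' [^] ?q \<in> carrier R" "v \<in> carrier R" "b \<in> carrier R"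
        using kc mc ds s' b by auto
      have "s' [^] ?q \<otimes> (\<ominus> v) \<oplus> s' [^] ?q \<otimes> d = (s' [^] ?q \<otimes> s [^] ?q) \<otimes> b"
        unfolding ds(1) using cc by algebra
      then have "b = s' [^] ?q \<otimes> (\<ominus> v) \<oplus> s' [^] ?q \<otimes> d" using s' cc by simp
      then show ?thesis using Mp(4)[OF s'(1) neg[OF ds(2)]] s'(1) by blast
    qed
    have uniq: "s = s'" if e: "v \<oplus> s [^] ?q \<otimes> d = w \<oplus> s' [^] ?q \<otimes> d" and m: "v \<in> M" "w \<in> M" "s \<in> K" "s' \<in> K" for v w s s'
    proof (rule ccontr)
      assume "s \<noteq> s'"
      then have "s \<ominus> s' \<noteq> \<zero>" using kc m by simp
      moreover have "s \<ominus> s' \<in> K" using m Kp(5,7) by (simp add: a_minus_def)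
      ultimately obtain z where z: "z \<in> K" "z [^] ?q \<otimes> (s \<ominus> s') [^] ?q = \<one>" using inv by blast
      have cc: "s [^] ?q \<in> carrier R" "s' [^] ?q \<in> carrier R" "z [^] ?q \<in> carrier R" "v \<in> carrier R" "w \<in> carrier R" "d \<in> carrier R"
        using kc mc m z d by auto
      have "(s \<ominus> s') [^] ?q \<otimes> d = (v \<oplus> s [^] ?q \<otimes> d) \<ominus> v \<ominus> s' [^] ?q \<otimes> d"
        using cc frob_diff[OF kc[OF m(3)] kc[OF m(4)]] by algebra
      also have "\<dots> = w \<oplus> \<ominus> v" unfolding e using cc by algebra
      finally have "(s \<ominus> s') [^] ?q \<otimes> d \<in> M" using Mp(3) neg m by auto
      then have "z [^] ?q \<otimes> ((s \<ominus> s') [^] ?q \<otimes> d) \<in> M" using Mp(4) z by auto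
      also have "z [^] ?q \<otimes> ((s \<ominus> s') [^] ?q \<otimes> d) = d"
        using z cc kc m by (simp flip: m_assoc)
      finally show False using M(2) by simp
    qed
    \<comment> \<open>The q-th root of the coordinate along d. Roots are unique by
      \<open>uniq\<close>, and scalars r^q come out as r, so here f0 = 0 and every f is
      allowed.\<close>
    define \<Theta> where "\<Theta> = (\<lambda>b. SOME s. s \<in> K \<and> (\<exists>v\<in>M. b = v \<oplus> s [^] ?q \<otimes> d))"
    have \<Theta>: "\<Theta> (v \<oplus> s [^] ?q \<otimes> d) = s" if "v \<in> M" "s \<in> K" for v s
      unfolding \<Theta>_def by (rule some_equality) (use that uniq in blast)+
    have "\<Theta> (v \<oplus> s [^] ?q \<otimes> d \<oplus> (w \<oplus> s' [^] ?q \<otimes> d)) = s \<oplus> s'" if "v \<in> M" "s \<in> K" "w \<in> M" "s' \<in> K" for v s w s'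
    proof -
      have "v \<oplus> s [^] ?q \<otimes> d \<oplus> (w \<oplus> s' [^] ?q \<otimes> d) = (v \<oplus> w) \<oplus> (s \<oplus> s') [^] ?q \<otimes> d"
        using that mc kc d by (simp add: frob_add l_distr a_ac)
      then show ?thesis using \<Theta> that Mp(3) Kp(7) by simp
    qed
    then have 1: "\<Theta> (a \<oplus> b) = \<Theta> a \<oplus> \<Theta> b" if "a \<in> K" "b \<in> K" for a b
      using ex[OF that(1)] ex[OF that(2)] \<Theta> by fastforce
    have "\<Theta> (r [^] ?q \<otimes> (v \<oplus> s [^] ?q \<otimes> d)) = r \<otimes> s" if "v \<in> M" "s \<in> K" "r \<in> K" for v s r
    proof -
      have "r [^] ?q \<otimes> (v \<oplus> s [^] ?q \<otimes> d) = r [^] ?q \<otimes> v \<oplus> (r \<otimes> s) [^] ?q \<otimes> d"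
        using that mc kc d by (simp add: nat_pow_distrib r_distr m_assoc)
      then show ?thesis using \<Theta> that Mp(4) Kp(6) by simp
    qed
    then have 2: "\<Theta> (r [^] ?q \<otimes> b) = r \<otimes> \<Theta> b" if "r \<in> K" "b \<in> K" for r b
      using ex[OF that(2)] \<Theta> that(1) by fastforce
    have 3: "\<Theta> b \<in> K" if "b \<in> K" for b using ex[OF that] \<Theta> by fastforce
    have "frob_linear R K ?q (p ^ 0) \<Theta>" using 1 2 3 kc by (simp add: frob_linear_def)
    moreover have "\<Theta> d = \<one>" using \<Theta>[OF Mp(2) Kp(3)] kc[OF d(1)] by simp
    ultimately show ?thesis by blast
  qed
  then show ?thesis unfolding uniform_splitting_def using Kp(3) one_not_zero by blast
qed

end

section \<open>Graded rings\<close>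

locale graded_cring = graded_ring R G + cring R for R (structure) and G
begin

definition comp :: "'a \<Rightarrow> nat \<Rightarrow> 'a" where
  "comp x = (THE f. (\<forall>i. f i \<in> G i) \<and> finite {i. f i \<noteq> \<zero>} \<and> x = finsum R f {i. f i \<noteq> \<zero>})"

lemma grade_props:
  shows grade_carrier: "a \<in> G i \<Longrightarrow> a \<in> carrier R"
    and grade_zero: "\<zero> \<in> G i"
    and grade_add: "a \<in> G i \<Longrightarrow> b \<in> G i \<Longrightarrow> a \<oplus> b \<in> G i"
  using additive_subgroup.a_subset[OF grade_subgroup] additive_subgroup.zero_closed[OF grade_subgroup]
    additive_subgroup.a_closed[OF grade_subgroup] by blast+

lemma comp_spec:
  assumes "x \<in> carrier R"
  shows comp_grade: "comp x i \<in> G i" and comp_finite: "finite {i. comp x i \<noteq> \<zero>}"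
    and comp_sum: "x = finsum R (comp x) {i. comp x i \<noteq> \<zero>}"
  using theI'[OF grade_decomp[OF assms]] unfolding comp_def by auto

lemma comp_carrier [simp]: "x \<in> carrier R \<Longrightarrow> comp x i \<in> carrier R"
  using comp_grade grade_carrier by blast

lemma comp_unique:
  assumes f: "\<And>i. f i \<in> G i" and A: "finite A" "\<And>i. i \<notin> A \<Longrightarrow> f i = \<zero>" and x: "x = finsum R f A"
  shows "comp x = f"
proof -
  have fc: "f i \<in> carrier R" for i using f grade_carrier by blast
  have sub: "{i. f i \<noteq> \<zero>} \<subseteq> A" using A(2) by auto
  have fin: "finite {i. f i \<noteq> \<zero>}" using sub A(1) finite_subset by auto
  have "x = finsum R f {i. f i \<noteq> \<zero>}"
    unfolding x by (rule add.finprod_mono_neutral_cong_right) (use A(1) sub fc in auto)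
  moreover have "x \<in> carrier R" unfolding x using fc by (intro finsum_closed) auto
  ultimately show ?thesis
    unfolding comp_def using f fin by (intro the1_equality grade_decomp) auto
qed

lemma comp_sum_superset:
  assumes "x \<in> carrier R" "finite A" "{i. comp x i \<noteq> \<zero>} \<subseteq> A"
  shows "x = finsum R (comp x) A"
proof -
  have "finsum R (comp x) A = finsum R (comp x) {i. comp x i \<noteq> \<zero>}"
    by (rule add.finprod_mono_neutral_cong_right) (use assms in auto)
  then show ?thesis using comp_sum[OF assms(1)] by simp
qed

lemma comp_add:
  assumes "x \<in> carrier R" "y \<in> carrier R"
  shows "comp (x \<oplus> y) i = comp x i \<oplus> comp y i"
proof -
  let ?A = "{i. comp x i \<noteq> \<zero>} \<union> {i. comp y i \<noteq> \<zero>}"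
  have fin: "finite ?A" using comp_finite assms by auto
  have "x \<oplus> y = finsum R (comp x) ?A \<oplus> finsum R (comp y) ?A"
    using comp_sum_superset[OF assms(1) fin] comp_sum_superset[OF assms(2) fin] by auto
  also have "\<dots> = finsum R (\<lambda>i. comp x i \<oplus> comp y i) ?A"
    using assms by (intro finsum_addf[symmetric]) auto
  finally have "comp (x \<oplus> y) = (\<lambda>i. comp x i \<oplus> comp y i)"
    using fin assms by (intro comp_unique[of _ ?A] grade_add comp_grade) auto
  then show ?thesis by simp
qed

lemma comp_form: "h \<in> G n \<Longrightarrow> comp h i = (if i = n then h else \<zero>)"
proof -
  assume h: "h \<in> G n"
  have "comp h = (\<lambda>i. if i = n then h else \<zero>)"
    by (rule comp_unique[of _ "{n}"]) (use h grade_zero grade_carrier in auto)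
  then show ?thesis by simp
qed

lemma comp_zero [simp]: "comp \<zero> i = \<zero>"
  using comp_form[OF grade_zero[of 0], of i] by simp

lemma comp_minus:
  assumes "x \<in> carrier R" shows "comp (\<ominus> x) i = \<ominus> comp x i"
  using comp_add[of "\<ominus> x" x i] assms by (simp add: l_neg minus_equality)

lemma comp_diff:
  assumes "x \<in> carrier R" "y \<in> carrier R" shows "comp (x \<ominus> y) i = comp x i \<ominus> comp y i"
  using assms by (simp add: a_minus_def comp_add comp_minus)

lemma comp_ext:
  assumes "x \<in> carrier R" "y \<in> carrier R" "\<And>i. comp x i = comp y i" shows "x = y"
  using comp_sum[OF assms(1)] comp_sum[OF assms(2)] ext[of "comp x" "comp y"] assms(3) by metis

lemma finsum_additive_induct:
  assumes "finite A" "f \<in> A \<rightarrow> carrier R" "P \<zero>" "\<And>i. i \<in> A \<Longrightarrow> P (f i)"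
    "\<And>x y. x \<in> carrier R \<Longrightarrow> y \<in> carrier R \<Longrightarrow> P x \<Longrightarrow> P y \<Longrightarrow> P (x \<oplus> y)"
  shows "P (finsum R f A)"
  using assms(1,2,4)
proof (induction A)
  case (insert a A)
  have "finsum R f A \<in> carrier R" using insert.prems by (intro finsum_closed) auto
  moreover have "P (finsum R f A)" using insert by auto
  ultimately show ?case using insert assms(5) by (simp add: finsum_insert Pi_def)
qed (use assms in simp)

lemma comp_induct:
  assumes x: "x \<in> carrier R" and z: "P \<zero>" and c: "\<And>i. P (comp x i)"
    and add: "\<And>x y. x \<in> carrier R \<Longrightarrow> y \<in> carrier R \<Longrightarrow> P x \<Longrightarrow> P y \<Longrightarrow> P (x \<oplus> y)"
  shows "P x"
  by (subst comp_sum[OF x], rule finsum_additive_induct[OF comp_finite[OF x]])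
     (use x z c add in auto)

lemma graded_induct [consumes 1, case_names form add]:
  assumes x: "x \<in> carrier R" and h: "\<And>n h. h \<in> G n \<Longrightarrow> P h"
    and add: "\<And>x y. x \<in> carrier R \<Longrightarrow> y \<in> carrier R \<Longrightarrow> P x \<Longrightarrow> P y \<Longrightarrow> P (x \<oplus> y)"
  shows "P x"
  by (rule comp_induct[OF x]) (use h[OF grade_zero] h[OF comp_grade[OF x]] add in auto)

lemma comp_mult_form:
  assumes "x \<in> carrier R" and h: "h \<in> G n"
  shows "comp (x \<otimes> h) k = (if n \<le> k then comp x (k - n) \<otimes> h else \<zero>)"
  using assms(1)
proof (induction x rule: graded_induct)
  case (form m a)
  then show ?case using grade_carrier[OF h] by (auto simp: comp_form[OF grade_mult[OF form h]] comp_form)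
next
  case (add x y)
  then show ?case using grade_carrier[OF h] by (auto simp: l_distr comp_add)
qed

lemma comp_form_mult:
  assumes "x \<in> carrier R" and h: "h \<in> G n"
  shows "comp (h \<otimes> x) k = (if n \<le> k then h \<otimes> comp x (k - n) else \<zero>)"
  using comp_mult_form[OF assms] assms(1) grade_carrier[OF h] by (simp add: m_comm)

text \<open>Dividing an element of high degree modulo a homogeneous ideal may produce a quotient
  with low components; truncation removes them while the remainder stays in the ideal.\<close>

definition trunc :: "nat \<Rightarrow> 'a \<Rightarrow> 'a" where
  "trunc M x = finsum R (\<lambda>i. if M \<le> i then comp x i else \<zero>) {i. comp x i \<noteq> \<zero>}"

lemma trunc_carrier [simp]: "x \<in> carrier R \<Longrightarrow> trunc M x \<in> carrier R"
  unfolding trunc_def by (intro finsum_closed) auto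

lemma comp_trunc:
  assumes "x \<in> carrier R" shows "comp (trunc M x) i = (if M \<le> i then comp x i else \<zero>)"
proof -
  have "comp (trunc M x) = (\<lambda>i. if M \<le> i then comp x i else \<zero>)"
    by (rule comp_unique[OF _ comp_finite[OF assms]])
       (use assms in \<open>auto simp: comp_grade grade_zero trunc_def\<close>)
  then show ?thesis by simp
qed

lemma trunc_add:
  assumes "x \<in> carrier R" "y \<in> carrier R" shows "trunc M (x \<oplus> y) = trunc M x \<oplus> trunc M y"
  by (rule comp_ext) (use assms in \<open>auto simp: comp_trunc comp_add\<close>)

text \<open>If n exceeds M, then \<open>M - n\<close> is 0 and nothing is cut off, as it should be:
  the product already lies in degrees at least n.\<close>

lemma trunc_mult_form:
  assumes "x \<in> carrier R" "h \<in> G n" shows "trunc M (x \<otimes> h) = trunc (M - n) x \<otimes> h"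
proof (rule comp_ext)
  fix i
  show "comp (trunc M (x \<otimes> h)) i = comp (trunc (M - n) x \<otimes> h) i"
    using assms(1) grade_carrier[OF assms(2)]
    by (simp add: comp_trunc comp_mult_form[OF _ assms(2)] le_diff_conv)
qed (use assms(1) grade_carrier[OF assms(2)] in auto)

definition ge :: "nat \<Rightarrow> 'a set" where "ge M = {x \<in> carrier R. \<forall>i<M. comp x i = \<zero>}"

lemma ge_carrier: "x \<in> ge M \<Longrightarrow> x \<in> carrier R" by (simp add: ge_def)

lemma form_ge: "h \<in> G n \<Longrightarrow> M \<le> n \<Longrightarrow> h \<in> ge M"
  using grade_carrier by (auto simp: ge_def comp_form)

lemma trunc_ge: "x \<in> carrier R \<Longrightarrow> trunc M x \<in> ge M"
  by (simp add: ge_def comp_trunc)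

lemma trunc_id: "x \<in> ge M \<Longrightarrow> trunc M x = x"
proof (rule comp_ext)
  assume x: "x \<in> ge M"
  show "comp (trunc M x) i = comp x i" for i
    using x comp_trunc[OF ge_carrier[OF x]] by (simp add: ge_def)
qed (simp_all add: ge_def)

lemma ge_0: "ge 0 = carrier R" by (auto simp: ge_def)

lemma ge_mono: "M \<le> N \<Longrightarrow> ge N \<subseteq> ge M" by (auto simp: ge_def)

lemma ge_add: "x \<in> ge M \<Longrightarrow> y \<in> ge M \<Longrightarrow> x \<oplus> y \<in> ge M"
  by (simp add: ge_def comp_add)

lemma ge_induct [consumes 1, case_names form add]:
  assumes x: "x \<in> ge M" and h: "\<And>n h. M \<le> n \<Longrightarrow> h \<in> G n \<Longrightarrow> P h"
    and add: "\<And>x y. x \<in> carrier R \<Longrightarrow> y \<in> carrier R \<Longrightarrow> P x \<Longrightarrow> P y \<Longrightarrow> P (x \<oplus> y)"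
  shows "P x"
proof (rule comp_induct)
  show "x \<in> carrier R" using x by (rule ge_carrier)
  show z: "P \<zero>" using h[OF _ grade_zero] by blast
  show "P (comp x i)" for i
    using x z h[OF _ comp_grade[OF ge_carrier[OF x]], of i] by (cases "M \<le> i") (auto simp: ge_def)
qed (use add in auto)

lemma ge_mult:
  assumes x: "x \<in> ge a" and y: "y \<in> ge b" shows "x \<otimes> y \<in> ge (a + b)"
  using x
proof (induction x rule: ge_induct)
  case (form n h)
  show ?case using y
  proof (induction y rule: ge_induct)
    case (form m k)
    then show ?case using \<open>a \<le> n\<close> \<open>h \<in> G n\<close> form_ge[OF grade_mult, of h n k m "a + b"] by simp
  next
    case (add x y)
    then show ?case using grade_carrier[OF form(2)] ge_add by (simp add: r_distr)
  qed
next
  case (add u v)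
  then show ?case using ge_carrier[OF y] ge_add by (simp add: l_distr)
qed

lemma ge_ideal: "ideal (ge M) R"
proof (rule ideal_if_closed)
  show "ge M \<subseteq> carrier R" by (auto simp: ge_def)
  show "\<zero> \<in> ge M" by (simp add: ge_def)
  show "a \<oplus> b \<in> ge M" if "a \<in> ge M" "b \<in> ge M" for a b
    using that by (rule ge_add)
  show "r \<otimes> a \<in> ge M" if "a \<in> ge M" "r \<in> carrier R" for a r
    using ge_mult[of r 0 a M] that ge_0 by simp
qed

lemma ge_pow: "x \<in> ge a \<Longrightarrow> x [^] (n::nat) \<in> ge (n * a)"
proof (induction n)
  case (Suc n)
  then show ?case using ge_mult[of "x [^] n" "n * a" x a] by (simp add: add.commute)
qed (simp add: ge_0)

lemma form_pow: "h \<in> G n \<Longrightarrow> h [^] (k::nat) \<in> G (k * n)"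
proof (induction k)
  case (Suc k)
  then show ?case using grade_mult[of "h [^] k" "k * n" h n] by (simp add: add.commute)
qed (simp add: grade_one)

lemma ideal_ge_eq: "ideal_ge R G N = ge N"
proof
  have c: "(\<Union>i\<in>{N..}. G i) \<subseteq> carrier R" using grade_carrier by auto
  show "ideal_ge R G N \<subseteq> ge N"
    unfolding ideal_ge_def by (rule genideal_minimal[OF ge_ideal]) (use form_ge in auto)
  show "ge N \<subseteq> ideal_ge R G N"
  proof
    fix x assume "x \<in> ge N"
    then show "x \<in> ideal_ge R G N"
    proof (induction x rule: ge_induct)
      case (form n h)
      then show ?case using genideal_self[OF c] by (auto simp: ideal_ge_def)
    next
      case (add x y)
      then show ?case using ideal_props(4)[OF genideal_ideal[OF c]] by (simp add: ideal_ge_def)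
    qed
  qed
qed

lemma irrelevant_ideal_eq: "irrelevant_ideal R G = ge 1"
proof
  show "irrelevant_ideal R G \<subseteq> ge 1"
  proof
    fix x assume "x \<in> irrelevant_ideal R G"
    then obtain f A where A: "finite A" "\<And>i. i \<in> A \<Longrightarrow> 1 \<le> i \<and> f i \<in> G i" "x = finsum R f A"
      by (auto simp: irrelevant_ideal_def)
    show "x \<in> ge 1" unfolding A(3)
      by (rule finsum_additive_induct)
         (use A form_ge grade_carrier ge_add ideal_props(3)[OF ge_ideal] in blast)+
  qed
  show "ge 1 \<subseteq> irrelevant_ideal R G"
  proof
    fix x assume x: "x \<in> ge 1"
    note xc = ge_carrier[OF x]
    have "x = finsum R (comp x) {i. comp x i \<noteq> \<zero>}" by (rule comp_sum[OF xc])
    moreover have "1 \<le> i" if "comp x i \<noteq> \<zero>" for i using that x by (cases i) (auto simp: ge_def)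
    ultimately show "x \<in> irrelevant_ideal R G"
      unfolding irrelevant_ideal_def using comp_finite[OF xc] comp_grade[OF xc] by blast
  qed
qed

section \<open>Homogeneous ideals through components\<close>

lemma homogeneousI:
  assumes I: "ideal I R" and c: "\<And>x i. x \<in> I \<Longrightarrow> comp x i \<in> I"
  shows "homogeneous_ideal R G I"
  unfolding homogeneous_ideal_def
proof (intro conjI I equalityI)
  have ss: "I \<inter> forms G \<subseteq> carrier R" using ideal_props(1)[OF I] by auto
  show "Idl (I \<inter> forms G) \<subseteq> I" by (rule genideal_minimal[OF I]) auto
  show "I \<subseteq> Idl (I \<inter> forms G)"
  proof
    fix x assume x: "x \<in> I"
    note xc = ideal_props(2)[OF I x]
    note D = ideal_props[OF genideal_ideal[OF ss]]
    show "x \<in> Idl (I \<inter> forms G)"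
    proof (rule comp_induct[where P = "\<lambda>x. x \<in> Idl (I \<inter> forms G)", OF xc D(3)])
      show "comp x i \<in> Idl (I \<inter> forms G)" for i
        using c[OF x, of i] comp_grade[OF xc, of i] genideal_self[OF ss] unfolding forms_def by blast
    qed (use D(4) in auto)
  qed
qed

text \<open>Multiplying by a form only shifts and multiplies components, and every ring element is a
  sum of forms. The ideal obtained reduces a statement on all components of all elements to
  generators.\<close>

lemma homogeneous_core_ideal:
  assumes I: "ideal I R"
  shows "ideal {x \<in> carrier R. \<forall>i. comp x i \<in> I} R"
proof (rule ideal_if_closed)
  note D = ideal_props[OF I]
  fix a r assume a: "a \<in> {x \<in> carrier R. \<forall>i. comp x i \<in> I}" and r: "r \<in> carrier R"
  have ac: "a \<in> carrier R" "\<And>i. comp a i \<in> I" using a by auto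
  have "\<forall>i. comp (r \<otimes> a) i \<in> I" using r
  proof (induction r rule: graded_induct)
    case (form n h)
    then show ?case using ac D(3,6) grade_carrier[OF form] by (simp add: comp_form_mult)
  next
    case (add x y)
    then show ?case using ac D(4) by (simp add: l_distr comp_add)
  qed
  then show "r \<otimes> a \<in> {x \<in> carrier R. \<forall>i. comp x i \<in> I}" using ac r by auto
qed (use ideal_props[OF I] in \<open>auto simp: comp_add\<close>)

lemma comp_Idl_forms:
  assumes "S \<subseteq> forms G" "x \<in> Idl S" shows "comp x i \<in> Idl S"
proof -
  have c: "S \<subseteq> carrier R" using assms(1) grade_carrier by (auto simp: forms_def)
  note D = genideal_ideal[OF c]
  have "Idl S \<subseteq> {x \<in> carrier R. \<forall>i. comp x i \<in> Idl S}"
  proof (rule genideal_minimal[OF homogeneous_core_ideal[OF D]], rule subsetI)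
    fix x assume x: "x \<in> S"
    then obtain n where "x \<in> G n" using assms(1) by (auto simp: forms_def)
    then show "x \<in> {x \<in> carrier R. \<forall>i. comp x i \<in> Idl S}"
      using x c genideal_self[OF c] ideal_props(3)[OF D] by (auto simp: comp_form)
  qed
  then show ?thesis using assms(2) by auto
qed

lemma homogeneous_Idl:
  assumes "S \<subseteq> forms G" shows "homogeneous_ideal R G (Idl S)"
proof (rule homogeneousI)
  show "ideal (Idl S) R" using assms grade_carrier by (intro genideal_ideal) (auto simp: forms_def)
qed (rule comp_Idl_forms[OF assms])

lemma homogeneous_ideal: "homogeneous_ideal R G I \<Longrightarrow> ideal I R"
  by (simp add: homogeneous_ideal_def)

lemma homogeneous_comp:
  assumes "homogeneous_ideal R G I" "x \<in> I" shows "comp x i \<in> I"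
proof -
  have e: "I = Idl (I \<inter> forms G)" using assms(1) by (simp add: homogeneous_ideal_def)
  then have "comp x i \<in> Idl (I \<inter> forms G)" using assms(2) by (intro comp_Idl_forms) auto
  then show ?thesis using e by simp
qed

lemma homogeneous_mem_iff:
  assumes "homogeneous_ideal R G I" "x \<in> carrier R"
  shows "x \<in> I \<longleftrightarrow> (\<forall>i. comp x i \<in> I)"
proof
  note D = ideal_props[OF homogeneous_ideal[OF assms(1)]]
  show "x \<in> I" if "\<forall>i. comp x i \<in> I"
    by (rule comp_induct[where P = "\<lambda>x. x \<in> I", OF assms(2) D(3)]) (use that D(4) in auto)
qed (simp add: homogeneous_comp[OF assms(1)])

lemma homogeneous_trunc:
  assumes "homogeneous_ideal R G I" "x \<in> I" shows "trunc M x \<in> I"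
proof -
  note D = ideal_props[OF homogeneous_ideal[OF assms(1)]]
  have "x \<in> carrier R" by (rule D(2)[OF assms(2)])
  then show ?thesis
    using homogeneous_mem_iff[OF assms(1), of "trunc M x"] homogeneous_comp[OF assms] D(3)
    by (simp add: comp_trunc)
qed

lemma homogeneous_principal:
  assumes "y \<in> G e" shows "homogeneous_ideal R G (PIdl y)"
proof -
  have "{y} \<subseteq> forms G" using assms by (auto simp: forms_def)
  then show ?thesis
    unfolding cgenideal_eq_genideal[OF grade_carrier[OF assms]] by (rule homogeneous_Idl)
qed

lemma homogeneous_add:
  assumes "homogeneous_ideal R G I" "homogeneous_ideal R G J"
  shows "homogeneous_ideal R G (I <+>\<^bsub>R\<^esub> J)"
proof (rule homogeneousI)
  note D = homogeneous_ideal[OF assms(1)] homogeneous_ideal[OF assms(2)]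
  show "ideal (I <+>\<^bsub>R\<^esub> J) R" by (rule add_ideals[OF D])
  fix x i assume "x \<in> I <+>\<^bsub>R\<^esub> J"
  then obtain a b where ab: "a \<in> I" "b \<in> J" "x = a \<oplus> b" by (auto simp: set_add_def')
  then have "comp x i = comp a i \<oplus> comp b i"
    using ideal_props(2)[OF D(1) ab(1)] ideal_props(2)[OF D(2) ab(2)] by (simp add: comp_add)
  then show "comp x i \<in> I <+>\<^bsub>R\<^esub> J"
    using homogeneous_comp[OF assms(1) ab(1)] homogeneous_comp[OF assms(2) ab(2)]
    unfolding set_add_def' by blast
qed

lemma homogeneous_colon:
  assumes J: "homogeneous_ideal R G J" and y: "y \<in> G e"
  shows "homogeneous_ideal R G (colon_elem R J y)"
proof (rule homogeneousI)
  show "ideal (colon_elem R J y) R"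
    using colon_ideal[OF homogeneous_ideal[OF J] grade_carrier[OF y]] .
  fix x i assume "x \<in> colon_elem R J y"
  then have x: "x \<in> carrier R" "x \<otimes> y \<in> J" by (auto simp: colon_elem_def)
  have "comp (x \<otimes> y) (i + e) \<in> J" by (rule homogeneous_comp[OF J x(2)])
  then show "comp x i \<in> colon_elem R J y" using x y by (simp add: comp_mult_form colon_elem_def)
qed

lemma homogeneous_frob_power:
  assumes "cring_char_p R p" and I: "homogeneous_ideal R G I"
  shows "homogeneous_ideal R G (frob_power R I (p ^ f))"
proof -
  interpret cring_char_p R p by fact
  have e: "I = Idl (I \<inter> forms G)" and D: "ideal I R" using I by (simp_all add: homogeneous_ideal_def)
  have "frob_power R I (p ^ f) = Idl {x [^] (p ^ f) | x. x \<in> I \<inter> forms G}"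
    by (subst (1) e, rule frob_power_Idl) (use ideal_props(1)[OF D] in auto)
  moreover have "{x [^] (p ^ f) | x. x \<in> I \<inter> forms G} \<subseteq> forms G"
    using form_pow by (auto simp: forms_def)
  ultimately show ?thesis using homogeneous_Idl by simp
qed

lemma homogeneous_ge: "homogeneous_ideal R G (ge M)"
proof (rule homogeneousI[OF ge_ideal])
  fix x i assume x: "x \<in> ge M"
  show "comp x i \<in> ge M"
  proof (cases "M \<le> i")
    case True
    then show ?thesis by (intro form_ge[OF comp_grade] ge_carrier[OF x])
  next
    case False
    then have "comp x i = \<zero>" using x by (simp add: ge_def)
    then show ?thesis using ideal_props(3)[OF ge_ideal] by simp
  qed
qed

end

section \<open>Homogeneous primes and parameters\<close>

lemma (in noetherian_ring) ideal_induct [consumes 1, case_names step]: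
  assumes "ideal A R"
    and step: "\<And>A. ideal A R \<Longrightarrow> (\<And>B. ideal B R \<Longrightarrow> A \<subset> B \<Longrightarrow> P B) \<Longrightarrow> P A"
  shows "P A"
proof (rule ccontr)
  assume nP: "\<not> P A"
  let ?S = "{I. ideal I R \<and> \<not> P I}"
  have "\<exists>M\<in>?S. \<forall>X\<in>?S. M \<subseteq> X \<longrightarrow> X = M"
  proof (rule subset_Zorn_nonempty)
    show "?S \<noteq> {}" using assms(1) nP by auto
    fix C assume C: "C \<noteq> {}" "subset.chain ?S C"
    then have "subset.chain {I. ideal I R} C" by (auto simp: pred_on.chain_def)
    then have "\<Union>C \<in> C" by (rule ideal_chain_is_trivial[OF C(1)])
    then show "\<Union>C \<in> ?S" using C(2) by (auto simp: pred_on.chain_def)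
  qed
  then obtain M where M: "ideal M R" "\<not> P M" "\<And>X. ideal X R \<Longrightarrow> \<not> P X \<Longrightarrow> M \<subseteq> X \<Longrightarrow> X = M"
    by auto
  then show False using step[OF M(1)] by (metis psubset_eq)
qed

lemma (in cring) prime_pow:
  assumes "primeideal P R" "x \<in> carrier R" "x [^] (n::nat) \<in> P" shows "x \<in> P"
  using assms(3)
proof (induction n)
  case 0
  then show ?case
    using ideal.one_imp_carrier[OF primeideal.axioms(1)[OF assms(1)]] primeideal.I_notcarr[OF assms(1)] by auto
next
  case (Suc n)
  then show ?case using primeideal.I_prime[OF assms(1), of "x [^] n" x] assms(2) by auto
qed

lemma (in cring) add_principal:
  assumes "ideal A R" "a \<in> carrier R"
  shows "ideal (A <+>\<^bsub>R\<^esub> (PIdl a)) R" "A \<subseteq> A <+>\<^bsub>R\<^esub> (PIdl a)" "a \<in> A <+>\<^bsub>R\<^esub> (PIdl a)"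
    "\<And>x. x \<in> A <+>\<^bsub>R\<^esub> (PIdl a) \<longleftrightarrow> (\<exists>w\<in>A. \<exists>r\<in>carrier R. x = w \<oplus> r \<otimes> a)"
proof -
  note D = ideal_props[OF assms(1)]
  show mem: "\<And>x. x \<in> A <+>\<^bsub>R\<^esub> (PIdl a) \<longleftrightarrow> (\<exists>w\<in>A. \<exists>r\<in>carrier R. x = w \<oplus> r \<otimes> a)"
    unfolding set_add_def' cgenideal_def by blast
  show "ideal (A <+>\<^bsub>R\<^esub> (PIdl a)) R" by (intro add_ideals cgenideal_ideal assms)
  show "A \<subseteq> A <+>\<^bsub>R\<^esub> (PIdl a)"
  proof
    fix w assume w: "w \<in> A"
    then have "w = w \<oplus> \<zero> \<otimes> a" using D(2) assms(2) by simp
    then show "w \<in> A <+>\<^bsub>R\<^esub> (PIdl a)" unfolding mem using w by blast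
  qed
  have "a = \<zero> \<oplus> \<one> \<otimes> a" using assms(2) by simp
  then show "a \<in> A <+>\<^bsub>R\<^esub> (PIdl a)" unfolding mem using D(3) by blast
qed

lemma (in cring) add_principal_mult:
  assumes A: "ideal A R" and ab: "a \<in> carrier R" "b \<in> carrier R" "a \<otimes> b \<in> A"
    and "x \<in> A <+>\<^bsub>R\<^esub> (PIdl a)" "y \<in> A <+>\<^bsub>R\<^esub> (PIdl b)"
  shows "x \<otimes> y \<in> A"
proof -
  note D = ideal_props[OF A]
  obtain w r v s where *: "w \<in> A" "r \<in> carrier R" "x = w \<oplus> r \<otimes> a" "v \<in> A" "s \<in> carrier R" "y = v \<oplus> s \<otimes> b"
    using assms(5,6) add_principal(4)[OF A ab(1)] add_principal(4)[OF A ab(2)] by blast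
  have c: "w \<in> carrier R" "v \<in> carrier R" using * D(2) by auto
  have "x \<otimes> y = w \<otimes> (v \<oplus> s \<otimes> b) \<oplus> ((r \<otimes> a) \<otimes> v \<oplus> (r \<otimes> s) \<otimes> (a \<otimes> b))"
    unfolding *(3,6) using c * ab by algebra
  then show ?thesis using * c ab D(4,6,7) by auto
qed

context graded_cring
begin

text \<open>For a and b outside P, subtract the low components that lie in P. The lowest components
  left, \<open>\<alpha>\<close> and \<open>\<beta>\<close>, are forms outside P, and their product
  is the lowest component of an element of P.\<close>

lemma homogeneous_primeI:
  assumes P: "homogeneous_ideal R G P" "carrier R \<noteq> P"
    and forms: "\<And>i j a b. a \<in> G i \<Longrightarrow> b \<in> G j \<Longrightarrow> a \<otimes> b \<in> P \<Longrightarrow> a \<in> P \<or> b \<in> P"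
  shows "primeideal P R"
proof (rule primeidealI[OF homogeneous_ideal[OF P(1)] cring_axioms P(2)])
  note D = ideal_props[OF homogeneous_ideal[OF P(1)]]
  fix a b assume ab: "a \<in> carrier R" "b \<in> carrier R" "a \<otimes> b \<in> P"
  show "a \<in> P \<or> b \<in> P"
  proof (rule ccontr)
    assume neg: "\<not> (a \<in> P \<or> b \<in> P)"
    have low: "\<exists>i. comp x i \<notin> P \<and> x \<ominus> trunc i x \<in> P \<and> (\<exists>z\<in>ge (Suc i). trunc i x = comp x i \<oplus> z)"
      if x: "x \<in> carrier R" "x \<notin> P" for x
    proof -
      have ex: "\<exists>i. comp x i \<notin> P" using x homogeneous_mem_iff[OF P(1) x(1)] by auto
      define i where "i = (LEAST i. comp x i \<notin> P)"
      have i: "comp x i \<notin> P" "\<And>k. k < i \<Longrightarrow> comp x k \<in> P"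
        using LeastI_ex[OF ex] not_less_Least unfolding i_def by blast+
      have "comp (x \<ominus> trunc i x) k \<in> P" for k
        unfolding comp_diff[OF x(1) trunc_carrier[OF x(1)]] comp_trunc[OF x(1)]
        using i(2)[of k] x D(3) by (auto simp: a_minus_def r_neg)
      then have "x \<ominus> trunc i x \<in> P" using homogeneous_mem_iff[OF P(1), of "x \<ominus> trunc i x"] x by auto
      moreover have "trunc i x = comp x i \<oplus> trunc (Suc i) x"
      proof (rule comp_ext)
        fix k
        show "comp (trunc i x) k = comp (comp x i \<oplus> trunc (Suc i) x) k"
          using x comp_form[OF comp_grade[OF x(1)], of i k]
          by (cases k i rule: linorder_cases) (simp_all add: comp_trunc comp_add)
      qed (use x in auto)
      ultimately show ?thesis using i(1) trunc_ge[OF x(1), of "Suc i"] by blast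
    qed
    obtain i a' where i: "comp a i \<notin> P" "a \<ominus> trunc i a \<in> P" "a' \<in> ge (Suc i)" "trunc i a = comp a i \<oplus> a'"
      using low[OF ab(1)] neg by auto
    obtain j b' where j: "comp b j \<notin> P" "b \<ominus> trunc j b \<in> P" "b' \<in> ge (Suc j)" "trunc j b = comp b j \<oplus> b'"
      using low[OF ab(2)] neg by auto
    define \<alpha> \<beta> where "\<alpha> = comp a i" and "\<beta> = comp b j"
    have \<alpha>\<beta>: "\<alpha> \<in> G i" "\<beta> \<in> G j" using comp_grade ab by (auto simp: \<alpha>_def \<beta>_def)
    have c: "\<alpha> \<in> carrier R" "\<beta> \<in> carrier R" "a' \<in> carrier R" "b' \<in> carrier R"
      using ab i j ge_carrier by (auto simp: \<alpha>_def \<beta>_def)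
    have "trunc i a \<otimes> trunc j b = a \<otimes> b \<ominus> ((a \<ominus> trunc i a) \<otimes> b \<oplus> trunc i a \<otimes> (b \<ominus> trunc j b))"
    proof -
      have "trunc i a \<in> carrier R" "trunc j b \<in> carrier R" using ab by auto
      then show ?thesis using ab(1,2) by algebra
    qed
    also have "\<dots> \<in> P" using ab i(2) j(2) D(4-7) by auto
    finally have "trunc i a \<otimes> trunc j b \<in> P" .
    moreover have "trunc i a \<otimes> trunc j b = \<alpha> \<otimes> \<beta> \<oplus> (\<alpha> \<otimes> b' \<oplus> (a' \<otimes> \<beta> \<oplus> a' \<otimes> b'))"
      unfolding i(4) j(4) \<alpha>_def[symmetric] \<beta>_def[symmetric] using c by algebra
    moreover have "\<alpha> \<otimes> b' \<oplus> (a' \<otimes> \<beta> \<oplus> a' \<otimes> b') \<in> ge (Suc (i + j))"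
    proof -
      have "\<alpha> \<in> ge i" "\<beta> \<in> ge j" using \<alpha>\<beta> form_ge by auto
      then have "\<alpha> \<otimes> b' \<in> ge (Suc (i + j))" "a' \<otimes> \<beta> \<in> ge (Suc (i + j))"
        using ge_mult[of \<alpha> i b' "Suc j"] ge_mult[of a' "Suc i" \<beta> j] i(3) j(3) by auto
      moreover have "a' \<otimes> b' \<in> ge (Suc (i + j))"
        using ge_mult[OF i(3) j(3)] ge_mono[of "Suc (i + j)" "Suc i + Suc j"] by auto
      ultimately show ?thesis by (intro ge_add)
    qed
    ultimately have "comp (\<alpha> \<otimes> \<beta> \<oplus> (\<alpha> \<otimes> b' \<oplus> (a' \<otimes> \<beta> \<oplus> a' \<otimes> b'))) (i + j) \<in> P"
      and z: "comp (\<alpha> \<otimes> b' \<oplus> (a' \<otimes> \<beta> \<oplus> a' \<otimes> b')) (i + j) = \<zero>"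
      using homogeneous_comp[OF P(1)] by (auto simp: ge_def)
    then have "\<alpha> \<otimes> \<beta> \<in> P"
      using c comp_form[OF grade_mult[OF \<alpha>\<beta>]] by (simp add: comp_add)
    then show False using forms[OF \<alpha>\<beta>] i(1) j(1) by (auto simp: \<alpha>_def \<beta>_def)
  qed
qed

end

locale noetherian_graded = graded_cring R G + noetherian_ring R for R (structure) and G +
  assumes field_0: "subfield (G 0) R"
begin

definition hprime :: "'a set \<Rightarrow> bool" where
  "hprime P \<longleftrightarrow> homogeneous_ideal R G P \<and> primeideal P R"

lemma hprimeD: "hprime P \<Longrightarrow> homogeneous_ideal R G P" "hprime P \<Longrightarrow> primeideal P R" "hprime P \<Longrightarrow> ideal P R"
  by (auto simp: hprime_def homogeneous_ideal_def)

text \<open>A stand-in for the set of minimal primes over \<open>A\<close>. Minimality of the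
  members is left out so that covers can be united; the last clause says that the intersection lies
  in the radical, and it comes out of the same induction as the finiteness.\<close>

definition hcover :: "'a set \<Rightarrow> 'a set set \<Rightarrow> bool" where
  "hcover A S \<longleftrightarrow> finite S \<and> (\<forall>P\<in>S. hprime P \<and> A \<subseteq> P) \<and>
    (\<forall>Q. primeideal Q R \<and> A \<subseteq> Q \<longrightarrow> (\<exists>P\<in>S. P \<subseteq> Q)) \<and>
    (\<forall>x\<in>carrier R. (\<forall>P\<in>S. x \<in> P) \<longrightarrow> (\<exists>n::nat. x [^] n \<in> A))"

lemma hcoverD:
  assumes "hcover A S"
  shows "finite S" "\<And>P. P \<in> S \<Longrightarrow> hprime P" "\<And>P. P \<in> S \<Longrightarrow> A \<subseteq> P"
    "\<And>Q. primeideal Q R \<Longrightarrow> A \<subseteq> Q \<Longrightarrow> \<exists>P\<in>S. P \<subseteq> Q"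
    "\<And>x. x \<in> carrier R \<Longrightarrow> (\<And>P. P \<in> S \<Longrightarrow> x \<in> P) \<Longrightarrow> \<exists>n::nat. x [^] n \<in> A"
  using assms unfolding hcover_def by simp_all

text \<open>Noetherian induction. If A is proper and not prime, there are forms a, b outside A with
  a b in A. A prime over A contains A + Ra or A + Rb, and a power of x in the one times a power in
  the other lies in A; so the two covers unite to a cover of A.\<close>

lemma hcover_exists:
  assumes "homogeneous_ideal R G A"
  shows "\<exists>S. hcover A S"
proof -
  have "ideal A R" by (rule homogeneous_ideal[OF assms])
  then show ?thesis using assms
  proof (induction A rule: ideal_induct)
    case (step A)
    note hA = step.prems
    note D = ideal_props[OF step.hyps]
    consider "A = carrier R" | "primeideal A R"
      | i j a b where "a \<in> G i" "b \<in> G j" "a \<otimes> b \<in> A" "a \<notin> A" "b \<notin> A"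
      using homogeneous_primeI[OF hA] by blast
    then show ?case
    proof cases
      case 1
      have "\<exists>n::nat. x [^] n \<in> A" if "x \<in> carrier R" for x using that 1 by auto
      moreover have "\<not> A \<subseteq> Q" if "primeideal Q R" for Q
        using primeideal.I_notcarr[OF that] ideal_props(1)[OF primeideal.axioms(1)[OF that]] 1 by auto
      ultimately show ?thesis by (intro exI[of _ "{}"]) (auto simp: hcover_def)
    next
      case 2
      have "\<exists>n::nat. x [^] n \<in> A" if "x \<in> A" for x
        using that D(2) by (intro exI[of _ 1]) simp
      then show ?thesis using 2 hA by (intro exI[of _ "{A}"]) (auto simp: hprime_def hcover_def)
    next
      case 3
      have ac: "a \<in> carrier R" "b \<in> carrier R" using 3 grade_carrier by auto
      let ?A = "A <+>\<^bsub>R\<^esub> (PIdl a)" and ?B = "A <+>\<^bsub>R\<^esub> (PIdl b)"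
      note Aa = add_principal[OF step.hyps ac(1)] and Ab = add_principal[OF step.hyps ac(2)]
      have ps: "A \<subset> ?A" "A \<subset> ?B" using Aa(2,3) Ab(2,3) 3(4,5) by auto
      obtain S where S: "hcover ?A S"
        using step.IH[OF Aa(1) ps(1) homogeneous_add[OF hA homogeneous_principal[OF 3(1)]]] by auto
      obtain T where T: "hcover ?B T"
        using step.IH[OF Ab(1) ps(2) homogeneous_add[OF hA homogeneous_principal[OF 3(2)]]] by auto
      note S = hcoverD[OF S] and T = hcoverD[OF T]
      have 1: "\<exists>P\<in>S \<union> T. P \<subseteq> Q" if Q: "primeideal Q R" "A \<subseteq> Q" for Q
      proof -
        note E = ideal_props[OF primeideal.axioms(1)[OF Q(1)]]
        have sub: "A <+>\<^bsub>R\<^esub> (PIdl c) \<subseteq> Q" if c: "c \<in> Q" for c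
        proof
          fix x assume "x \<in> A <+>\<^bsub>R\<^esub> (PIdl c)"
          then obtain w r where "w \<in> A" "r \<in> carrier R" "x = w \<oplus> r \<otimes> c"
            using add_principal(4)[OF step.hyps E(2)[OF c]] by auto
          then show "x \<in> Q" using E(4)[of w "r \<otimes> c"] E(6)[OF c] Q(2) by auto
        qed
        have "a \<in> Q \<or> b \<in> Q" using primeideal.I_prime[OF Q(1) ac] 3(3) Q(2) by auto
        then show ?thesis using S(4)[OF Q(1)] T(4)[OF Q(1)] sub by blast
      qed
      have 2: "\<exists>n::nat. x [^] n \<in> A" if x: "x \<in> carrier R" "\<forall>P\<in>S \<union> T. x \<in> P" for x
      proof -
        obtain n m :: nat where "x [^] n \<in> ?A" "x [^] m \<in> ?B" using S(5)[OF x(1)] T(5)[OF x(1)] x(2) by auto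
        then have "x [^] n \<otimes> x [^] m \<in> A" by (rule add_principal_mult[OF step.hyps ac 3(3)])
        then show ?thesis using x(1) by (auto simp: nat_pow_mult)
      qed
      have "hprime P \<and> A \<subseteq> P" if "P \<in> S \<union> T" for P
        using that S(2,3)[of P] T(2,3)[of P] Aa(2) Ab(2) by auto
      then have "hcover A (S \<union> T)" unfolding hcover_def using S(1) T(1) 1 2 by simp
      then show ?thesis by blast
    qed
  qed
qed

text \<open>A nonzero component of degree 0 would be a unit, because \<open>G 0\<close> is a
  field.\<close>

lemma hproper_le_ge_1:
  assumes I: "homogeneous_ideal R G I" "I \<noteq> carrier R" shows "I \<subseteq> ge 1"
proof
  fix x assume x: "x \<in> I"
  note D = ideal_props[OF homogeneous_ideal[OF I(1)]]
  note xc = D(2)[OF x]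
  have "comp x 0 = \<zero>"
  proof (rule ccontr)
    assume n: "comp x 0 \<noteq> \<zero>"
    have c: "comp x 0 \<in> I" "comp x 0 \<in> G 0" using homogeneous_comp[OF I(1) x] comp_grade[OF xc] by auto
    then have "inv (comp x 0) \<in> G 0" "inv (comp x 0) \<otimes> comp x 0 = \<one>"
      using subfield_m_inv[OF field_0, of "comp x 0"] n by auto
    then have "\<one> \<in> I" using D(6)[OF c(1)] grade_carrier by metis
    then show False using ideal.one_imp_carrier[OF homogeneous_ideal[OF I(1)]] I(2) by auto
  qed
  then show "x \<in> ge 1" using xc by (simp add: ge_def)
qed

lemma one_not_ge_1: "\<one> \<notin> ge 1"
  using comp_form[OF grade_one, of 0] subfieldE(6)[OF field_0] by (simp add: ge_def)

lemma ge_1_hprime: "hprime (ge 1)"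
  unfolding hprime_def
proof (intro conjI homogeneous_ge homogeneous_primeI)
  show "carrier R \<noteq> ge 1" using one_not_ge_1 by auto
  fix i j a b assume a: "a \<in> G i" and b: "b \<in> G j" and ab: "a \<otimes> b \<in> ge 1"
  show "a \<in> ge 1 \<or> b \<in> ge 1"
  proof (cases "i = 0 \<and> j = 0")
    case True
    then have "a \<otimes> b = \<zero>" using ab comp_form[OF grade_mult[OF a b], of 0] by (simp add: ge_def)
    then have "a = \<zero> \<or> b = \<zero>" using subfieldE(5)[OF field_0] a b True by auto
    then show ?thesis using ideal_props(3)[OF ge_ideal] by auto
  next
    case False
    then show ?thesis using form_ge[OF a, of 1] form_ge[OF b, of 1] by (cases i; cases j) auto
  qed
qed

lemma form_not_in:
  assumes "homogeneous_ideal R G I" "homogeneous_ideal R G P" "\<not> I \<subseteq> P"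
  shows "\<exists>n a. a \<in> G n \<and> a \<in> I \<and> a \<notin> P"
proof -
  obtain x where x: "x \<in> I" "x \<notin> P" using assms(3) by auto
  have xc: "x \<in> carrier R" using ideal_props(2)[OF homogeneous_ideal[OF assms(1)] x(1)] .
  then obtain i where "comp x i \<notin> P" using homogeneous_mem_iff[OF assms(2) xc] x(2) by auto
  then show ?thesis using homogeneous_comp[OF assms(1) x(1)] comp_grade[OF xc] by blast
qed

text \<open>The usual sum of two elements must be a form, so each summand is raised to the degree of
  the other. Both degrees are kept positive, since a zeroth power would be 1 and lie in no
  prime.\<close>

lemma hprime_avoidance:
  assumes "finite S" "\<And>P. P \<in> S \<Longrightarrow> hprime P" "\<And>P. P \<in> S \<Longrightarrow> \<not> ge 1 \<subseteq> P"
  shows "\<exists>n z. 1 \<le> n \<and> z \<in> G n \<and> (\<forall>P\<in>S. z \<notin> P)"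
  using assms
proof (induction S rule: finite_psubset_induct)
  case (psubset S)
  show ?case
  proof (cases "\<exists>P\<in>S. \<exists>P'\<in>S. P \<subset> P'")
    case True
    then obtain P P' where P: "P \<in> S" "P' \<in> S" "P \<subset> P'" by auto
    have "\<exists>n z. 1 \<le> n \<and> z \<in> G n \<and> (\<forall>P\<in>S - {P}. z \<notin> P)"
      by (rule psubset.IH) (use psubset.prems P(1) in auto)
    then obtain n z where "1 \<le> n" "z \<in> G n" "\<forall>Q\<in>S - {P}. z \<notin> Q" by auto
    moreover from this have "z \<notin> P" using P by auto
    ultimately show ?thesis by blast
  next
    case anti: False
    show ?thesis
    proof (cases "S = {}")
      case True
      then show ?thesis using grade_zero[of 1] by auto
    next
      case False
      then obtain P where P: "P \<in> S" by auto
      have "\<exists>n z. 1 \<le> n \<and> z \<in> G n \<and> (\<forall>Q\<in>S - {P}. z \<notin> Q)"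
        by (rule psubset.IH) (use psubset.prems P in auto)
      then obtain n z where z: "1 \<le> n" "z \<in> G n" "\<And>Q. Q \<in> S \<Longrightarrow> Q \<noteq> P \<Longrightarrow> z \<notin> Q" by auto
      show ?thesis
      proof (cases "z \<in> P")
        case False
        then show ?thesis using z by blast
      next
        case True
        note hP = hprimeD[OF psubset.prems(1)[OF P]]
        \<comment> \<open>The form lies in every other member but not in P: start from a form of
          positive degree outside P and multiply by one form of each Q, chosen outside P.\<close>
        have "\<exists>m w. 1 \<le> m \<and> w \<in> G m \<and> w \<notin> P \<and> (\<forall>Q\<in>T. w \<in> Q)" if "finite T" "T \<subseteq> S - {P}" for T
          using that
        proof (induction T)
          case empty
          obtain m w where w: "w \<in> G m" "w \<in> ge 1" "w \<notin> P"
            using form_not_in[OF homogeneous_ge hP(1)] psubset.prems(2)[OF P] by blast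
          have "w \<noteq> \<zero>" using w(3) ideal_props(3)[OF hP(3)] by auto
          then have "1 \<le> m" using w(1,2) comp_form[OF w(1), of 0] by (cases m) (auto simp: ge_def)
          then show ?case using w by blast
        next
          case (insert Q T)
          then obtain m w where w: "1 \<le> m" "w \<in> G m" "w \<notin> P" "\<forall>Q\<in>T. w \<in> Q" by auto
          have Q: "Q \<in> S" "Q \<noteq> P" using insert by auto
          note hQ = hprimeD[OF psubset.prems(1)[OF Q(1)]]
          have "\<not> Q \<subseteq> P" using anti P Q by auto
          then obtain k a where a: "a \<in> G k" "a \<in> Q" "a \<notin> P" using form_not_in[OF hQ(1) hP(1)] by blast
          have c: "a \<in> carrier R" "w \<in> carrier R" using a w grade_carrier by auto
          have "w \<otimes> a \<notin> P" using primeideal.I_prime[OF hP(2) c(2,1)] w(3) a(3) by auto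
          moreover have "w \<otimes> a \<in> Q'" if "Q' \<in> insert Q T" for Q'
          proof (cases "Q' = Q")
            case True
            then show ?thesis using ideal_props(6)[OF hQ(3) a(2) c(2)] by simp
          next
            case False
            then have "Q' \<in> T" "Q' \<in> S" using that insert.prems by auto
            then show ?thesis using ideal_props(7)[OF hprimeD(3)[OF psubset.prems(1)], of Q' w a] w(4) c by auto
          qed
          moreover have "w \<otimes> a \<in> G (m + k)" by (rule grade_mult[OF w(2) a(1)])
          ultimately show ?case using w(1) by (intro exI[of _ "m + k"] exI[of _ "w \<otimes> a"]) auto
        qed
        then obtain m w where w: "1 \<le> m" "w \<in> G m" "w \<notin> P" "\<And>Q. Q \<in> S \<Longrightarrow> Q \<noteq> P \<Longrightarrow> w \<in> Q"
          using psubset.hyps by (metis Diff_iff finite_Diff singletonD subset_refl)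
        let ?y = "z [^] m \<oplus> w [^] n"
        have c: "z \<in> carrier R" "w \<in> carrier R" "z [^] m \<in> carrier R" "w [^] n \<in> carrier R"
          using z w grade_carrier by auto
        have "?y \<in> G (m * n)"
          using form_pow[OF z(2), of m] form_pow[OF w(2), of n] by (intro grade_add) (auto simp: mult.commute)
        moreover have "?y \<notin> Q" if Q: "Q \<in> S" for Q
        proof
          assume y: "?y \<in> Q"
          note hQ = hprimeD[OF psubset.prems(1)[OF Q]]
          note E = ideal_props[OF hQ(3)]
          show False
          proof (cases "Q = P")
            case True
            have "z [^] m \<in> P" by (rule ideal_pow_closed[OF hP(3)]) (use \<open>z \<in> P\<close> w(1) in auto)
            then have "?y \<ominus> z [^] m \<in> P" using y True by (intro ideal_props(5)[OF hP(3)]) auto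
            moreover have "?y \<ominus> z [^] m = w [^] n" using c(3,4) by algebra
            ultimately have "w \<in> P" using prime_pow[OF hP(2) c(2)] by simp
            then show False using w(3) by simp
          next
            case False
            have "w [^] n \<in> Q" by (rule ideal_pow_closed[OF hQ(3)]) (use w(4)[OF Q False] z(1) in auto)
            then have "?y \<ominus> w [^] n \<in> Q" using y by (intro E(5))
            moreover have "?y \<ominus> w [^] n = z [^] m" using c(3,4) by algebra
            ultimately have "z \<in> Q" using prime_pow[OF hQ(2) c(1)] by simp
            then show False using z(3)[OF Q False] by simp
          qed
        qed
        ultimately show ?thesis using w(1) z(1)
          by (intro exI[of _ "m * n"] exI[of _ ?y]) (auto simp: Suc_le_eq)
      qed
    qed
  qed
qed

text \<open>Let z avoid every member of a cover of A other than the irrelevant ideal. A homogeneous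
  prime Q over A + Rz, different from the irrelevant ideal, would contain such a member P, strictly
  since z is in Q, against \<open>dim\<close>. So a cover of A + Rz has no other member than the
  irrelevant ideal.\<close>

lemma parameter_exists:
  assumes A: "homogeneous_ideal R G A"
    and dim: "\<And>P Q. hprime P \<Longrightarrow> hprime Q \<Longrightarrow> A \<subseteq> P \<Longrightarrow> P \<subset> Q \<Longrightarrow> Q \<subset> ge 1 \<Longrightarrow> False"
  shows "\<exists>n z. 1 \<le> n \<and> z \<in> G n \<and> (\<forall>g\<in>ge 1. \<exists>k::nat. g [^] k \<in> A <+>\<^bsub>R\<^esub> (PIdl z))"
proof -
  obtain S where "hcover A S" using hcover_exists[OF A] by auto
  note S = hcoverD[OF this]
  have le: "P \<subseteq> ge 1" if "hprime P" for P
    using hproper_le_ge_1[of P] hprimeD[OF that] primeideal.I_notcarr by blast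
  have "\<exists>n z. 1 \<le> n \<and> z \<in> G n \<and> (\<forall>P\<in>S - {ge 1}. z \<notin> P)"
  proof (rule hprime_avoidance)
    show "\<not> ge 1 \<subseteq> P" if "P \<in> S - {ge 1}" for P
      using that S(2) le[of P] by blast
  qed (use S(1,2) in auto)
  then obtain n z where z: "1 \<le> n" "z \<in> G n" "\<And>P. P \<in> S \<Longrightarrow> P \<noteq> ge 1 \<Longrightarrow> z \<notin> P" by auto
  note AZ = add_principal[OF homogeneous_ideal[OF A] grade_carrier[OF z(2)]]
  have hAZ: "homogeneous_ideal R G (A <+>\<^bsub>R\<^esub> (PIdl z))"
    by (rule homogeneous_add[OF A homogeneous_principal[OF z(2)]])
  obtain T where "hcover (A <+>\<^bsub>R\<^esub> (PIdl z)) T" using hcover_exists[OF hAZ] by auto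
  note T = hcoverD[OF this]
  have T1: "Q = ge 1" if "Q \<in> T" for Q
  proof (rule ccontr)
    assume n: "Q \<noteq> ge 1"
    have Q: "hprime Q" "A \<subseteq> Q" "z \<in> Q" using T(2,3)[OF that] AZ(2,3) by auto
    obtain P where P: "P \<in> S" "P \<subseteq> Q" using S(4)[OF hprimeD(2)[OF Q(1)] Q(2)] by auto
    have "P \<noteq> ge 1" using P(2) le[OF Q(1)] n by auto
    then have "z \<notin> P" using z(3) P(1) by auto
    then have "P \<subset> Q" using P(2) Q(3) by auto
    then show False using dim[of P Q] S(2,3)[OF P(1)] Q(1) le[OF Q(1)] n by auto
  qed
  have "\<exists>k::nat. g [^] k \<in> A <+>\<^bsub>R\<^esub> (PIdl z)" if "g \<in> ge 1" for g
    using T(5)[OF ge_carrier[OF that]] T1 that by auto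
  then show ?thesis using z(1,2) by blast
qed

text \<open>A chain of length at least d - 1 ending in P, prolonged by Q and M, would be longer than
  the dimension.\<close>

lemma height_no_chain:
  assumes d: "krull_dim R = enat d" and ht: "enat d \<le> ideal_height R A + 1"
    and P: "primeideal P R" "A \<subseteq> P" "P \<subset> Q" "primeideal Q R" "Q \<subset> M" "primeideal M R"
  shows False
proof -
  have "ideal_height R A \<le> prime_height R P"
    unfolding ideal_height_def by (rule INF_lower) (use P in auto)
  then have hp: "enat d \<le> prime_height R P + 1"
    using ht by (meson add_right_mono order_trans)
  \<comment> \<open>For d at most 1 the prime P alone is a long enough chain. Otherwise the height
    of P, possibly infinite, exceeds d - 2, and the supremum yields a chain longer than d -
    2.\<close>
  have "\<exists>n C. prime_chain R C n \<and> C n = P \<and> d \<le> n + 1"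
  proof (cases "d \<le> 1")
    case True
    then show ?thesis using P(1) by (intro exI[of _ 0] exI[of _ "\<lambda>_. P"]) (auto simp: prime_chain_def)
  next
    case False
    then obtain k where k: "d = Suc (Suc k)" by (metis One_nat_def le_SucE not0_implies_Suc nle_le not_less_eq_eq)
    have "enat k < prime_height R P"
    proof (rule ccontr)
      assume "\<not> enat k < prime_height R P"
      then have "prime_height R P + 1 \<le> enat k + 1" by (intro add_right_mono) simp
      with hp have "enat d \<le> enat k + 1" by (rule order_trans)
      then show False using k by (simp add: one_enat_def)
    qed
    then obtain n C where "enat k < enat n" "prime_chain R C n" "C n = P"
      unfolding prime_height_def less_Sup_iff by auto
    then show ?thesis using k by (intro exI[of _ n] exI[of _ C]) auto
  qed
  then obtain n C where C: "prime_chain R C n" "C n = P" "d \<le> n + 1" by auto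
  let ?D = "C(n + 1 := Q, n + 2 := M)"
  have "prime_chain R ?D (n + 2)"
    unfolding prime_chain_def
  proof (intro conjI allI impI)
    fix i assume "i \<le> n + 2"
    then consider "i \<le> n" | "i = n + 1" | "i = n + 2" by linarith
    then show "primeideal (?D i) R"
      by cases (use C(1) P in \<open>auto simp: prime_chain_def\<close>)
  next
    fix i assume "i < n + 2"
    then consider "i < n" | "i = n" | "i = n + 1" by linarith
    then show "?D i \<subset> ?D (Suc i)"
      by cases (use C P in \<open>auto simp: prime_chain_def\<close>)
  qed
  then have "enat (n + 2) \<le> krull_dim R"
    unfolding krull_dim_def by (intro Sup_upper) auto
  then show False using d C(3) by simp
qed

end

section \<open>Form generators of the irrelevant ideal and the degree bounds they give\<close>

context noetherian_graded
begin

text \<open>A generator carries a degree with it, as the zero form has none of its own. The common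
  bound \<open>C\<close> on the degrees enters all later constants.\<close>

definition irrelevant_gens :: "('a \<times> nat) set \<Rightarrow> nat \<Rightarrow> bool" where
  "irrelevant_gens \<Gamma> C \<longleftrightarrow> finite \<Gamma> \<and> (\<forall>(g, k)\<in>\<Gamma>. 1 \<le> k \<and> k \<le> C \<and> g \<in> G k) \<and> ge 1 = Idl (fst ` \<Gamma>)"

lemma irrelevant_gensD:
  assumes "irrelevant_gens \<Gamma> C"
  shows "finite \<Gamma>" "\<And>g k. (g, k) \<in> \<Gamma> \<Longrightarrow> 1 \<le> k" "\<And>g k. (g, k) \<in> \<Gamma> \<Longrightarrow> k \<le> C"
    "\<And>g k. (g, k) \<in> \<Gamma> \<Longrightarrow> g \<in> G k" "\<And>g k. (g, k) \<in> \<Gamma> \<Longrightarrow> g \<in> carrier R"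
    "\<And>g k. (g, k) \<in> \<Gamma> \<Longrightarrow> g \<in> ge 1" "ge 1 = Idl (fst ` \<Gamma>)"
  using assms grade_carrier form_ge unfolding irrelevant_gens_def by blast+

lemma irrelevant_gens_exist: "\<exists>\<Gamma> C. irrelevant_gens \<Gamma> C"
proof -
  obtain F where F: "F \<subseteq> carrier R" "finite F" "ge 1 = Idl F"
    using finetely_gen[OF ge_ideal] by blast
  define \<Gamma> where "\<Gamma> = (\<lambda>(f, i). (comp f i, i)) ` (SIGMA f:F. {i. comp f i \<noteq> \<zero>})"
  have fin: "finite \<Gamma>" unfolding \<Gamma>_def using F comp_finite by (intro finite_imageI finite_SigmaI) auto
  have Fge: "f \<in> ge 1" if "f \<in> F" for f using genideal_self[OF F(1)] F(3) that by auto
  have \<Gamma>: "1 \<le> k" "g \<in> G k" "g \<in> ge 1" if gk: "(g, k) \<in> \<Gamma>" for g k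
  proof -
    obtain f where f: "f \<in> F" "g = comp f k" "comp f k \<noteq> \<zero>" using gk by (auto simp: \<Gamma>_def)
    show "1 \<le> k" using f Fge[OF f(1)] by (cases k) (auto simp: ge_def)
    show "g \<in> G k" using f F(1) comp_grade by auto
    show "g \<in> ge 1" using f homogeneous_comp[OF homogeneous_ge Fge[OF f(1)]] by auto
  qed
  have forms: "fst ` \<Gamma> \<subseteq> forms G" using \<Gamma>(2) unfolding forms_def by fastforce
  then have c: "fst ` \<Gamma> \<subseteq> carrier R" using grade_carrier by (auto simp: forms_def)
  note h = homogeneous_Idl[OF forms]
  have "ge 1 = Idl (fst ` \<Gamma>)"
  proof
    show "Idl (fst ` \<Gamma>) \<subseteq> ge 1" by (rule genideal_minimal[OF ge_ideal]) (use \<Gamma>(3) in auto)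
    have "f \<in> Idl (fst ` \<Gamma>)" if f: "f \<in> F" for f
    proof -
      have "comp f i \<in> Idl (fst ` \<Gamma>)" for i
      proof (cases "comp f i = \<zero>")
        case True
        then show ?thesis using ideal_props(3)[OF homogeneous_ideal[OF h]] by simp
      next
        case False
        then have "(comp f i, i) \<in> \<Gamma>" using f by (auto simp: \<Gamma>_def)
        then have "comp f i \<in> fst ` \<Gamma>" by force
        then show ?thesis using genideal_self[OF c] by auto
      qed
      then show ?thesis using homogeneous_mem_iff[OF h, of f] f F(1) by auto
    qed
    then show "ge 1 \<subseteq> Idl (fst ` \<Gamma>)"
      unfolding F(3) by (intro genideal_minimal homogeneous_ideal[OF h]) auto
  qed
  then have "irrelevant_gens \<Gamma> (Max (insert 0 (snd ` \<Gamma>)))"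
    unfolding irrelevant_gens_def using fin \<Gamma>(1,2) by (auto intro!: Max_ge image_eqI)
  then show ?thesis by blast
qed

text \<open>A form of positive degree is a sum of products g h' with g a generator and h' a form of
  the complementary degree. Peeling off one generator in this way takes the place of expansions into
  monomials.\<close>

lemma form_induct_gens:
  assumes \<Gamma>: "irrelevant_gens \<Gamma> C" and h: "h \<in> G n" "1 \<le> n"
    and S: "\<zero> \<in> S" "\<And>a b. a \<in> S \<Longrightarrow> b \<in> S \<Longrightarrow> a \<oplus> b \<in> S"
    and gen: "\<And>g k h'. (g, k) \<in> \<Gamma> \<Longrightarrow> k \<le> n \<Longrightarrow> h' \<in> G (n - k) \<Longrightarrow> g \<otimes> h' \<in> S"
  shows "h \<in> S"
proof -
  note \<Gamma>D = irrelevant_gensD[OF \<Gamma>]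
  \<comment> \<open>Quantifying over all multiples makes this an ideal, so that only the generators
    have to be checked.\<close>
  let ?X = "{x \<in> carrier R. \<forall>r\<in>carrier R. comp (r \<otimes> x) n \<in> S}"
  have "Idl (fst ` \<Gamma>) \<subseteq> ?X"
  proof (rule genideal_minimal)
    show "ideal ?X R"
    proof (rule ideal_if_closed)
      show "s \<otimes> a \<in> ?X" if "a \<in> ?X" "s \<in> carrier R" for a s
        using that by (auto simp flip: m_assoc)
    qed (use S in \<open>auto simp: r_distr comp_add\<close>)
    show "fst ` \<Gamma> \<subseteq> ?X"
    proof
      fix g assume "g \<in> fst ` \<Gamma>"
      then obtain k where g: "(g, k) \<in> \<Gamma>" by auto
      note gG = \<Gamma>D(4)[OF g] and gc = \<Gamma>D(5)[OF g]
      have "comp (r \<otimes> g) n \<in> S" if r: "r \<in> carrier R" for r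
        using comp_mult_form[OF r gG, of n] gen[OF g _ comp_grade[OF r]] S(1) gc r
        by (auto simp: m_comm)
      then show "g \<in> ?X" using gc by auto
    qed
  qed
  moreover have "h \<in> Idl (fst ` \<Gamma>)" using form_ge[OF h] \<Gamma>D(7) by auto
  ultimately have "comp (\<one> \<otimes> h) n \<in> S" by auto
  then show ?thesis using comp_form[OF h(1), of n] grade_carrier[OF h(1)] by simp
qed

text \<open>Pigeonhole: a monomial of degree above C |\<open>\<Gamma>\<close>| m in generators of
  degree at most C has more than |\<open>\<Gamma>\<close>| m factors, so some generator occurs at
  least m times. The induction peels off a generator g and passes to L : g, where the exponent
  demanded of g is one lower; hence exponents may differ between generators in
  \<open>main\<close>.\<close>

lemma ge_le_power_ideal:
  assumes \<Gamma>: "irrelevant_gens \<Gamma> C" and "ideal L R" and pw: "\<And>g k. (g, k) \<in> \<Gamma> \<Longrightarrow> g [^] (m::nat) \<in> L"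
  shows "ge (C * (card \<Gamma> * m) + 1) \<subseteq> L"
proof -
  note \<Gamma>D = irrelevant_gensD[OF \<Gamma>]
  have main: "h \<in> L"
    if "ideal L R" "\<And>\<gamma>. \<gamma> \<in> \<Gamma> \<Longrightarrow> fst \<gamma> [^] \<alpha> \<gamma> \<in> L" "h \<in> G n" "C * sum \<alpha> \<Gamma> + 1 \<le> n" for \<alpha> :: "'a \<times> nat \<Rightarrow> nat" and L h n
    using that
  proof (induction "sum \<alpha> \<Gamma>" arbitrary: \<alpha> L h n rule: less_induct)
    case less
    note D = ideal_props[OF less.prems(1)]
    show ?case
    proof (rule form_induct_gens[OF \<Gamma> less.prems(3) _ D(3,4)])
      show "1 \<le> n" using less.prems(4) by simp
      fix g k h' assume g: "(g, k) \<in> \<Gamma>" "k \<le> n" "h' \<in> G (n - k)"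
      have gc: "g \<in> carrier R" and hc: "h' \<in> carrier R" using \<Gamma>D(5)[OF g(1)] grade_carrier[OF g(3)] by auto
      show "g \<otimes> h' \<in> L"
      proof (cases "\<alpha> (g, k)")
        case 0
        then have "\<one> \<in> L" using less.prems(2)[OF g(1)] by simp
        then have "L = carrier R" by (rule ideal.one_imp_carrier[OF less.prems(1)])
        then show ?thesis using gc hc by simp
      next
        case (Suc m)
        let ?\<alpha> = "\<alpha>((g, k) := m)"
        have s: "sum \<alpha> \<Gamma> = Suc (sum ?\<alpha> \<Gamma>)"
        proof -
          have "sum ?\<alpha> (\<Gamma> - {(g, k)}) = sum \<alpha> (\<Gamma> - {(g, k)})" by (rule sum.cong) auto
          then show ?thesis using sum.remove[OF \<Gamma>D(1) g(1), of \<alpha>] sum.remove[OF \<Gamma>D(1) g(1), of ?\<alpha>] Suc by simp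
        qed
        have "h' \<in> colon_elem R L g"
        proof (rule less.hyps[OF _ colon_ideal[OF less.prems(1) gc] _ g(3)])
          show "sum ?\<alpha> \<Gamma> < sum \<alpha> \<Gamma>" using s by simp
          show "fst \<gamma> [^] ?\<alpha> \<gamma> \<in> colon_elem R L g" if \<gamma>: "\<gamma> \<in> \<Gamma>" for \<gamma>
          proof -
            have gc': "fst \<gamma> \<in> carrier R" using \<gamma> \<Gamma>D(5)[of "fst \<gamma>" "snd \<gamma>"] by simp
            show ?thesis
            proof (cases "\<gamma> = (g, k)")
              case True
              then show ?thesis using less.prems(2)[OF \<gamma>] Suc gc by (simp add: colon_elem_def)
            next
              case False
              then show ?thesis using D(7)[OF less.prems(2)[OF \<gamma>] gc] gc' by (simp add: colon_elem_def)
            qed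
          qed
          show "C * sum ?\<alpha> \<Gamma> + 1 \<le> n - k" using less.prems(4) s \<Gamma>D(3)[OF g(1)] by simp
        qed
        then show ?thesis using gc hc by (simp add: colon_elem_def m_comm)
      qed
    qed
  qed
  show ?thesis
  proof
    fix x assume "x \<in> ge (C * (card \<Gamma> * m) + 1)"
    then show "x \<in> L"
    proof (induction x rule: ge_induct)
      case (form n h)
      show ?case by (rule main[OF assms(2) _ form(2), of "\<lambda>_. m"]) (use pw form(1) in auto)
    next
      case (add x y)
      then show ?case using ideal_props(4)[OF assms(2)] by auto
    qed
  qed
qed

text \<open>Multiply the factors of a monomial until degree a is reached: the last factor overshoots
  by less than C, so degree b remains for the rest. Formally, a generator of degree k replaces a by
  a - k and L by L : g.\<close>

lemma ge_split:
  assumes \<Gamma>: "irrelevant_gens \<Gamma> C" and "ideal L R" and st: "\<And>s t. s \<in> ge a \<Longrightarrow> t \<in> ge b \<Longrightarrow> s \<otimes> t \<in> L"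
  shows "ge (a + b + C) \<subseteq> L"
proof -
  note \<Gamma>D = irrelevant_gensD[OF \<Gamma>]
  have main: "h \<in> L"
    if "ideal L R" "\<And>s t. s \<in> ge a \<Longrightarrow> t \<in> ge b \<Longrightarrow> s \<otimes> t \<in> L" "h \<in> G n" "a + b + C \<le> n" for a L h n
    using that
  proof (induction a arbitrary: L h n rule: less_induct)
    case (less a)
    note D = ideal_props[OF less.prems(1)]
    have hc: "h \<in> carrier R" using less.prems(3) grade_carrier by auto
    show ?case
    proof (cases "a = 0")
      case True
      then have "\<one> \<otimes> h \<in> L" using less.prems(4) form_ge[OF less.prems(3)] ge_0 by (intro less.prems(2)) auto
      then show ?thesis using hc by simp
    next
      case False
      show ?thesis
      proof (rule form_induct_gens[OF \<Gamma> less.prems(3) _ D(3,4)])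
        show "1 \<le> n" using less.prems(4) False by simp
        fix g k h' assume g: "(g, k) \<in> \<Gamma>" "k \<le> n" "h' \<in> G (n - k)"
        note gG = \<Gamma>D(4)[OF g(1)]
        have gc: "g \<in> carrier R" and h'c: "h' \<in> carrier R" using \<Gamma>D(5)[OF g(1)] grade_carrier[OF g(3)] by auto
        show "g \<otimes> h' \<in> L"
        proof (cases "a \<le> k")
          case True
          show ?thesis by (rule less.prems(2)[OF form_ge[OF gG True] form_ge[OF g(3)]])
            (use less.prems(4) \<Gamma>D(3)[OF g(1)] in simp)
        next
          case k: False
          have "h' \<in> colon_elem R L g"
          proof (rule less.IH[OF _ colon_ideal[OF less.prems(1) gc] _ g(3), of "a - k"])
            show "a - k < a" using False \<Gamma>D(2)[OF g(1)] by simp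
            show "a - k + b + C \<le> n - k" using less.prems(4) k by simp
            show "s \<otimes> t \<in> colon_elem R L g" if s: "s \<in> ge (a - k)" and t: "t \<in> ge b" for s t
            proof -
              have c: "s \<in> carrier R" "t \<in> carrier R" using s t ge_carrier by auto
              have "s \<otimes> g \<in> ge a" using ge_mult[OF s form_ge[OF gG order_refl]] k by simp
              then have "(s \<otimes> g) \<otimes> t \<in> L" using less.prems(2) t by blast
              then show ?thesis using c gc by (simp add: colon_elem_def m_ac)
            qed
          qed
          then show ?thesis using gc h'c by (simp add: colon_elem_def m_comm)
        qed
      qed
    qed
  qed
  show ?thesis
  proof
    fix x assume "x \<in> ge (a + b + C)"
    then show "x \<in> L"
    proof (induction x rule: ge_induct)
      case (form n h)
      show ?case by (rule main[OF assms(2) st form(2,1)])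
    next
      case (add x y)
      then show ?case using ideal_props(4)[OF assms(2)] by auto
    qed
  qed
qed

end

section \<open>A weak test element\<close>

locale noetherian_graded_p = noetherian_graded R G + cring_char_p R p for R (structure) and G and p
begin

lemma le_p_pow: "n \<le> p ^ n"
proof -
  have "n < 2 ^ n" by (rule less_exp)
  also have "\<dots> \<le> p ^ n" using prime_ge_2_nat[OF prime_p] by (rule power_mono) simp
  finally show ?thesis by simp
qed

lemma quotient_carrier: "carrier (R Quot P) = (+>) P ` carrier R"
  unfolding FactRing_def A_RCOSETS_def' by auto

lemma quotient_char_p:
  assumes "primeideal P R" shows "domain_char_p (R Quot P) p"
proof -
  interpret P: primeideal P R by fact
  interpret D: domain "R Quot P" by (rule P.quotient_is_domain)
  interpret h: ring_hom_ring R "R Quot P" "(+>) P" by (rule P.rcos_ring_hom_ring)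
  have "P +> ([n] \<cdot> \<one>) = [n] \<cdot>\<^bsub>R Quot P\<^esub> \<one>\<^bsub>R Quot P\<^esub>" for n :: nat
    by (induction n) auto
  from this[of p] have "[p] \<cdot>\<^bsub>R Quot P\<^esub> \<one>\<^bsub>R Quot P\<^esub> = \<zero>\<^bsub>R Quot P\<^esub>" using char_p by simp
  then show ?thesis using prime_p by unfold_locales
qed

text \<open>R/P is generated over the image of the field \<open>G 0\<close> by the images of
  finitely many forms, so the result for subfields propagates by adjoining these one at a
  time.\<close>

lemma quotient_uniform_splitting:
  assumes "primeideal P R" shows "uniform_splitting (R Quot P) p (carrier (R Quot P))"
proof -
  interpret P: primeideal P R by fact
  interpret D: domain_char_p "R Quot P" p by (rule quotient_char_p[OF assms])
  interpret h: ring_hom_ring R "R Quot P" "(+>) P" by (rule P.rcos_ring_hom_ring)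
  let ?D = "R Quot P" and ?\<phi> = "(+>) P"
  obtain \<Gamma> C where \<Gamma>: "irrelevant_gens \<Gamma> C" using irrelevant_gens_exist by auto
  note \<Gamma>D = irrelevant_gensD[OF \<Gamma>]
  have K: "subfield (?\<phi> ` G 0) ?D" by (rule h.img_is_subfield(2)[OF field_0 D.one_not_zero])
  have "\<exists>B. subring B ?D \<and> uniform_splitting ?D p B \<and> ?\<phi> ` G 0 \<subseteq> B \<and> X \<subseteq> B"
    if "finite X" "X \<subseteq> carrier ?D" for X
    using that
  proof (induction X)
    case empty
    then show ?case using D.uniform_splitting_subfield[OF K] subfieldE(1)[OF K] by blast
  next
    case (insert x X)
    then obtain B where B: "subring B ?D" "uniform_splitting ?D p B" "?\<phi> ` G 0 \<subseteq> B" "X \<subseteq> B" by auto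
    have x: "x \<in> carrier ?D" using insert.prems by auto
    show ?case
      using D.adjoin_subring[OF B(1) x] D.subset_adjoin[OF B(1) x] D.uniform_splitting_adjoin[OF B(2,1) x] B
      by (intro exI[of _ "adjoin ?D B x"]) auto
  qed
  from this[of "?\<phi> ` fst ` \<Gamma>"] obtain B where B: "subring B ?D" "uniform_splitting ?D p B"
    "?\<phi> ` G 0 \<subseteq> B" "?\<phi> ` fst ` \<Gamma> \<subseteq> B"
    using \<Gamma>D(1,5) by fastforce
  note Bp = subringE[OF B(1)]
  have forms: "?\<phi> h \<in> B" if "h \<in> G n" for h n
    using that
  proof (induction n arbitrary: h rule: less_induct)
    case (less n)
    show ?case
    proof (cases "n = 0")
      case True
      then show ?thesis using B(3) less.prems by auto
    next
      case False
      have "h \<in> {h \<in> carrier R. ?\<phi> h \<in> B}"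
      proof (rule form_induct_gens[OF \<Gamma> less.prems])
        show "1 \<le> n" using False by simp
        show "\<zero> \<in> {h \<in> carrier R. ?\<phi> h \<in> B}" using Bp(2) h.hom_zero by simp
        show "a \<oplus> b \<in> {h \<in> carrier R. ?\<phi> h \<in> B}"
          if "a \<in> {h \<in> carrier R. ?\<phi> h \<in> B}" "b \<in> {h \<in> carrier R. ?\<phi> h \<in> B}" for a b
          using that Bp(7) h.hom_add by auto
        fix g k h' assume g: "(g, k) \<in> \<Gamma>" "k \<le> n" "h' \<in> G (n - k)"
        have c: "g \<in> carrier R" "h' \<in> carrier R" using \<Gamma>D(5)[OF g(1)] grade_carrier[OF g(3)] by auto
        have "?\<phi> h' \<in> B" by (rule less.IH[OF _ g(3)]) (use g(2) \<Gamma>D(2)[OF g(1)] in simp)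
        moreover have "?\<phi> g \<in> B" using B(4) g(1) by force
        ultimately show "g \<otimes> h' \<in> {h \<in> carrier R. ?\<phi> h \<in> B}" using c Bp(6) by auto
      qed
      then show ?thesis by simp
    qed
  qed
  have "?\<phi> x \<in> B" if "x \<in> carrier R" for x
    using that
  proof (induction x rule: graded_induct)
    case (form n h)
    then show ?case by (rule forms)
  next
    case (add x y)
    then show ?case using Bp(7) by auto
  qed
  then have "carrier ?D \<subseteq> B" unfolding quotient_carrier by blast
  then have "carrier ?D = B" using Bp(1) by blast
  then show ?thesis using B(2) by simp
qed

text \<open>The test property up to an error in \<open>N\<close>. First N is a minimal prime, where
  a functional on the quotient is available; later it is the intersection of all minimal primes,
  whose elements are nilpotent.\<close>

definition weak_test_mod :: "'a set \<Rightarrow> 'a \<Rightarrow> nat \<Rightarrow> bool" where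
  "weak_test_mod N c f \<longleftrightarrow> (\<forall>I x. ideal I R \<longrightarrow> x \<in> tight_closure R p I \<longrightarrow>
    c \<otimes> x [^] (p ^ f) \<in> frob_power R I (p ^ f) <+>\<^bsub>R\<^esub> N)"

lemma weak_test_modD:
  "weak_test_mod N c f \<Longrightarrow> ideal I R \<Longrightarrow> x \<in> tight_closure R p I \<Longrightarrow>
    c \<otimes> x [^] (p ^ f) \<in> frob_power R I (p ^ f) <+>\<^bsub>R\<^esub> N"
  by (simp add: weak_test_mod_def)

text \<open>If d x^q lies in I^[q] with d in R^o, then d is nonzero modulo the minimal prime P, and
  a functional sends its class to the fixed c'. Applying the functional replaces q by p^f0 and d by
  c.\<close>

lemma weak_test_mod_prime:
  assumes mP: "minimal_prime R P"
  shows "\<exists>c\<in>carrier R. c \<notin> P \<and> (\<exists>f. weak_test_mod P c f)"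
proof -
  have pP: "primeideal P R" using mP by (simp add: minimal_prime_def)
  interpret P: primeideal P R by fact
  interpret D: domain_char_p "R Quot P" p by (rule quotient_char_p[OF pP])
  interpret h: ring_hom_ring R "R Quot P" "(+>) P" by (rule P.rcos_ring_hom_ring)
  let ?D = "R Quot P" and ?\<phi> = "(+>) P"
  have iP: "ideal P R" by (rule P.is_ideal)
  note DP = ideal_props[OF iP]
  note car = quotient_carrier[of P]
  have eq: "?\<phi> a = ?\<phi> b \<longleftrightarrow> a \<ominus> b \<in> P" if "a \<in> carrier R" "b \<in> carrier R" for a b
    using quotient_eq_iff_same_a_r_cos[OF iP that] by auto
  have zero: "?\<phi> a = \<zero>\<^bsub>?D\<^esub> \<longleftrightarrow> a \<in> P" if "a \<in> carrier R" for a
    using eq[OF that zero_closed] that h.hom_zero by (simp add: a_minus_def)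
  obtain c' f0 where c': "c' \<in> carrier ?D" "c' \<noteq> \<zero>\<^bsub>?D\<^esub>" and T: "\<And>d. d \<in> carrier ?D \<Longrightarrow> d \<noteq> \<zero>\<^bsub>?D\<^esub> \<Longrightarrow>
    \<exists>f\<^sub>1. \<forall>f\<ge>f\<^sub>1. \<exists>\<Theta>. frob_linear ?D (carrier ?D) (p ^ f) (p ^ f0) \<Theta> \<and> \<Theta> d = c'"
    using quotient_uniform_splitting[OF pP] unfolding uniform_splitting_def by metis
  obtain c where c: "c \<in> carrier R" "c' = ?\<phi> c" using c'(1) car by auto
  have "c \<otimes> x [^] (p ^ f0) \<in> frob_power R I (p ^ f0) <+>\<^bsub>R\<^esub> P"
    if I: "ideal I R" and x: "x \<in> tight_closure R p I" for I x
  proof -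
    have Ic: "I \<subseteq> carrier R" by (rule ideal_props(1)[OF I])
    let ?L = "frob_power R I (p ^ f0) <+>\<^bsub>R\<^esub> P"
    have L: "ideal ?L R" by (rule add_ideals[OF frob_power_ideal[OF Ic] iP])
    note DL = ideal_props[OF L] and DF = ideal_props[OF frob_power_ideal[OF Ic]]
    have FL: "w \<in> ?L" if "w \<in> frob_power R I (p ^ f0)" for w
    proof -
      have "w = w \<oplus> \<zero>" using DF(2)[OF that] by simp
      then show ?thesis using that DP(3) unfolding set_add_def' by blast
    qed
    have PL: "w \<in> ?L" if "w \<in> P" for w
    proof -
      have "w = \<zero> \<oplus> w" using DP(2)[OF that] by simp
      then show ?thesis using that DF(3) unfolding set_add_def' by blast
    qed
    obtain d e0 where d: "d \<in> ring_circ R" "\<And>f. f \<ge> e0 \<Longrightarrow> d \<otimes> x [^] (p ^ f) \<in> frob_power R I (p ^ f)"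
      and xc: "x \<in> carrier R"
      using x by (auto simp: tight_closure_def)
    have dc: "d \<in> carrier R" "d \<notin> P" using d(1) mP by (auto simp: ring_circ_def)
    obtain f1 where f1: "\<And>f. f \<ge> f1 \<Longrightarrow>
        \<exists>\<Theta>. frob_linear ?D (carrier ?D) (p ^ f) (p ^ f0) \<Theta> \<and> \<Theta> (?\<phi> d) = c'"
      using T[of "?\<phi> d"] zero[OF dc(1)] dc by auto
    \<comment> \<open>A single exponent beyond both thresholds is enough, so their dependence on x
      and d does no harm.\<close>
    define f where "f = max e0 f1"
    obtain \<Theta> where \<Theta>: "frob_linear ?D (carrier ?D) (p ^ f) (p ^ f0) \<Theta>" "\<Theta> (?\<phi> d) = c'"
      using f1[of f] by (auto simp: f_def)
    have \<Theta>c: "\<Theta> u \<in> carrier ?D" if "u \<in> carrier ?D" for u using \<Theta>(1) that by (auto simp: frob_linear_def)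
    have \<Theta>_add: "\<Theta> (u \<oplus>\<^bsub>?D\<^esub> v) = \<Theta> u \<oplus>\<^bsub>?D\<^esub> \<Theta> v" if "u \<in> carrier ?D" "v \<in> carrier ?D" for u v
      using \<Theta>(1) that by (simp add: frob_linear_def)
    have \<Theta>_mult: "\<Theta> (u [^]\<^bsub>?D\<^esub> (p ^ f) \<otimes>\<^bsub>?D\<^esub> v) = u [^]\<^bsub>?D\<^esub> (p ^ f0) \<otimes>\<^bsub>?D\<^esub> \<Theta> v"
      if "u \<in> carrier ?D" "v \<in> carrier ?D" for u v
      using \<Theta>(1) that by (simp add: frob_linear_def)
    have \<Theta>0: "\<Theta> \<zero>\<^bsub>?D\<^esub> = \<zero>\<^bsub>?D\<^esub>" by (rule D.frob_linear_zero[OF D.carrier_is_subring \<Theta>(1)])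
    \<comment> \<open>The elements all of whose multiples are sent into the image of
      \<open>?L\<close>. They form an ideal, so only q-th powers of elements of I matter, and from
      those semilinearity takes out a p^f0-th power.\<close>
    let ?X = "{r \<in> carrier R. \<forall>s\<in>carrier R. \<Theta> (?\<phi> (s \<otimes> r)) \<in> ?\<phi> ` ?L}"
    have "frob_power R I (p ^ f) \<subseteq> ?X"
    proof (rule frob_power_minimal)
      show "ideal ?X R"
      proof (rule ideal_if_closed)
        show "?X \<subseteq> carrier R" by auto
        have "\<Theta> (?\<phi> (s \<otimes> \<zero>)) = ?\<phi> \<zero>" if "s \<in> carrier R" for s
          using that \<Theta>0 h.hom_zero by simp
        then have "\<Theta> (?\<phi> (s \<otimes> \<zero>)) \<in> ?\<phi> ` ?L" if "s \<in> carrier R" for s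
          using imageI[OF DL(3), of ?\<phi>] that by (simp only:)
        then show "\<zero> \<in> ?X" using zero_closed by blast
        show "s \<otimes> a \<in> ?X" if a: "a \<in> ?X" and s: "s \<in> carrier R" for a s
        proof -
          have "\<Theta> (?\<phi> (r \<otimes> (s \<otimes> a))) \<in> ?\<phi> ` ?L" if r: "r \<in> carrier R" for r
          proof -
            have "r \<otimes> (s \<otimes> a) = (r \<otimes> s) \<otimes> a" using a s r by (simp add: m_assoc)
            moreover have "r \<otimes> s \<in> carrier R" using s r by simp
            ultimately show ?thesis using a by (simp only: mem_Collect_eq)
          qed
          then show ?thesis using a s by blast
        qed
        fix a b assume ab: "a \<in> ?X" "b \<in> ?X"
        have "\<Theta> (?\<phi> (s \<otimes> (a \<oplus> b))) \<in> ?\<phi> ` ?L" if s: "s \<in> carrier R" for s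
        proof -
          have abc: "a \<in> carrier R" "b \<in> carrier R" using ab by auto
          obtain l m where lm: "l \<in> ?L" "m \<in> ?L" "\<Theta> (?\<phi> (s \<otimes> a)) = ?\<phi> l" "\<Theta> (?\<phi> (s \<otimes> b)) = ?\<phi> m"
            using ab s by blast
          have "?\<phi> (s \<otimes> (a \<oplus> b)) = ?\<phi> (s \<otimes> a) \<oplus>\<^bsub>?D\<^esub> ?\<phi> (s \<otimes> b)"
            using abc s h.hom_add[of "s \<otimes> a" "s \<otimes> b"] by (simp only: r_distr m_closed)
          then have "\<Theta> (?\<phi> (s \<otimes> (a \<oplus> b))) = ?\<phi> l \<oplus>\<^bsub>?D\<^esub> ?\<phi> m"
            using \<Theta>_add[of "?\<phi> (s \<otimes> a)" "?\<phi> (s \<otimes> b)"] abc s lm(3,4) by simp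
          also have "\<dots> = ?\<phi> (l \<oplus> m)" using h.hom_add lm(1,2) DL(2) by simp
          finally show ?thesis using DL(4)[OF lm(1,2)] by blast
        qed
        then show "a \<oplus> b \<in> ?X" using ab by auto
      qed
      fix a assume a: "a \<in> I"
      then have ac: "a \<in> carrier R" using Ic by auto
      have "\<Theta> (?\<phi> (s \<otimes> a [^] (p ^ f))) \<in> ?\<phi> ` ?L" if s: "s \<in> carrier R" for s
      proof -
        have "?\<phi> s \<in> carrier ?D" using s by simp
        then have "\<Theta> (?\<phi> s) \<in> carrier ?D" by (rule \<Theta>c)
        then obtain t where t: "t \<in> carrier R" "\<Theta> (?\<phi> s) = ?\<phi> t" unfolding car by blast
        have "?\<phi> (s \<otimes> a [^] (p ^ f)) = ?\<phi> a [^]\<^bsub>?D\<^esub> (p ^ f) \<otimes>\<^bsub>?D\<^esub> ?\<phi> s"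
          using s ac by (simp add: h.hom_nat_pow D.m_comm)
        then have "\<Theta> (?\<phi> (s \<otimes> a [^] (p ^ f))) = ?\<phi> (a [^] (p ^ f0) \<otimes> t)"
          using \<Theta>_mult[of "?\<phi> a" "?\<phi> s"] s ac t by (simp add: h.hom_nat_pow)
        moreover have "a [^] (p ^ f0) \<otimes> t \<in> ?L"
          using FL[OF frob_power_mem[OF Ic a]] t(1) DL(7) by blast
        ultimately show ?thesis by blast
      qed
      then show "a [^] (p ^ f) \<in> ?X" using ac by auto
    qed
    moreover have "d \<otimes> x [^] (p ^ f) \<in> frob_power R I (p ^ f)" by (rule d(2)) (simp add: f_def)
    ultimately have "d \<otimes> x [^] (p ^ f) \<in> ?X" by (rule subsetD)
    then obtain l where l: "l \<in> ?L" "\<Theta> (?\<phi> (\<one> \<otimes> (d \<otimes> x [^] (p ^ f)))) = ?\<phi> l" by blast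
    have "?\<phi> (\<one> \<otimes> (d \<otimes> x [^] (p ^ f))) = ?\<phi> x [^]\<^bsub>?D\<^esub> (p ^ f) \<otimes>\<^bsub>?D\<^esub> ?\<phi> d"
      using dc xc by (simp add: h.hom_nat_pow D.m_comm)
    then have "?\<phi> l = ?\<phi> (x [^] (p ^ f0) \<otimes> c)"
      using l(2) \<Theta>_mult[of "?\<phi> x" "?\<phi> d"] xc dc \<Theta>(2) c by (simp add: h.hom_nat_pow)
    then have "x [^] (p ^ f0) \<otimes> c \<ominus> l \<in> P"
      using eq[of "x [^] (p ^ f0) \<otimes> c" l] xc c(1) DL(2)[OF l(1)] by auto
    then have "(x [^] (p ^ f0) \<otimes> c \<ominus> l) \<oplus> l \<in> ?L" using PL l(1) DL(4) by blast
    moreover have "(x [^] (p ^ f0) \<otimes> c \<ominus> l) \<oplus> l = c \<otimes> x [^] (p ^ f0)"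
    proof -
      have "x [^] (p ^ f0) \<in> carrier R" "l \<in> carrier R" using xc DL(2)[OF l(1)] by auto
      then show ?thesis using c(1) by algebra
    qed
    ultimately show ?thesis by simp
  qed
  then have "weak_test_mod P c f0" by (simp add: weak_test_mod_def)
  moreover have "c \<notin> P" using zero[OF c(1)] c c'(2) by auto
  ultimately show ?thesis using c(1) by blast
qed

text \<open>Frobenius raises the two parts of the sum separately. This brings two tests to a common
  exponent and, for v large, kills a nilpotent error.\<close>

lemma raise_weak_test:
  assumes I: "ideal I R" and N: "ideal N R" and a: "a \<in> carrier R" and x: "x \<in> carrier R"
    and mem: "a \<otimes> x [^] (p ^ u) \<in> frob_power R I (p ^ u) <+>\<^bsub>R\<^esub> N"
  shows "\<exists>i\<in>frob_power R I (p ^ (u + v)). \<exists>\<nu>\<in>N. a [^] (p ^ v) \<otimes> x [^] (p ^ (u + v)) = i \<oplus> \<nu> [^] (p ^ v)"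
proof -
  have Ic: "I \<subseteq> carrier R" by (rule ideal_props(1)[OF I])
  note D = ideal_props[OF frob_power_ideal[OF Ic]]
  obtain i \<nu> where i: "i \<in> frob_power R I (p ^ u)" "\<nu> \<in> N" "a \<otimes> x [^] (p ^ u) = i \<oplus> \<nu>"
    using mem by (auto simp: set_add_def')
  have c: "i \<in> carrier R" "\<nu> \<in> carrier R" using D(2)[OF i(1)] ideal_props(2)[OF N i(2)] by auto
  have "i [^] (p ^ v) \<in> frob_power R I (p ^ (u + v))"
    using frob_power_mem[OF D(1) i(1), of "p ^ v"] frob_power_frob_power[OF Ic] by simp
  moreover have "a [^] (p ^ v) \<otimes> x [^] (p ^ (u + v)) = (a \<otimes> x [^] (p ^ u)) [^] (p ^ v)"
    using a x by (simp add: nat_pow_distrib pow_pow)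
  then have "a [^] (p ^ v) \<otimes> x [^] (p ^ (u + v)) = i [^] (p ^ v) \<oplus> \<nu> [^] (p ^ v)"
    using i(3) c by (simp add: frob_add)
  ultimately show ?thesis using i(2) by blast
qed

text \<open>Multiply one element outside P from each ideal of \<open>U\<close>; the product stays
  outside the prime P.\<close>

lemma prime_separation:
  assumes "finite U" "primeideal P R" "\<And>Q. Q \<in> U \<Longrightarrow> ideal Q R \<and> \<not> Q \<subseteq> P"
  shows "\<exists>g\<in>carrier R. g \<notin> P \<and> (\<forall>Q\<in>U. g \<in> Q)"
  using assms(1,3)
proof (induction U)
  case empty
  have "\<one> \<notin> P"
    using ideal.one_imp_carrier[OF primeideal.axioms(1)[OF assms(2)]] primeideal.I_notcarr[OF assms(2)] by auto
  then show ?case by (intro bexI[of _ \<one>]) auto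
next
  case (insert Q U)
  then obtain g where g: "g \<in> carrier R" "g \<notin> P" "\<forall>Q\<in>U. g \<in> Q" by auto
  have Q: "ideal Q R" "\<not> Q \<subseteq> P" using insert.prems by auto
  then obtain a where a: "a \<in> Q" "a \<notin> P" by auto
  have ac: "a \<in> carrier R" by (rule ideal_props(2)[OF Q(1) a(1)])
  have "g \<otimes> a \<notin> P" using primeideal.I_prime[OF assms(2) g(1) ac] g(2) a(2) by auto
  moreover have "g \<otimes> a \<in> Q" by (rule ideal_props(6)[OF Q(1) a(1) g(1)])
  moreover have "g \<otimes> a \<in> Q'" if Q': "Q' \<in> U" for Q'
    using ideal_props(7)[of Q' g a] insert.prems[of Q'] g(3) Q' ac by auto
  ultimately show ?case using g(1) ac by (intro bexI[of _ "g \<otimes> a"]) auto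
qed

text \<open>N is finitely generated and the elements killed by a fixed Frobenius power form an
  ideal, so a bound for the generators is a bound for N.\<close>

lemma nilpotent_uniform:
  assumes N: "ideal N R" and nil: "\<And>x. x \<in> N \<Longrightarrow> \<exists>n::nat. x [^] n = \<zero>"
  shows "\<exists>f. \<forall>x\<in>N. x [^] (p ^ f) = \<zero>"
proof -
  obtain F where F: "F \<subseteq> carrier R" "finite F" "N = Idl F" using finetely_gen[OF N] by blast
  have FN: "x \<in> N" if "x \<in> F" for x using genideal_self[OF F(1)] F(3) that by auto
  obtain n :: "'a \<Rightarrow> nat" where n: "\<And>x. x \<in> N \<Longrightarrow> x [^] n x = \<zero>" using nil by metis
  define f where "f = Max (insert 0 (n ` F))"
  have "x [^] (p ^ f) = \<zero>" if x: "x \<in> F" for x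
  proof -
    have "n x \<le> f" unfolding f_def using F(2) x by (intro Max_ge) auto
    also have "f \<le> p ^ f" by (rule le_p_pow)
    finally obtain k where "p ^ f = n x + k" using le_Suc_ex by blast
    then have "x [^] (p ^ f) = x [^] n x \<otimes> x [^] k" using x F(1) by (auto simp: nat_pow_mult)
    then show ?thesis using n[OF FN[OF x]] x F(1) by auto
  qed
  then have "Idl F \<subseteq> {x \<in> carrier R. x [^] (p ^ f) \<in> {\<zero>}}"
    using F(1) by (intro genideal_minimal root_ideal zeroideal) auto
  then show ?thesis using F(3) by blast
qed

text \<open>A test modulo a minimal prime P, multiplied by an element of all the other minimal
  primes that is not in P, becomes a test modulo their intersection N. Sums of Frobenius powers of
  these elements avoid every minimal prime, since each prime misses exactly one summand. A last
  Frobenius power removes N.\<close>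

lemma weak_test_element:
  "\<exists>c\<in>ring_circ R. \<exists>f. \<forall>I x. ideal I R \<longrightarrow> x \<in> tight_closure R p I \<longrightarrow>
    c \<otimes> x [^] (p ^ f) \<in> frob_power R I (p ^ f)"
proof -
  have "homogeneous_ideal R G {\<zero>}" by (rule homogeneousI[OF zeroideal]) auto
  then obtain S where "hcover {\<zero>} S" using hcover_exists by blast
  note S = hcoverD[OF this]
  define M where "M = {P. minimal_prime R P}"
  have MS: "M \<subseteq> S"
  proof
    fix Q assume Q: "Q \<in> M"
    then have pQ: "primeideal Q R" by (simp add: M_def minimal_prime_def)
    then have "{\<zero>} \<subseteq> Q" using ideal_props(3)[OF primeideal.axioms(1)] by auto
    then obtain P where "P \<in> S" "P \<subseteq> Q" using S(4)[OF pQ] by auto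
    then show "Q \<in> S" using Q hprimeD(2)[OF S(2)] by (auto simp: M_def minimal_prime_def)
  qed
  then have finM: "finite M" using S(1) finite_subset by auto
  \<comment> \<open>Take a minimal one among the finitely many members below Q. A smaller prime
    would contain a member again, so the one taken is a minimal prime of R.\<close>
  have below: "\<exists>P\<in>M. P \<subseteq> Q" if Q: "Q \<in> S" for Q
  proof -
    have fin: "finite {P \<in> S. P \<subseteq> Q}" "{P \<in> S. P \<subseteq> Q} \<noteq> {}" using S(1) Q by auto
    then obtain P where P: "P \<in> S" "P \<subseteq> Q" "\<And>P'. P' \<in> S \<Longrightarrow> P' \<subseteq> Q \<Longrightarrow> P' \<subseteq> P \<Longrightarrow> P = P'"
      using finite_has_minimal[OF fin] by auto
    have "Q' = P" if Q': "primeideal Q' R" "Q' \<subseteq> P" for Q'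
    proof -
      have "{\<zero>} \<subseteq> Q'" using ideal_props(3)[OF primeideal.axioms(1)[OF Q'(1)]] by auto
      then obtain P' where "P' \<in> S" "P' \<subseteq> Q'" using S(4)[OF Q'(1)] by auto
      then show ?thesis using P(2) P(3)[of P'] Q'(2) by auto
    qed
    then show ?thesis using P(2) hprimeD(2)[OF S(2)[OF P(1)]] by (auto simp: M_def minimal_prime_def)
  qed
  have Mp: "primeideal P R" "ideal P R" if "P \<in> M" for P
    using that primeideal.axioms(1) by (auto simp: M_def minimal_prime_def)
  define N where "N = {x \<in> carrier R. \<forall>P\<in>M. x \<in> P}"
  have N: "ideal N R"
    unfolding N_def by (rule ideal_if_closed) (use ideal_props[OF Mp(2)] in auto)
  note DN = ideal_props[OF N]
  have "\<exists>n::nat. x [^] n = \<zero>" if "x \<in> N" for x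
    using S(5)[of x] that below by (fastforce simp: N_def)
  then obtain f2 where f2: "\<And>x. x \<in> N \<Longrightarrow> x [^] (p ^ f2) = \<zero>" using nilpotent_uniform[OF N] by blast
  \<comment> \<open>T holds the minimal primes avoided so far. Membership in the remaining ones is
    maintained so that the next summand decides alone there.\<close>
  have "\<exists>c\<in>carrier R. (\<forall>P\<in>T. c \<notin> P) \<and> (\<forall>P\<in>M - T. c \<in> P) \<and> (\<exists>f. weak_test_mod N c f)"
    if "finite T" "T \<subseteq> M" for T
    using that
  proof (induction T)
    case empty
    have "\<zero> \<otimes> x [^] (p ^ 0) \<in> frob_power R I (p ^ 0) <+>\<^bsub>R\<^esub> N"
      if "ideal I R" "x \<in> tight_closure R p I" for I x
    proof -
      have "ideal (frob_power R I (p ^ 0) <+>\<^bsub>R\<^esub> N) R"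
        by (intro add_ideals frob_power_ideal N ideal_props(1) that)
      then show ?thesis using that(2) ideal_props(3) by (simp add: tight_closure_def)
    qed
    then have "weak_test_mod N \<zero> 0" by (simp add: weak_test_mod_def)
    moreover have "\<forall>P\<in>M. \<zero> \<in> P" using ideal_props(3)[OF Mp(2)] by simp
    ultimately show ?case by (intro bexI[of _ \<zero>] conjI exI[of _ 0]) simp_all
  next
    case (insert P T)
    then obtain c f0 where c: "c \<in> carrier R" "\<forall>P\<in>T. c \<notin> P" "\<forall>P\<in>M - T. c \<in> P"
      and cf: "weak_test_mod N c f0" by auto
    note cf = weak_test_modD[OF cf]
    have PM: "P \<in> M" using insert.prems by auto
    note pP = Mp[OF PM] note DP = ideal_props[OF pP(2)]
    obtain c1 f1 where c1: "c1 \<in> carrier R" "c1 \<notin> P"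
      and cf1: "weak_test_mod P c1 f1"
      using weak_test_mod_prime[of P] PM unfolding M_def by blast
    note cf1 = weak_test_modD[OF cf1]
    have "ideal Q R \<and> \<not> Q \<subseteq> P" if Q: "Q \<in> M - {P}" for Q
    proof
      show "ideal Q R" using Mp(2) Q by simp
      have "Q \<noteq> P" "primeideal Q R" using Mp(1) Q by simp_all
      then show "\<not> Q \<subseteq> P" using PM unfolding M_def minimal_prime_def by blast
    qed
    then obtain g where g: "g \<in> carrier R" "g \<notin> P" "\<forall>Q\<in>M - {P}. g \<in> Q"
      using prime_separation[of "M - {P}" P] finM pP(1) by blast
    define c2 where "c2 = g \<otimes> c1"
    have c2: "c2 \<in> carrier R" "c2 \<notin> P" "\<And>Q. Q \<in> M \<Longrightarrow> Q \<noteq> P \<Longrightarrow> c2 \<in> Q"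
      using g c1 primeideal.I_prime[OF pP(1) g(1) c1(1)] ideal_props(7)[OF Mp(2)] by (auto simp: c2_def)
    have cf2: "c2 \<otimes> x [^] (p ^ f1) \<in> frob_power R I (p ^ f1) <+>\<^bsub>R\<^esub> N"
      if I: "ideal I R" and x: "x \<in> tight_closure R p I" for I x
    proof -
      note F = ideal_props[OF frob_power_ideal[OF ideal_props(1)[OF I], of "p ^ f1"]]
      obtain i \<pi> where i: "i \<in> frob_power R I (p ^ f1)" "\<pi> \<in> P" "c1 \<otimes> x [^] (p ^ f1) = i \<oplus> \<pi>"
        using cf1[OF I x] by (auto simp: set_add_def')
      have cc: "i \<in> carrier R" "\<pi> \<in> carrier R" "x \<in> carrier R"
        using F(2)[OF i(1)] DP(2)[OF i(2)] x by (auto simp: tight_closure_def)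
      have "c2 \<otimes> x [^] (p ^ f1) = g \<otimes> i \<oplus> g \<otimes> \<pi>"
        using i(3) cc g(1) c1(1) by (simp add: c2_def m_assoc r_distr)
      moreover have "g \<otimes> i \<in> frob_power R I (p ^ f1)" by (rule F(6)[OF i(1) g(1)])
      moreover have "g \<otimes> \<pi> \<in> Q" if "Q \<in> M" for Q
        using DP(6)[OF i(2) g(1)] ideal_props(7)[OF Mp(2)[OF that], of g \<pi>] g(3) that cc(2) by (cases "Q = P") auto
      then have "g \<otimes> \<pi> \<in> N" using g(1) cc(2) by (simp add: N_def)
      ultimately show ?thesis unfolding set_add_def' by blast
    qed
    \<comment> \<open>The crossed exponents bring both tests to exponent f0 + f1. Modulo a prime of
      T only the first summand survives, modulo P only the second.\<close>
    define c3 where "c3 = c [^] (p ^ f1) \<oplus> c2 [^] (p ^ f0)"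
    have pc: "c [^] (p ^ f1) \<in> carrier R" "c2 [^] (p ^ f0) \<in> carrier R" using c c2 by auto
    have pw: "a [^] (p ^ k) \<in> Q \<longleftrightarrow> a \<in> Q" if "a \<in> carrier R" "Q \<in> M" for a k Q
      using prime_pow[OF Mp(1)[OF that(2)] that(1)] ideal_pow_closed[OF Mp(2)[OF that(2)], of a "p ^ k"] by auto
    have sum_notin: "a \<oplus> b \<notin> Q" if "a \<in> Q" "b \<notin> Q" "b \<in> carrier R" "Q \<in> M" for a b Q
    proof
      assume "a \<oplus> b \<in> Q"
      then have "(a \<oplus> b) \<ominus> a \<in> Q" using that(1) ideal_props(5)[OF Mp(2)[OF that(4)]] by blast
      moreover have "(a \<oplus> b) \<ominus> a = b"
        using that(3) ideal_props(2)[OF Mp(2)[OF that(4)] that(1)] by algebra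
      ultimately show False using that(2) by simp
    qed
    have "c3 \<notin> Q" if Q: "Q \<in> insert P T" for Q
    proof -
      have QM: "Q \<in> M" using Q insert.prems by auto
      show ?thesis
      proof (cases "Q = P")
        case True
        have "c \<in> P" using c(3) PM insert.hyps by auto
        then show ?thesis unfolding c3_def
          using sum_notin[of "c [^] (p ^ f1)" Q "c2 [^] (p ^ f0)"] pw[OF c(1) QM] pw[OF c2(1) QM] c2 pc True QM by simp
      next
        case False
        then have "c \<notin> Q" using Q c(2) by auto
        then have "c2 [^] (p ^ f0) \<oplus> c [^] (p ^ f1) \<notin> Q"
          using sum_notin[of "c2 [^] (p ^ f0)" Q "c [^] (p ^ f1)"] pw[OF c(1) QM] pw[OF c2(1) QM] c2(3)[OF QM False] pc QM by simp
        then show ?thesis using pc by (simp add: c3_def a_comm)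
      qed
    qed
    moreover have "c3 \<in> Q" if "Q \<in> M - insert P T" for Q
      using that c(3) c2(3) pw c(1) c2(1) ideal_props(4)[OF Mp(2)] by (auto simp: c3_def)
    moreover have "c3 \<otimes> x [^] (p ^ (f0 + f1)) \<in> frob_power R I (p ^ (f0 + f1)) <+>\<^bsub>R\<^esub> N"
      if I: "ideal I R" and x: "x \<in> tight_closure R p I" for I x
    proof -
      let ?L = "frob_power R I (p ^ (f0 + f1)) <+>\<^bsub>R\<^esub> N"
      have xc: "x \<in> carrier R" using x by (simp add: tight_closure_def)
      have L: "ideal ?L R" by (intro add_ideals frob_power_ideal N ideal_props(1) I)
      have mem: "i \<oplus> \<nu> [^] (p ^ k) \<in> ?L" if "i \<in> frob_power R I (p ^ (f0 + f1))" "\<nu> \<in> N" for i \<nu> k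
        using that ideal_pow_closed[OF N that(2), of "p ^ k"] unfolding set_add_def' by auto
      have "c [^] (p ^ f1) \<otimes> x [^] (p ^ (f0 + f1)) \<in> ?L"
        using raise_weak_test[OF I N c(1) xc cf[OF I x], of f1] mem by auto
      moreover have "c2 [^] (p ^ f0) \<otimes> x [^] (p ^ (f0 + f1)) \<in> ?L"
        using raise_weak_test[OF I N c2(1) xc cf2[OF I x], of f0] mem by (auto simp: add.commute)
      ultimately show ?thesis
        using ideal_props(4)[OF L] pc xc by (simp add: c3_def l_distr)
    qed
    then have "weak_test_mod N c3 (f0 + f1)" by (simp add: weak_test_mod_def)
    moreover have "c3 \<in> carrier R" using pc by (simp add: c3_def)
    ultimately show ?case by blast
  qed
  from this[OF finM order_refl] obtain c f where c: "c \<in> carrier R" "\<forall>P\<in>M. c \<notin> P"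
    and cf: "weak_test_mod N c f" by auto
  note cf = weak_test_modD[OF cf]
  have "c [^] (p ^ f2) \<otimes> x [^] (p ^ (f + f2)) \<in> frob_power R I (p ^ (f + f2))"
    if I: "ideal I R" and x: "x \<in> tight_closure R p I" for I x
  proof -
    have xc: "x \<in> carrier R" using x by (simp add: tight_closure_def)
    note F = ideal_props[OF frob_power_ideal[OF ideal_props(1)[OF I]]]
    show ?thesis using raise_weak_test[OF I N c(1) xc cf[OF I x], of f2] f2 F(2) by auto
  qed
  moreover have "c [^] (p ^ f2) \<in> ring_circ R"
    by (rule ring_circ_pow) (use c in \<open>auto simp: ring_circ_def M_def\<close>)
  ultimately show ?thesis by blast
qed

end

section \<open>Condition (LC) under adding a form\<close>

lemma (in cring) quot_module_smult:
  assumes L: "ideal L R" and "r \<in> carrier R" "x \<in> carrier R"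
  shows "r \<odot>\<^bsub>quot_module R L\<^esub> (L +> x) = \<zero>\<^bsub>quot_module R L\<^esub> \<longleftrightarrow> r \<otimes> x \<in> L"
proof -
  interpret L: ideal L R by fact
  have "r \<odot>\<^bsub>quot_module R L\<^esub> (L +> x) = L +> (r \<otimes> x)"
    using assms by (simp add: quot_module_def FactRing_def L.rcoset_mult_add)
  moreover have "\<zero>\<^bsub>quot_module R L\<^esub> = L" by (simp add: quot_module_def FactRing_def)
  moreover have "L +> (r \<otimes> x) = L \<longleftrightarrow> r \<otimes> x \<in> L"
    using L.rcos_const_imp_mem a_rcos_zero[OF L] m_closed[OF assms(2,3)] by blast
  ultimately show ?thesis by simp
qed

section \<open>Torsion modulo an ideal and the conditions in terms of elements\<close>

context graded_cring
begin

text \<open>Membership of the class of \<open>x\<close> in the zeroth local cohomology of R/L,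
  expressed by a representative.\<close>

definition torsion :: "'a set \<Rightarrow> 'a \<Rightarrow> bool" where
  "torsion L x \<longleftrightarrow> (\<exists>k::nat. \<forall>r \<in> ge 1 [^]\<^bsub>ideals_set R\<^esub> k. r \<otimes> x \<in> L)"

lemma ge_1_power_ideal: "ideal (ge 1 [^]\<^bsub>ideals_set R\<^esub> (k::nat)) R"
proof -
  interpret I: comm_monoid "ideals_set R" by (rule ideals_set_is_comm_monoid)
  have "ge 1 \<in> carrier (ideals_set R)" using ge_ideal by (simp add: ideals_set_def)
  then have "ge 1 [^]\<^bsub>ideals_set R\<^esub> k \<in> carrier (ideals_set R)" by (rule I.nat_pow_closed)
  then show ?thesis by (simp add: ideals_set_def)
qed

lemma ge_1_power_Suc:
  "ge 1 [^]\<^bsub>ideals_set R\<^esub> Suc k = (ge 1 [^]\<^bsub>ideals_set R\<^esub> k) \<cdot> ge 1"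
  by (simp add: ideals_set_def)

lemma ge_1_power_subset: "ge 1 [^]\<^bsub>ideals_set R\<^esub> (k::nat) \<subseteq> ge k"
proof (induction k)
  case 0
  then show ?case by (simp add: ideals_set_def ge_0)
next
  case (Suc k)
  show ?case unfolding ge_1_power_Suc
  proof
    fix x assume "x \<in> (ge 1 [^]\<^bsub>ideals_set R\<^esub> k) \<cdot> ge 1"
    then show "x \<in> ge (Suc k)"
    proof (induction x rule: ideal_prod.induct)
      case (prod i j)
      then show ?case using ge_mult[OF subsetD[OF Suc] , of i j 1] by simp
    next
      case (sum s1 s2)
      then show ?case using ge_add by simp
    qed
  qed
qed

lemma pow_in_ge_1_power: "w \<in> ge 1 \<Longrightarrow> w [^] k \<in> ge 1 [^]\<^bsub>ideals_set R\<^esub> (k::nat)"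
proof (induction k)
  case 0
  then show ?case by (simp add: ideals_set_def)
next
  case (Suc k)
  have "w [^] k \<otimes> w \<in> (ge 1 [^]\<^bsub>ideals_set R\<^esub> k) \<cdot> ge 1"
    by (rule ideal_prod.prod[OF Suc.IH[OF Suc.prems] Suc.prems])
  then show ?case unfolding ge_1_power_Suc nat_pow_Suc .
qed

lemma torsion_if_ge: "(\<And>r. r \<in> ge k \<Longrightarrow> r \<otimes> x \<in> L) \<Longrightarrow> torsion L x"
  unfolding torsion_def by (intro exI[of _ k] ballI) (use ge_1_power_subset in auto)

lemma torsion_mono: "torsion L x \<Longrightarrow> L \<subseteq> L' \<Longrightarrow> torsion L' x"
  unfolding torsion_def by blast

lemma torsion_pow:
  assumes "torsion L x" shows "\<exists>k::nat. \<forall>w\<in>ge 1. w [^] k \<otimes> x \<in> L"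
proof -
  obtain k :: nat where "\<forall>r \<in> ge 1 [^]\<^bsub>ideals_set R\<^esub> k. r \<otimes> x \<in> L"
    using assms by (auto simp: torsion_def)
  then show ?thesis using pow_in_ge_1_power by (intro exI[of _ k] ballI) simp
qed

lemma torsion_mult:
  assumes "ideal L R" "torsion L x" "x \<in> carrier R" "s \<in> carrier R" shows "torsion L (s \<otimes> x)"
proof -
  obtain k :: nat where k: "\<And>r. r \<in> ge 1 [^]\<^bsub>ideals_set R\<^esub> k \<Longrightarrow> r \<otimes> x \<in> L"
    using assms(2) by (auto simp: torsion_def)
  have "r \<otimes> (s \<otimes> x) \<in> L" if r: "r \<in> ge 1 [^]\<^bsub>ideals_set R\<^esub> k" for r
  proof -
    have "r \<in> carrier R" by (rule ideal_props(2)[OF ge_1_power_ideal r])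
    then have "r \<otimes> (s \<otimes> x) = s \<otimes> (r \<otimes> x)" using assms(3,4) by (simp add: m_lcomm)
    then show ?thesis using ideal_props(6)[OF assms(1) k[OF r] assms(4)] by simp
  qed
  then show ?thesis unfolding torsion_def by blast
qed

lemma annihilates_H0_iff:
  assumes L: "ideal L R"
  shows "(let M = quot_module R L in \<forall>r \<in> ideal_ge R G N. \<forall>u \<in> H0 R (irrelevant_ideal R G) M.
      r \<odot>\<^bsub>M\<^esub> u = \<zero>\<^bsub>M\<^esub>) \<longleftrightarrow> (\<forall>r\<in>ge N. \<forall>x\<in>carrier R. torsion L x \<longrightarrow> r \<otimes> x \<in> L)"
proof -
  have car: "carrier (quot_module R L) = (+>) L ` carrier R"
    unfolding quot_module_def FactRing_def A_RCOSETS_def' by auto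
  have "L +> x \<in> H0 R (ge 1) (quot_module R L) \<longleftrightarrow> torsion L x" if x: "x \<in> carrier R" for x
  proof -
    have "r \<odot>\<^bsub>quot_module R L\<^esub> (L +> x) = \<zero>\<^bsub>quot_module R L\<^esub> \<longleftrightarrow> r \<otimes> x \<in> L"
      if "r \<in> ge 1 [^]\<^bsub>ideals_set R\<^esub> k" for r and k :: nat
      by (rule quot_module_smult[OF L ideal_props(2)[OF ge_1_power_ideal that] x])
    then show ?thesis unfolding H0_def torsion_def using x car by auto
  qed
  then have H0: "H0 R (ge 1) (quot_module R L) = (+>) L ` {x \<in> carrier R. torsion L x}"
    using car by (auto simp: H0_def)
  show ?thesis
    unfolding Let_def ideal_ge_eq irrelevant_ideal_eq H0
    using quot_module_smult[OF L ge_carrier] by auto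
qed

end

context noetherian_graded_p
begin

lemma homogeneous_frob: "homogeneous_ideal R G I \<Longrightarrow> homogeneous_ideal R G (frob_power R I (p ^ f))"
  by (rule homogeneous_frob_power[OF cring_char_p_axioms])

lemma satisfies_LC_iff:
  "satisfies_LC R G p I \<longleftrightarrow> homogeneous_ideal R G I \<and> (\<exists>N. \<forall>e. \<forall>r\<in>ge (N * p ^ e). \<forall>x\<in>carrier R.
    torsion (frob_power R I (p ^ e)) x \<longrightarrow> r \<otimes> x \<in> frob_power R I (p ^ e))"
proof (cases "homogeneous_ideal R G I")
  case True
  have "ideal (frob_power R I (p ^ e)) R" for e
    by (rule homogeneous_ideal[OF homogeneous_frob[OF True]])
  note this[THEN annihilates_H0_iff]
  then show ?thesis unfolding satisfies_LC_def by (simp only:)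
qed (simp add: satisfies_LC_def)

lemma satisfies_LC_star_iff:
  "satisfies_LC_star R G p I \<longleftrightarrow> homogeneous_ideal R G I \<and> (\<exists>N. \<forall>e. \<forall>r\<in>ge (N * p ^ e). \<forall>x\<in>carrier R.
    torsion (tight_closure R p (frob_power R I (p ^ e))) x \<longrightarrow> r \<otimes> x \<in> tight_closure R p (frob_power R I (p ^ e)))"
proof (cases "homogeneous_ideal R G I")
  case True
  have "ideal (tight_closure R p (frob_power R I (p ^ e))) R" for e
    by (rule tight_closure_ideal[OF ideal_props(1)[OF homogeneous_ideal[OF homogeneous_frob[OF True]]]])
  note this[THEN annihilates_H0_iff]
  then show ?thesis unfolding satisfies_LC_star_def by (simp only:)
qed (simp add: satisfies_LC_star_def)

text \<open>The product of finitely many multipliers serves all elements. Because of this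
  finiteness, torsion modulo a tight closure is exploited only through powers of z and the elements
  \<open>w g\<close>.\<close>

lemma tight_closure_uniform:
  assumes "finite F" "F \<subseteq> tight_closure R p L" "ideal L R"
  shows "\<exists>c\<in>ring_circ R. \<exists>e. \<forall>x\<in>F. \<forall>f\<ge>e. c \<otimes> x [^] (p ^ f) \<in> frob_power R L (p ^ f)"
  using assms(1,2)
proof (induction F)
  case empty
  then show ?case using one_ring_circ by auto
next
  case (insert x F)
  then obtain c e where c: "c \<in> ring_circ R" "\<And>x f. x \<in> F \<Longrightarrow> f \<ge> e \<Longrightarrow> c \<otimes> x [^] (p ^ f) \<in> frob_power R L (p ^ f)"
    by auto
  obtain d e' where d: "d \<in> ring_circ R" "\<And>f. f \<ge> e' \<Longrightarrow> d \<otimes> x [^] (p ^ f) \<in> frob_power R L (p ^ f)"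
    using insert.prems by (auto simp: tight_closure_def)
  note cc = ring_circ_carrier[OF c(1)] ring_circ_carrier[OF d(1)]
  note D = ideal_props[OF frob_power_ideal[OF ideal_props(1)[OF assms(3)]]]
  have tc: "y \<in> carrier R" if "y \<in> tight_closure R p L" for y using that by (simp add: tight_closure_def)
  have "(c \<otimes> d) \<otimes> y [^] (p ^ f) \<in> frob_power R L (p ^ f)" if y: "y \<in> insert x F" and f: "f \<ge> max e e'" for y f
  proof (cases "y = x")
    case True
    then have "(c \<otimes> d) \<otimes> y [^] (p ^ f) = c \<otimes> (d \<otimes> x [^] (p ^ f))"
      using cc tc insert.prems by (simp add: m_assoc)
    then show ?thesis using D(6)[OF d(2) cc(1)] f by simp
  next
    case False
    then have "y \<in> F" using y by simp
    moreover have "(c \<otimes> d) \<otimes> y [^] (p ^ f) = d \<otimes> (c \<otimes> y [^] (p ^ f))"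
      using cc tc[of y] insert.prems y by (auto simp: m_ac)
    ultimately show ?thesis using D(6)[OF c(2) cc(2)] f by simp
  qed
  then show ?case using ring_circ_mult[OF c(1) d(1)] by blast
qed

end

text \<open>The data produced by the height hypothesis: modulo \<open>A = J : y\<close> the form \<open>z\<close> generates an
  ideal primary to the irrelevant ideal; \<open>w g\<close> is the component in \<open>A\<close> of a fixed power of \<open>g\<close>.\<close>

locale lc_step = noetherian_graded_p R G p for R (structure) and G and p +
  fixes J I :: "'a set" and y z :: 'a and e n h C :: nat and \<Gamma> :: "('a \<times> nat) set"
    and w \<alpha> :: "'a \<Rightarrow> 'a"
  assumes hJ: "homogeneous_ideal R G J" and y: "y \<in> G e" and I: "I = J <+>\<^bsub>R\<^esub> (PIdl y)"
    and z: "1 \<le> n" "z \<in> G n" and \<Gamma>: "irrelevant_gens \<Gamma> C"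
    and w: "\<And>g k. (g, k) \<in> \<Gamma> \<Longrightarrow> w g \<in> colon_elem R J y"
    and \<alpha>: "\<And>g k. (g, k) \<in> \<Gamma> \<Longrightarrow> \<alpha> g \<in> carrier R"
    and gpow: "\<And>g k. (g, k) \<in> \<Gamma> \<Longrightarrow> g [^] (p ^ h) = w g \<oplus> \<alpha> g \<otimes> z"
begin

text \<open>The bound of \<open>ge_le_power_ideal\<close> for the exponent p^h. For the exponent
  p^(h + f) the bound is at most p^f times as large, so \<open>c0 * p ^ f\<close> serves every
  f.\<close>

definition c0 :: nat where "c0 = C * (card \<Gamma> * p ^ h) + 1"

lemma carr: "y \<in> carrier R" "z \<in> carrier R" "ideal J R" "J \<subseteq> carrier R" "ideal I R" "I \<subseteq> carrier R"
  "ideal (colon_elem R J y) R" "colon_elem R J y \<subseteq> carrier R" "J \<subseteq> I" "y \<in> I"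
  "homogeneous_ideal R G I"
proof -
  show yz: "y \<in> carrier R" "z \<in> carrier R" using grade_carrier y z by auto
  show J: "ideal J R" "J \<subseteq> carrier R" using homogeneous_ideal[OF hJ] ideal_props(1) by auto
  show "ideal I R" "J \<subseteq> I" "y \<in> I" unfolding I using add_principal[OF J(1) yz(1)] by auto
  then show "I \<subseteq> carrier R" using ideal_props(1) by auto
  show "ideal (colon_elem R J y) R" using colon_ideal[OF J(1) yz(1)] .
  then show "colon_elem R J y \<subseteq> carrier R" using ideal_props(1) by auto
  show "homogeneous_ideal R G I" unfolding I by (rule homogeneous_add[OF hJ homogeneous_principal[OF y]])
qed

lemma frob_props:
  "ideal (frob_power R J q) R" "ideal (frob_power R I q) R" "frob_power R J q \<subseteq> frob_power R I q"
  "y [^] q \<in> frob_power R I q" "ideal (frob_power R (colon_elem R J y) q) R"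
  using frob_power_ideal carr(4,6,8) frob_power_mono[OF carr(9,6)] frob_power_mem[OF carr(6,10)] by blast+

lemma w_carrier: "(g, k) \<in> \<Gamma> \<Longrightarrow> w g \<in> carrier R"
  using w carr(8) by blast

text \<open>Both g^(p^h) and \<open>\<alpha> g\<close> times z lie in the irrelevant ideal, hence so
  does their difference. Thus powers of \<open>w g\<close> may be used on torsion elements.\<close>

lemma w_ge: "(g, k) \<in> \<Gamma> \<Longrightarrow> w g \<in> ge 1"
proof -
  assume g: "(g, k) \<in> \<Gamma>"
  have "z \<in> ge 1" using form_ge[OF z(2,1)] .
  moreover have "g [^] (p ^ h) \<in> ge 1"
    by (rule ideal_pow_closed[OF ge_ideal irrelevant_gensD(6)[OF \<Gamma> g]]) simp
  ultimately have "g [^] (p ^ h) \<ominus> \<alpha> g \<otimes> z \<in> ge 1"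
    using \<alpha>[OF g] ideal_props(5,6)[OF ge_ideal] by blast
  moreover have "g [^] (p ^ h) \<ominus> \<alpha> g \<otimes> z = w g"
    unfolding gpow[OF g] using w_carrier[OF g] \<alpha>[OF g] carr(2) by algebra
  ultimately show ?thesis by simp
qed

lemma gpow_pow:
  assumes "(g, k) \<in> \<Gamma>"
  shows "g [^] (p ^ (h + f)) = w g [^] (p ^ f) \<oplus> \<alpha> g [^] (p ^ f) \<otimes> z [^] (p ^ f)"
proof -
  have "g [^] (p ^ (h + f)) = (g [^] (p ^ h)) [^] (p ^ f)"
    using irrelevant_gensD(5)[OF \<Gamma> assms] by (simp add: pow_pow)
  then show ?thesis
    unfolding gpow[OF assms] using w_carrier[OF assms] \<alpha>[OF assms] carr(2)
    by (simp add: frob_add nat_pow_distrib)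
qed

text \<open>The f-th Frobenius power of \<open>gpow\<close> puts the p^(h + f)-th power of every
  generator into A^[q] + z^q R, where A = J : y and q = p^f. Hence everything of degree at least
  \<open>c0 * p ^ f\<close> lies there.\<close>

lemma ge_division_once:
  assumes "a \<in> ge (c0 * p ^ f)"
  shows "\<exists>v\<in>frob_power R (colon_elem R J y) (p ^ f). \<exists>b\<in>carrier R. a = v \<oplus> b \<otimes> z [^] (p ^ f)"
proof -
  let ?A = "frob_power R (colon_elem R J y) (p ^ f)"
  have zc: "z [^] (p ^ f) \<in> carrier R" using carr(2) by simp
  note S = add_principal[OF frob_props(5)[of "p ^ f"] zc]
  have "g [^] (p ^ h * p ^ f) \<in> ?A <+>\<^bsub>R\<^esub> (PIdl (z [^] (p ^ f)))" if g: "(g, k) \<in> \<Gamma>" for g k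
  proof -
    have "\<alpha> g [^] (p ^ f) \<in> carrier R" using \<alpha>[OF g] by simp
    then show ?thesis
      using gpow_pow[OF g, of f] frob_power_mem[OF carr(8) w[OF g], of "p ^ f"]
      unfolding S(4) power_add by blast
  qed
  then have "ge (C * (card \<Gamma> * (p ^ h * p ^ f)) + 1) \<subseteq> ?A <+>\<^bsub>R\<^esub> (PIdl (z [^] (p ^ f)))"
    by (rule ge_le_power_ideal[OF \<Gamma> S(1)])
  moreover have "C * (card \<Gamma> * (p ^ h * p ^ f)) + 1 \<le> c0 * p ^ f"
    using p_gt_0 by (simp add: c0_def algebra_simps Suc_le_eq)
  ultimately have "a \<in> ?A <+>\<^bsub>R\<^esub> (PIdl (z [^] (p ^ f)))"
    using assms ge_mono by blast
  then show ?thesis unfolding S(4) .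
qed

text \<open>Every further division by z^q costs only the degree q n of z^q, because the quotient can
  be truncated to the degree it ought to have. The surplus c0 q is required once, however large i
  is.\<close>

lemma ge_division:
  assumes "a \<in> ge (c0 * p ^ f + i * p ^ f * n)"
  shows "\<exists>v\<in>frob_power R (colon_elem R J y) (p ^ f). \<exists>b\<in>carrier R. a = v \<oplus> b \<otimes> z [^] (Suc i * p ^ f)"
  using assms
proof (induction i arbitrary: a)
  case 0
  then show ?case using ge_division_once[of a f] by simp
next
  case (Suc i)
  let ?A = "frob_power R (colon_elem R J y) (p ^ f)" and ?q = "p ^ f"
  let ?M = "c0 * ?q + Suc i * ?q * n"
  have hA: "homogeneous_ideal R G ?A" by (rule homogeneous_frob[OF homogeneous_colon[OF hJ y]])
  note DA = ideal_props[OF frob_props(5)[of ?q]]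
  have zq: "z [^] k \<in> carrier R" for k :: nat using carr(2) by simp
  have "a \<in> ge (c0 * ?q)" using Suc.prems ge_mono[of "c0 * ?q" ?M] by auto
  then obtain v b where vb: "v \<in> ?A" "b \<in> carrier R" "a = v \<oplus> b \<otimes> z [^] ?q"
    using ge_division_once by blast
  have zG: "z [^] ?q \<in> G (?q * n)" by (rule form_pow[OF z(2)])
  have M: "?M - ?q * n = c0 * ?q + i * ?q * n" by (simp add: algebra_simps)
  \<comment> \<open>Truncate the whole equation at the degree bound of a: v stays in the homogeneous
    ideal, and the quotient acquires the degree that the induction hypothesis needs.\<close>
  have "a = trunc ?M a" using trunc_id[OF Suc.prems] by simp
  also have "\<dots> = trunc ?M v \<oplus> trunc (?M - ?q * n) b \<otimes> z [^] ?q"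
    unfolding vb(3) trunc_mult_form[OF vb(2) zG, symmetric]
    using vb(2) DA(2)[OF vb(1)] zq by (intro trunc_add) auto
  finally have a: "a = trunc ?M v \<oplus> trunc (c0 * ?q + i * ?q * n) b \<otimes> z [^] ?q"
    unfolding M .
  obtain v' b' where vb': "v' \<in> ?A" "b' \<in> carrier R"
    "trunc (c0 * ?q + i * ?q * n) b = v' \<oplus> b' \<otimes> z [^] (Suc i * ?q)"
    using Suc.IH[OF trunc_ge[OF vb(2)]] by blast
  have tv: "trunc ?M v \<in> ?A" by (rule homogeneous_trunc[OF hA vb(1)])
  have cc: "trunc ?M v \<in> carrier R" "v' \<in> carrier R" "z [^] ?q \<in> carrier R" "z [^] (Suc i * ?q) \<in> carrier R"
    by (rule DA(2)[OF tv], rule DA(2)[OF vb'(1)], rule zq, rule zq)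
  have "a = (trunc ?M v \<oplus> v' \<otimes> z [^] ?q) \<oplus> b' \<otimes> (z [^] (Suc i * ?q) \<otimes> z [^] ?q)"
    unfolding a vb'(3) using cc vb'(2) by algebra
  also have "z [^] (Suc i * ?q) \<otimes> z [^] ?q = z [^] (Suc (Suc i) * ?q)"
    using carr(2) by (simp add: nat_pow_mult add.commute)
  finally show ?case using DA(4)[OF tv DA(7)[OF vb'(1) cc(3)]] vb'(2) by blast
qed

text \<open>Writing \<open>z\<^sup>k U = j + a y\<^sup>Q\<close>, the degree bound lets us divide \<open>a\<close> by \<open>z\<^sup>k\<close> modulo
  \<open>A\<^bsup>[Q]\<^esup>\<close>, which multiplies \<open>y\<^sup>Q\<close> into \<open>J\<^bsup>[Q]\<^esup>\<close>.\<close>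

lemma correction:
  assumes U: "U \<in> ge ((c0 + e) * p ^ f)"
    and zU: "z [^] (k::nat) \<otimes> U \<in> frob_power R I (p ^ f)"
    and wU: "\<And>g m. (g, m) \<in> \<Gamma> \<Longrightarrow> w g [^] k \<otimes> U \<in> frob_power R I (p ^ f)"
  shows "\<exists>b\<in>carrier R. torsion (frob_power R J (p ^ f)) (U \<ominus> b \<otimes> y [^] (p ^ f))"
proof -
  let ?q = "p ^ f"
  let ?J = "frob_power R J ?q" and ?I = "frob_power R I ?q"
  note DJ = ideal_props[OF frob_props(1)[of ?q]] and DI = ideal_props[OF frob_props(2)[of ?q]]
  have hJq: "homogeneous_ideal R G ?J" by (rule homogeneous_frob[OF hJ])
  have Uc: "U \<in> carrier R" by (rule ge_carrier[OF U])
  have yG: "y [^] ?q \<in> G (?q * e)" by (rule form_pow[OF y])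
  have yc: "y [^] ?q \<in> carrier R" using carr(1) by simp
  \<comment> \<open>The exponent k is rounded up to a multiple of q, since
    \<open>ge_division\<close> divides by powers of z^q.\<close>
  define K where "K = Suc k * ?q"
  have kK: "k \<le> K" unfolding K_def by (metis Suc_leD Suc_leI le_trans mult.right_neutral mult_le_mono2 p_gt_0 zero_less_power lessI less_imp_le_nat One_nat_def)
  have zc: "z [^] (m::nat) \<in> carrier R" for m using carr(2) by simp
  have "z [^] (K - k) \<otimes> (z [^] k \<otimes> U) \<in> ?I" by (rule DI(6)[OF zU zc])
  moreover have "z [^] (K - k) \<otimes> (z [^] k \<otimes> U) = z [^] K \<otimes> U"
    using kK carr(2) Uc by (simp add: nat_pow_mult flip: m_assoc)
  ultimately have "z [^] K \<otimes> U \<in> ?I" by simp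
  then obtain j a where ja: "j \<in> ?J" "a \<in> carrier R" "z [^] K \<otimes> U = j \<oplus> a \<otimes> y [^] ?q"
    using frob_power_sum[OF carr(3,1) I] by blast
  \<comment> \<open>A lower bound for the degrees in z^K U. After y^q is split off, at least c0 q +
    K n remains, which is enough to divide by z^K.\<close>
  define M where "M = K * n + (c0 + e) * ?q"
  have "z [^] K \<otimes> U \<in> ge M"
    unfolding M_def by (intro ge_mult U form_ge[OF form_pow[OF z(2)]]) simp
  then have "z [^] K \<otimes> U = trunc M (j \<oplus> a \<otimes> y [^] ?q)" using trunc_id ja(3) by simp
  also have "\<dots> = trunc M j \<oplus> trunc (M - ?q * e) a \<otimes> y [^] ?q"
    using ja DJ(2)[OF ja(1)] yc trunc_mult_form[OF ja(2) yG] by (simp add: trunc_add)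
  finally have zKU: "z [^] K \<otimes> U = trunc M j \<oplus> trunc (M - ?q * e) a \<otimes> y [^] ?q" .
  have "c0 * ?q + k * ?q * n \<le> M - ?q * e" by (simp add: M_def K_def algebra_simps)
  then have "trunc (M - ?q * e) a \<in> ge (c0 * ?q + k * ?q * n)"
    using trunc_ge[OF ja(2)] ge_mono by blast
  then obtain v b where vb: "v \<in> frob_power R (colon_elem R J y) ?q" "b \<in> carrier R"
    "trunc (M - ?q * e) a = v \<oplus> b \<otimes> z [^] K"
    using ge_division unfolding K_def by blast
  have vy: "v \<otimes> y [^] ?q \<in> ?J" by (rule colon_frob_power[OF carr(3,1) vb(1)])
  have tj: "trunc M j \<in> ?J" by (rule homogeneous_trunc[OF hJq ja(1)])
  have vc: "v \<in> carrier R" using ideal_props(2)[OF frob_props(5) vb(1)] .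
  define V where "V = U \<ominus> b \<otimes> y [^] ?q"
  have Vc: "V \<in> carrier R" using Uc vb(2) yc by (simp add: V_def)
  have zV: "z [^] K \<otimes> V \<in> ?J"
  proof -
    have cc: "trunc M j \<in> carrier R" "z [^] K \<in> carrier R" using DJ(2)[OF tj] zc by auto
    have "z [^] K \<otimes> V = z [^] K \<otimes> U \<ominus> b \<otimes> z [^] K \<otimes> y [^] ?q"
      unfolding V_def using cc(2) Uc vb(2) yc by algebra
    also have "\<dots> = trunc M j \<oplus> v \<otimes> y [^] ?q"
      unfolding zKU vb(3) using cc vc vb(2) yc by algebra
    finally show ?thesis using DJ(4)[OF tj vy] by simp
  qed
  \<comment> \<open>Since \<open>w g\<close> lies in J : y, its q-th power times y^q is in J^[q].
    The extra exponent q therefore removes both the y^q-part of (w g)^k U and the correction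
    term.\<close>
  have wV: "w g [^] (?q + k) \<otimes> V \<in> ?J" if g: "(g, m) \<in> \<Gamma>" for g m
  proof -
    have wc: "w g \<in> carrier R" "w g [^] ?q \<in> carrier R" "w g [^] k \<in> carrier R" using w_carrier[OF g] by auto
    have wy: "w g [^] ?q \<otimes> y [^] ?q \<in> ?J"
      by (rule colon_frob_power[OF carr(3,1) frob_power_mem[OF carr(8) w[OF g]]])
    obtain i c where ic: "i \<in> ?J" "c \<in> carrier R" "w g [^] k \<otimes> U = i \<oplus> c \<otimes> y [^] ?q"
      using frob_power_sum[OF carr(3,1) I wU[OF g]] by blast
    have ic': "i \<in> carrier R" using DJ(2) ic(1) by auto
    have "w g [^] (?q + k) \<otimes> V = w g [^] ?q \<otimes> (w g [^] k \<otimes> U) \<ominus> (w g [^] k \<otimes> b) \<otimes> (w g [^] ?q \<otimes> y [^] ?q)"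
    proof -
      have "w g [^] (?q + k) = w g [^] ?q \<otimes> w g [^] k" using wc(1) by (simp add: nat_pow_mult)
      then show ?thesis unfolding V_def using wc(2,3) Uc vb(2) yc by algebra
    qed
    also have "\<dots> = w g [^] ?q \<otimes> i \<oplus> c \<otimes> (w g [^] ?q \<otimes> y [^] ?q) \<ominus> (w g [^] k \<otimes> b) \<otimes> (w g [^] ?q \<otimes> y [^] ?q)"
      unfolding ic(3) using wc(2,3) ic' ic(2) vb(2) yc by algebra
    also have "\<dots> \<in> ?J"
    proof (intro DJ(5) DJ(4))
      show "w g [^] ?q \<otimes> i \<in> ?J" by (rule DJ(6)[OF ic(1) wc(2)])
      show "c \<otimes> (w g [^] ?q \<otimes> y [^] ?q) \<in> ?J" by (rule DJ(6)[OF wy ic(2)])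
      show "(w g [^] k \<otimes> b) \<otimes> (w g [^] ?q \<otimes> y [^] ?q) \<in> ?J"
        by (rule DJ(6)[OF wy m_closed[OF wc(3) vb(2)]])
    qed
    finally show ?thesis .
  qed
  define s where "s = max K (?q + k)"
  have pow_mono: "x [^] (p ^ s) \<otimes> V \<in> ?J" if x: "x \<in> carrier R" "x [^] m \<otimes> V \<in> ?J" "m \<le> s" for x and m :: nat
  proof -
    have "m \<le> p ^ s" using x(3) le_p_pow order_trans by blast
    then have "x [^] (p ^ s) \<otimes> V = x [^] (p ^ s - m) \<otimes> (x [^] m \<otimes> V)"
      using x(1) Vc by (simp add: nat_pow_mult flip: m_assoc)
    then show ?thesis using DJ(6)[OF x(2)] x(1) by simp
  qed
  \<comment> \<open>A Frobenius power of \<open>gpow\<close> writes a power of g through powers of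
    \<open>w g\<close> and z, each of which carries V into J^[q].\<close>
  have "g [^] (p ^ (h + s)) \<in> colon_elem R ?J V" if g: "(g, m) \<in> \<Gamma>" for g m
  proof -
    have gc: "g \<in> carrier R" by (rule irrelevant_gensD(5)[OF \<Gamma> g])
    have cc: "w g [^] (p ^ s) \<in> carrier R" "\<alpha> g [^] (p ^ s) \<in> carrier R" "z [^] (p ^ s) \<in> carrier R"
      using w_carrier[OF g] \<alpha>[OF g] zc by auto
    have "w g [^] (p ^ s) \<otimes> V \<in> ?J"
      by (rule pow_mono[OF w_carrier[OF g] wV[OF g]]) (simp add: s_def)
    moreover have "z [^] (p ^ s) \<otimes> V \<in> ?J"
      by (rule pow_mono[OF carr(2) zV]) (simp add: s_def)
    ultimately have "w g [^] (p ^ s) \<otimes> V \<oplus> \<alpha> g [^] (p ^ s) \<otimes> (z [^] (p ^ s) \<otimes> V) \<in> ?J"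
      using DJ(4)[OF _ DJ(6)[OF _ cc(2)]] by blast
    moreover have "w g [^] (p ^ s) \<otimes> V \<oplus> \<alpha> g [^] (p ^ s) \<otimes> (z [^] (p ^ s) \<otimes> V) =
        (w g [^] (p ^ s) \<oplus> \<alpha> g [^] (p ^ s) \<otimes> z [^] (p ^ s)) \<otimes> V"
      using cc Vc by algebra
    ultimately show ?thesis unfolding colon_elem_def gpow_pow[OF g] using cc by simp
  qed
  then have "ge (C * (card \<Gamma> * p ^ (h + s)) + 1) \<subseteq> colon_elem R ?J V"
    by (rule ge_le_power_ideal[OF \<Gamma> colon_ideal[OF frob_props(1) Vc]])
  then have "torsion ?J V"
    by (intro torsion_if_ge) (auto simp: colon_elem_def)
  then show ?thesis using vb(2) unfolding V_def by blast
qed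

text \<open>Elements of large degree are sums of products s t. The factor s lifts x to the degrees
  where \<open>correction\<close> applies, and t is left for the condition on J.\<close>

lemma torsion_split:
  assumes L: "ideal L R" "torsion L x" "x \<in> carrier R"
    and main: "\<And>U t. U \<in> ge ((c0 + e) * p ^ f) \<Longrightarrow> torsion L U \<Longrightarrow> t \<in> ge (N * p ^ f) \<Longrightarrow> t \<otimes> U \<in> L"
    and r: "r \<in> ge ((c0 + e + N + C) * p ^ f)"
  shows "r \<otimes> x \<in> L"
proof -
  have "ge ((c0 + e) * p ^ f + N * p ^ f + C) \<subseteq> colon_elem R L x"
  proof (rule ge_split[OF \<Gamma> colon_ideal[OF L(1,3)]])
    fix s t assume s: "s \<in> ge ((c0 + e) * p ^ f)" and t: "t \<in> ge (N * p ^ f)"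
    note c = ge_carrier[OF s] ge_carrier[OF t]
    have "s \<otimes> x \<in> ge ((c0 + e) * p ^ f)" using ge_mult[OF s, of x 0] L(3) ge_0 by simp
    then have "t \<otimes> (s \<otimes> x) \<in> L" using main t torsion_mult[OF L c(1)] by blast
    then show "s \<otimes> t \<in> colon_elem R L x" using c L(3) by (simp add: colon_elem_def m_ac)
  qed
  moreover have "(c0 + e) * p ^ f + N * p ^ f + C \<le> (c0 + e + N + C) * p ^ f"
    using p_gt_0 by (simp add: algebra_simps Suc_le_eq)
  ultimately have "r \<in> colon_elem R L x" using r ge_mono by blast
  then show ?thesis by (simp add: colon_elem_def)
qed

text \<open>The condition on J handles U - b y^q, and the term subtracted lies in I^[q]
  anyway.\<close>

lemma LC_step:
  assumes "satisfies_LC R G p J" shows "satisfies_LC R G p I"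
proof -
  obtain N where N: "\<And>f r x. r \<in> ge (N * p ^ f) \<Longrightarrow> x \<in> carrier R \<Longrightarrow>
      torsion (frob_power R J (p ^ f)) x \<Longrightarrow> r \<otimes> x \<in> frob_power R J (p ^ f)"
    using assms unfolding satisfies_LC_iff by blast
  have "r \<otimes> x \<in> frob_power R I (p ^ f)"
    if r: "r \<in> ge ((c0 + e + N + C) * p ^ f)" and x: "x \<in> carrier R" "torsion (frob_power R I (p ^ f)) x" for r x f
  proof (rule torsion_split[OF frob_props(2) x(2,1) _ r])
    let ?q = "p ^ f"
    note DI = ideal_props[OF frob_props(2)[of ?q]]
    fix U t assume U: "U \<in> ge ((c0 + e) * ?q)" "torsion (frob_power R I ?q) U" and t: "t \<in> ge (N * ?q)"
    have Uc: "U \<in> carrier R" and tc: "t \<in> carrier R" using U t ge_carrier by auto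
    obtain k :: nat where k: "\<forall>v\<in>ge 1. v [^] k \<otimes> U \<in> frob_power R I ?q" using torsion_pow[OF U(2)] by auto
    have "z [^] k \<otimes> U \<in> frob_power R I ?q" using k form_ge[OF z(2,1)] by blast
    then obtain b where b: "b \<in> carrier R" "torsion (frob_power R J ?q) (U \<ominus> b \<otimes> y [^] ?q)"
      using correction[OF U(1)] k w_ge by blast
    have yc: "y [^] ?q \<in> carrier R" using carr(1) by simp
    have "t \<otimes> (U \<ominus> b \<otimes> y [^] ?q) \<in> frob_power R I ?q"
      using N[OF t _ b(2)] Uc b(1) yc frob_props(3) by blast
    then have "t \<otimes> (U \<ominus> b \<otimes> y [^] ?q) \<oplus> (t \<otimes> b) \<otimes> y [^] ?q \<in> frob_power R I ?q"
      using DI(4) DI(6)[OF frob_props(4) m_closed[OF tc b(1)]] by blast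
    moreover have "t \<otimes> (U \<ominus> b \<otimes> y [^] ?q) \<oplus> (t \<otimes> b) \<otimes> y [^] ?q = t \<otimes> U"
      using tc Uc b(1) yc by algebra
    ultimately show "t \<otimes> U \<in> frob_power R I ?q" by simp
  qed
  then show ?thesis unfolding satisfies_LC_iff using carr(11) by blast
qed

text \<open>No uniform multiplier is available for the memberships in \<open>(J\<^bsup>[qq']\<^esup>)\<^sup>*\<close> as \<open>q'\<close> varies; the weak
  test element \<open>c\<^sub>1\<close> provides one.\<close>

lemma LC_star_step:
  assumes "satisfies_LC_star R G p J" shows "satisfies_LC_star R G p I"
proof -
  let ?T = "tight_closure R p"
  obtain N where N: "\<And>f r x. r \<in> ge (N * p ^ f) \<Longrightarrow> x \<in> carrier R \<Longrightarrow>
      torsion (?T (frob_power R J (p ^ f))) x \<Longrightarrow> r \<otimes> x \<in> ?T (frob_power R J (p ^ f))"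
    using assms unfolding satisfies_LC_star_iff by blast
  obtain c1 f0 where c1: "c1 \<in> ring_circ R"
    and test: "\<And>I x. ideal I R \<Longrightarrow> x \<in> ?T I \<Longrightarrow> c1 \<otimes> x [^] (p ^ f0) \<in> frob_power R I (p ^ f0)"
    using weak_test_element by blast
  have Fc: "frob_power R J q \<subseteq> carrier R" "frob_power R I q \<subseteq> carrier R" for q
    using ideal_props(1)[OF frob_props(1)] ideal_props(1)[OF frob_props(2)] by auto
  have "r \<otimes> x \<in> ?T (frob_power R I (p ^ f))"
    if r: "r \<in> ge ((c0 + e + N + C) * p ^ f)" and x: "x \<in> carrier R" "torsion (?T (frob_power R I (p ^ f))) x" for r x f
  proof (rule torsion_split[OF tight_closure_ideal[OF Fc(2)] x(2,1) _ r])
    let ?q = "p ^ f"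
    let ?I = "frob_power R I ?q"
    fix U t assume U: "U \<in> ge ((c0 + e) * ?q)" "torsion (?T ?I) U" and t: "t \<in> ge (N * ?q)"
    have Uc: "U \<in> carrier R" and tc: "t \<in> carrier R" using U t ge_carrier by auto
    obtain k :: nat where k: "\<forall>v\<in>ge 1. v [^] k \<otimes> U \<in> ?T ?I" using torsion_pow[OF U(2)] by auto
    \<comment> \<open>\<open>correction\<close> looks only at these finitely many elements, so one
      multiplier c covers all of them and all large q'.\<close>
    define W where "W = insert z (w ` fst ` \<Gamma>)"
    have W: "finite W" "v \<in> ge 1" if "v \<in> W" for v
      using that irrelevant_gensD(1)[OF \<Gamma>] form_ge[OF z(2,1)] w_ge by (auto simp: W_def)
    have zW: "z \<in> W" and wW: "\<And>g m. (g, m) \<in> \<Gamma> \<Longrightarrow> w g \<in> W" by (auto simp: W_def image_iff Bex_def intro: prod.collapse) 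
    have "(\<lambda>v. v [^] k \<otimes> U) ` W \<subseteq> ?T ?I" using k W(2) by auto
    then obtain c e0 where c: "c \<in> ring_circ R"
      and ce: "\<forall>x\<in>(\<lambda>v. v [^] k \<otimes> U) ` W. \<forall>g\<ge>e0. c \<otimes> x [^] (p ^ g) \<in> frob_power R ?I (p ^ g)"
      using tight_closure_uniform[OF finite_imageI[OF W(1)[OF zW]] _ frob_props(2)] by blast
    note cc = ring_circ_carrier[OF c] ring_circ_carrier[OF c1]
    \<comment> \<open>The factor c of V below is raised to the power p^f0 by the test, and c1 comes
      from the test itself; neither depends on g.\<close>
    define d where "d = c1 \<otimes> c [^] (p ^ f0)"
    have d: "d \<in> ring_circ R" unfolding d_def by (intro ring_circ_mult ring_circ_pow c c1)
    have "d \<otimes> (t \<otimes> U) [^] (p ^ (g + f0)) \<in> frob_power R ?I (p ^ (g + f0))" if g: "e0 \<le> g" for g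
    proof -
      let ?Q = "p ^ (f + g)" and ?Q' = "p ^ (f + g + f0)"
      have IQ: "frob_power R ?I (p ^ j) = frob_power R I (p ^ (f + j))" for j
        by (rule frob_power_frob_power[OF carr(6)])
      \<comment> \<open>This takes the place of U: powers of z and the \<open>w g\<close> carry it
        into I^[qq'] itself, with q' = p^g, so \<open>correction\<close> applies at exponent f +
        g.\<close>
      define V where "V = c \<otimes> U [^] (p ^ g)"
      have Vc: "V \<in> carrier R" using cc Uc by (simp add: V_def)
      have V: "V \<in> ge ((c0 + e) * ?Q)"
        using ge_mult[of c 0 "U [^] (p ^ g)"] ge_pow[OF U(1), of "p ^ g"] cc(1) ge_0
        by (simp add: V_def power_add mult_ac)
      have vV: "v [^] (k * p ^ g) \<otimes> V \<in> frob_power R I ?Q" if v: "v \<in> W" for v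
      proof -
        have vc: "v \<in> carrier R" using ge_carrier[OF W(2)[OF v]] .
        have "v [^] (k * p ^ g) \<otimes> V = c \<otimes> (v [^] k \<otimes> U) [^] (p ^ g)"
          using vc cc Uc by (simp add: V_def nat_pow_distrib nat_pow_pow m_lcomm)
        then show ?thesis using ce v g by (simp add: IQ)
      qed
      have "\<exists>b\<in>carrier R. torsion (frob_power R J ?Q) (V \<ominus> b \<otimes> y [^] ?Q)"
        by (rule correction[OF V vV[OF zW] vV[OF wW]])
      then obtain b where b: "b \<in> carrier R" "torsion (frob_power R J ?Q) (V \<ominus> b \<otimes> y [^] ?Q)"
        by (rule bexE)
      have yc: "y [^] j \<in> carrier R" for j :: nat using carr(1) by simp
      define X where "X = V \<ominus> b \<otimes> y [^] ?Q"
      have Xc: "X \<in> carrier R" using Vc b(1) yc by (simp add: X_def)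
      have "torsion (?T (frob_power R J ?Q)) X"
        unfolding X_def by (rule torsion_mono[OF b(2) tight_closure_superset[OF Fc(1)]])
      \<comment> \<open>The condition on J is used at exponent f + g with the same N; t^(q') has
        just the degree required there.\<close>
      moreover have "t [^] (p ^ g) \<in> ge (N * ?Q)"
        using ge_pow[OF t, of "p ^ g"] by (simp add: power_add mult_ac)
      ultimately have "t [^] (p ^ g) \<otimes> X \<in> ?T (frob_power R J ?Q)" using N Xc by blast
      then have "c1 \<otimes> (t [^] (p ^ g) \<otimes> X) [^] (p ^ f0) \<in> frob_power R (frob_power R J ?Q) (p ^ f0)"
        by (rule test[OF frob_props(1)])
      then have mem: "c1 \<otimes> (t [^] (p ^ g) \<otimes> X) [^] (p ^ f0) \<in> frob_power R I ?Q'"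
        unfolding frob_power_frob_power[OF carr(4)] by (rule subsetD[OF frob_props(3)])
      have pc: "t [^] (p ^ (g + f0)) \<in> carrier R" "U [^] (p ^ (g + f0)) \<in> carrier R"
        "c [^] (p ^ f0) \<in> carrier R" "b [^] (p ^ f0) \<in> carrier R" "y [^] ?Q' \<in> carrier R"
        using tc Uc cc b(1) yc by auto
      have "X [^] (p ^ f0) = c [^] (p ^ f0) \<otimes> U [^] (p ^ (g + f0)) \<ominus> b [^] (p ^ f0) \<otimes> y [^] ?Q'"
        unfolding X_def V_def using cc(1) Uc b(1) yc carr(1) by (simp add: frob_diff nat_pow_distrib pow_pow)
      then have X: "(t [^] (p ^ g) \<otimes> X) [^] (p ^ f0) =
          t [^] (p ^ (g + f0)) \<otimes> (c [^] (p ^ f0) \<otimes> U [^] (p ^ (g + f0)) \<ominus> b [^] (p ^ f0) \<otimes> y [^] ?Q')"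
        using tc Xc by (simp add: nat_pow_distrib pow_pow)
      have "d \<otimes> (t \<otimes> U) [^] (p ^ (g + f0)) =
          c1 \<otimes> (t [^] (p ^ g) \<otimes> X) [^] (p ^ f0) \<oplus> (c1 \<otimes> t [^] (p ^ (g + f0)) \<otimes> b [^] (p ^ f0)) \<otimes> y [^] ?Q'"
      proof -
        have "(t \<otimes> U) [^] (p ^ (g + f0)) = t [^] (p ^ (g + f0)) \<otimes> U [^] (p ^ (g + f0))"
          using tc Uc by (simp add: nat_pow_distrib)
        then show ?thesis unfolding X d_def using pc cc(2) by algebra
      qed
      moreover have "(c1 \<otimes> t [^] (p ^ (g + f0)) \<otimes> b [^] (p ^ f0)) \<otimes> y [^] ?Q' \<in> frob_power R I ?Q'"
        using pc cc by (intro ideal_props(6)[OF frob_props(2)] frob_props(4)) auto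
      ultimately show ?thesis
        using ideal_props(4)[OF frob_props(2)] mem by (simp add: IQ add.assoc)
    qed
    then have "d \<otimes> (t \<otimes> U) [^] (p ^ j) \<in> frob_power R ?I (p ^ j)" if "e0 + f0 \<le> j" for j
      using that le_add_diff_inverse2[of f0 j] by (metis add_leD2 add_le_imp_le_diff)
    then show "t \<otimes> U \<in> ?T ?I"
      unfolding tight_closure_def using d tc Uc by blast
  qed
  then show ?thesis unfolding satisfies_LC_star_iff using carr(11) by blast
qed

end

context noetherian_graded_p
begin

lemma lc_step_exists:
  assumes J: "homogeneous_ideal R G J" and y: "y \<in> G e" and I: "I = J <+>\<^bsub>R\<^esub> (PIdl y)"
    and d: "krull_dim R = enat d" and ht: "enat d \<le> ideal_height R (colon_elem R J y) + 1"
  shows "\<exists>z n h C \<Gamma> w \<alpha>. lc_step R G p J I y z e n h C \<Gamma> w \<alpha>"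
proof -
  let ?A = "colon_elem R J y"
  have hA: "homogeneous_ideal R G ?A" by (rule homogeneous_colon[OF J y])
  have "\<exists>n z. 1 \<le> n \<and> z \<in> G n \<and> (\<forall>g\<in>ge 1. \<exists>k::nat. g [^] k \<in> ?A <+>\<^bsub>R\<^esub> (PIdl z))"
  proof (rule parameter_exists[OF hA])
    fix P Q assume "hprime P" "hprime Q" "?A \<subseteq> P" "P \<subset> Q" "Q \<subset> ge 1"
    then show False
      using height_no_chain[OF d ht, of P Q "ge 1"] hprimeD(2) ge_1_hprime by blast
  qed
  then obtain n z where z: "1 \<le> n" "z \<in> G n" and zk: "\<forall>g\<in>ge 1. \<exists>k::nat. g [^] k \<in> ?A <+>\<^bsub>R\<^esub> (PIdl z)"
    by auto
  note S = add_principal[OF homogeneous_ideal[OF hA] grade_carrier[OF z(2)]]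
  obtain \<Gamma> C where \<Gamma>: "irrelevant_gens \<Gamma> C" using irrelevant_gens_exist by auto
  note \<Gamma>D = irrelevant_gensD[OF \<Gamma>]
  obtain k :: "'a \<Rightarrow> nat" where k: "\<And>g. g \<in> ge 1 \<Longrightarrow> g [^] k g \<in> ?A <+>\<^bsub>R\<^esub> (PIdl z)"
    using zk by metis
  \<comment> \<open>One exponent for all generators, padded to a power of p so that Frobenius can be
    applied to the resulting equations.\<close>
  define h where "h = Max (insert 0 (k ` fst ` \<Gamma>))"
  have "\<exists>v\<in>?A. \<exists>a\<in>carrier R. g [^] (p ^ h) = v \<oplus> a \<otimes> z" if g: "(g, m) \<in> \<Gamma>" for g m
  proof -
    have gc: "g \<in> carrier R" by (rule \<Gamma>D(5)[OF g])
    have "k g \<le> h" unfolding h_def using \<Gamma>D(1) g by (intro Max_ge) force+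
    also have "h \<le> p ^ h" by (rule le_p_pow)
    finally have "g [^] (p ^ h) = g [^] (p ^ h - k g) \<otimes> g [^] k g"
      using gc by (simp add: nat_pow_mult)
    also have "\<dots> \<in> ?A <+>\<^bsub>R\<^esub> (PIdl z)"
      using gc by (intro ideal_props(6)[OF S(1)] k \<Gamma>D(6)[OF g]) simp
    finally show ?thesis unfolding S(4) .
  qed
  then have "\<forall>g\<in>fst ` \<Gamma>. \<exists>v a. v \<in> ?A \<and> a \<in> carrier R \<and> g [^] (p ^ h) = v \<oplus> a \<otimes> z" by fastforce
  then obtain w \<alpha> where w: "\<forall>g\<in>fst ` \<Gamma>. w g \<in> ?A \<and> \<alpha> g \<in> carrier R \<and> g [^] (p ^ h) = w g \<oplus> \<alpha> g \<otimes> z"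
    by metis
  have "lc_step R G p J I y z e n h C \<Gamma> w \<alpha>"
  proof (unfold_locales, fact J, fact y, fact I, fact z(1), fact z(2), fact \<Gamma>)
    fix g m assume "(g, m) \<in> \<Gamma>"
    then have "g \<in> fst ` \<Gamma>" by force
    then show "w g \<in> ?A" "\<alpha> g \<in> carrier R" "g [^] (p ^ h) = w g \<oplus> \<alpha> g \<otimes> z" using w by auto
  qed
  then show ?thesis by blast
qed

end

text \<open>The additive order of 1 is the same in R and in \<open>G 0\<close>, and a proper
  factorization of it would produce zero divisors in the field \<open>G 0\<close>.\<close>

lemma (in noetherian_graded) ring_char_prime:
  assumes p: "ring_char (R\<lparr>carrier := G 0\<rparr>) = p" "p > 0"
  shows "cring_char_p R p"
proof -
  let ?z = "\<lambda>n::nat. [n] \<cdot> \<one> = \<zero>"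
  have pow: "add_pow (R\<lparr>carrier := G 0\<rparr>) (n::nat) \<one> = [n] \<cdot> \<one>" for n
    by (simp add: add_pow_def nat_pow_def)
  have ex: "\<exists>n>0. ?z n" and pL: "p = (LEAST n. 0 < n \<and> ?z n)"
    using p unfolding ring_char_def by (auto simp: pow split: if_splits)
  have pz: "0 < p" "?z p" using LeastI_ex[OF ex] by (auto simp: pL)
  have min: "\<not> ?z n" if "0 < n" "n < p" for n using not_less_Least that pL by blast
  have inG: "[n] \<cdot> \<one> \<in> G 0" for n :: nat
    by (induction n) (auto intro: grade_zero grade_one grade_add)
  have "\<one> \<noteq> \<zero>" using subfieldE(6)[OF field_0] .
  then have "p \<noteq> 1" using pz(2) by auto
  moreover have "\<not> a dvd p" if a: "a \<in> {2..<p}" for a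
  proof
    assume "a dvd p"
    then obtain b where b: "p = a * b" by (auto simp: dvd_def)
    have ab: "0 < a" "a < p" "0 < b" "b < p" using a b pz(1) by (auto intro: Nat.gr0I)
    have "([a] \<cdot> \<one>) \<otimes> ([b] \<cdot> \<one>) = [a] \<cdot> ([b] \<cdot> \<one>)" by (simp add: add_pow_ldistr)
    also have "\<dots> = [p] \<cdot> \<one>" using add.nat_pow_pow[of \<one> a b] b by (simp add: mult.commute)
    also have "\<dots> = \<zero>" by (rule pz(2))
    finally have "?z a \<or> ?z b" by (rule subfieldE(5)[OF field_0 inG inG])
    then show False using min ab by auto
  qed
  ultimately have "prime p" unfolding prime_nat_iff' using pz(1) by auto
  then show ?thesis using pz(2) by unfold_locales
qed

theorem theorem2p3:
  fixes R :: "('a, 'b) ring_scheme"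
    and G :: "nat \<Rightarrow> 'a set"
    and x :: "nat \<Rightarrow> 'a" and y :: 'a
    and I J :: "'a set"
    and d n e p :: nat
  assumes "cring R"
    and "noetherian_ring R"
    and "graded_ring R G"
    and "subfield (G 0) R"
    and "ring_char (R\<lparr>carrier := G 0\<rparr>) = p"
    and "p > 0"
    and "krull_dim R = enat d"
    and "x ` {1..n} \<subseteq> carrier R"
    and "J = Idl\<^bsub>R\<^esub> (x ` {1..n})"
    and "homogeneous_ideal R G J"
    and "y \<in> G e"
    and "I = J <+>\<^bsub>R\<^esub> (PIdl\<^bsub>R\<^esub> y)"
    and "enat d \<le> ideal_height R (colon_elem R J y) + 1"
  shows "(satisfies_LC R G p J \<longrightarrow> satisfies_LC R G p I) \<and>
         (satisfies_LC_star R G p J \<longrightarrow> satisfies_LC_star R G p I)"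
proof -
  interpret noetherian_graded R G
    using assms(1-4)
    by (intro noetherian_graded.intro graded_cring.intro noetherian_graded_axioms.intro)
  interpret cring_char_p R p by (rule ring_char_prime[OF assms(5,6)])
  interpret noetherian_graded_p R G p ..
  obtain z m h C \<Gamma> w \<alpha> where "lc_step R G p J I y z e m h C \<Gamma> w \<alpha>"
    using lc_step_exists[OF assms(10-12) assms(7) assms(13)] by blast
  then interpret lc_step R G p J I y z e m h C \<Gamma> w \<alpha> .
  show ?thesis using LC_step LC_star_step by blast
qed

end
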